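(* There exists $\varepsilon_0>0$ such that for every $\varepsilon\in(0,\varepsilon_0)$ there is $\gamma_0(\varepsilon)\in(1,\infty)$ such that the following hold, and $\gamma_0(\varepsilon)\to1$ as $\varepsilon\to0$: (a) the symmetric state (S2), $\Psi=(1+\gamma)^{-1/2}(\eta_\varepsilon,\eta_\varepsilon)$, is a global minimizer of the energy $G_\varepsilon$ in the energy space with symmetry $\mathcal{E}_s$ if $\gamma\in(0,\gamma_0(\varepsilon)]$, and a saddle point of $G_\varepsilon$ in $\mathcal{E}_s$ if $\gamma\in(\gamma_0(\varepsilon),\infty)$; (b) if $\gamma\in(\gamma_0(\varepsilon),\infty)$, there are two domain wall states (S3) that are global minimizers of $G_\varepsilon$ in $\mathcal{E}_s$: one satisfies $\psi_1(x)>\psi_2(x)>0$ for all $x>0$, and the other one is obtained from it by the transformation $\psi_1\leftrightarrow\psi_2$.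
   Context: $L^{2,1}(\mathbb{R})=\{f\in L^2(\mathbb{R}):|x|f\in L^2(\mathbb{R})\}$, $\mathcal{E}=H^1(\mathbb{R};\mathbb{R}^2)\cap L^{2,1}(\mathbb{R};\mathbb{R}^2)$, and $\mathcal{E}_s=\{\Psi=(\psi_1,\psi_2)\in\mathcal{E}:\psi_1(x)=\psi_2(-x),\ x\in\mathbb{R}\}$. For $\gamma>0$ and $\Psi\in\mathcal{E}$, $$G_\varepsilon(\Psi)=\frac12\int_{\mathbb{R}}\Big[\varepsilon^2(\psi_1')^2+\varepsilon^2(\psi_2')^2+(x^2-1)(\psi_1^2+\psi_2^2)+\tfrac12(\psi_1^2+\psi_2^2)^2+(\gamma-1)\psi_1^2\psi_2^2\Big]dx,$$ whose Euler--Lagrange equations are $$-\varepsilon^2\psi_1''+x^2\psi_1+(\psi_1^2+\gamma\psi_2^2-1)\psi_1=0,\qquad -\varepsilon^2\psi_2''+x^2\psi_2+(\gamma\psi_1^2+\psi_2^2-1)\psi_2=0.$$ For small $\varepsilon>0$, $\eta_\varepsilon\in H^1(\mathbb{R})\cap L^{2,1}(\mathbb{R})$ is the positive solution of $\varepsilon^2\eta_\varepsilon''+(1-x^2-\eta_\varepsilon^2)\eta_\varepsilon=0$ on $\mathbb{R}$. A domain wall state is a solution $\Psi=(\psi_1,\psi_2)$ of the Euler--Lagrange equations with $\psi_1(x)=\psi_2(-x)$ for all $x\in\mathbb{R}$ but $\psi_1\not\equiv\psi_2$. A saddle point of $G_\varepsilon$ in $\mathcal{E}_s$ is a critical point in $\mathcal{E}_s$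 at which the second variation of $G_\varepsilon$, restricted to perturbations in $\mathcal{E}_s$, takes both positive and negative values. *)

theory Defs
  imports "HOL-Analysis.Analysis"
begin

section \<open>Function spaces on the real line\<close>

definition L2_space :: "(real \<Rightarrow> real) set" where
  "L2_space = {f \<in> borel_measurable lborel. integrable lborel (\<lambda>x. (f x)\<^sup>2)}"

definition L21_space :: "(real \<Rightarrow> real) set" where
  "L21_space = {f \<in> L2_space. (\<lambda>x. \<bar>x\<bar> * f x) \<in> L2_space}"

definition test_functions :: "(real \<Rightarrow> real) set" where
  "test_functions = {\<phi>. (\<forall>n x. (deriv ^^ n) \<phi> field_differentiable at x) \<and>
                          compact (closure {x. \<phi> x \<noteq> 0})}"

definition has_weak_derivative :: "(real \<Rightarrow> real) \<Rightarrow> (real \<Rightarrow> real) \<Rightarrow> bool" where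
  "has_weak_derivative f g \<longleftrightarrow>
     (\<forall>\<phi>\<in>test_functions.
        (\<integral>x. f x * deriv \<phi> x \<partial>lborel) = - (\<integral>x. g x * \<phi> x \<partial>lborel))"

text \<open>Every class in $H^1(R)$ has exactly one continuous representative; the space is modelled
  by these representatives, so that pointwise conditions on its elements are meaningful.\<close>

definition H1_space :: "(real \<Rightarrow> real) set" where
  "H1_space = {f \<in> L2_space. continuous_on UNIV f \<and>
                             (\<exists>g\<in>L2_space. has_weak_derivative f g)}"

text \<open>The weak derivative is determined only up to a null set; the choice does not affect
  integrals.\<close>

definition weak_deriv :: "(real \<Rightarrow> real) \<Rightarrow> real \<Rightarrow> real" where
  "weak_deriv f = (SOME g. g \<in> L2_space \<and> has_weak_derivative f g)"

type_synonym state = "(real \<Rightarrow> real) \<times> (real \<Rightarrow> real)"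

definition energy_space :: "state set" where
  "energy_space = (H1_space \<inter> L21_space) \<times> (H1_space \<inter> L21_space)"

definition sym_energy_space :: "state set" where
  "sym_energy_space = {(\<psi>1, \<psi>2) \<in> energy_space. \<forall>x. \<psi>1 x = \<psi>2 (- x)}"

section \<open>The energy and its variations\<close>

fun energy :: "real \<Rightarrow> real \<Rightarrow> state \<Rightarrow> real" where
  "energy \<epsilon> \<gamma> (\<psi>1, \<psi>2) = 1 / 2 * (\<integral>x.
       \<epsilon>\<^sup>2 * (weak_deriv \<psi>1 x)\<^sup>2 + \<epsilon>\<^sup>2 * (weak_deriv \<psi>2 x)\<^sup>2
     + (x\<^sup>2 - 1) * ((\<psi>1 x)\<^sup>2 + (\<psi>2 x)\<^sup>2)
     + 1 / 2 * ((\<psi>1 x)\<^sup>2 + (\<psi>2 x)\<^sup>2)\<^sup>2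
     + (\<gamma> - 1) * (\<psi>1 x)\<^sup>2 * (\<psi>2 x)\<^sup>2 \<partial>lborel)"

definition global_minimizer :: "(state \<Rightarrow> real) \<Rightarrow> state set \<Rightarrow> state \<Rightarrow> bool" where
  "global_minimizer F X \<Psi> \<longleftrightarrow> \<Psi> \<in> X \<and> (\<forall>\<Phi>\<in>X. F \<Psi> \<le> F \<Phi>)"

fun perturb :: "state \<Rightarrow> state \<Rightarrow> real \<Rightarrow> state" where
  "perturb (\<psi>1, \<psi>2) (\<phi>1, \<phi>2) t = (\<lambda>x. \<psi>1 x + t * \<phi>1 x, \<lambda>x. \<psi>2 x + t * \<phi>2 x)"

definition critical_point :: "(state \<Rightarrow> real) \<Rightarrow> state set \<Rightarrow> state \<Rightarrow> bool" where
  "critical_point F X \<Psi> \<longleftrightarrow>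
     \<Psi> \<in> X \<and> (\<forall>\<Phi>\<in>X. ((\<lambda>t. F (perturb \<Psi> \<Phi> t)) has_real_derivative 0) (at 0))"

text \<open>On the energy space the energy is a quartic polynomial in the parameter \<open>t\<close>, so these
  derivatives exist.\<close>

definition second_variation :: "(state \<Rightarrow> real) \<Rightarrow> state \<Rightarrow> state \<Rightarrow> real" where
  "second_variation F \<Psi> \<Phi> = (deriv ^^ 2) (\<lambda>t. F (perturb \<Psi> \<Phi> t)) 0"

definition saddle_point :: "(state \<Rightarrow> real) \<Rightarrow> state set \<Rightarrow> state \<Rightarrow> bool" where
  "saddle_point F X \<Psi> \<longleftrightarrow> critical_point F X \<Psi> \<and>
     (\<exists>\<Phi>\<in>X. second_variation F \<Psi> \<Phi> > 0) \<and> (\<exists>\<Phi>\<in>X. second_variation F \<Psi> \<Phi> < 0)"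

section \<open>Stationary states\<close>

definition has_second_derivative :: "(real \<Rightarrow> real) \<Rightarrow> (real \<Rightarrow> real) \<Rightarrow> bool" where
  "has_second_derivative f f2 \<longleftrightarrow>
     (\<exists>f1. (\<forall>x. (f has_real_derivative f1 x) (at x)) \<and>
           (\<forall>x. (f1 has_real_derivative f2 x) (at x)))"

fun euler_lagrange :: "real \<Rightarrow> real \<Rightarrow> state \<Rightarrow> bool" where
  "euler_lagrange \<epsilon> \<gamma> (\<psi>1, \<psi>2) \<longleftrightarrow>
     (\<exists>\<psi>1'' \<psi>2''. has_second_derivative \<psi>1 \<psi>1'' \<and> has_second_derivative \<psi>2 \<psi>2'' \<and>
        (\<forall>x. - \<epsilon>\<^sup>2 * \<psi>1'' x + x\<^sup>2 * \<psi>1 x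
               + ((\<psi>1 x)\<^sup>2 + \<gamma> * (\<psi>2 x)\<^sup>2 - 1) * \<psi>1 x = 0) \<and>
        (\<forall>x. - \<epsilon>\<^sup>2 * \<psi>2'' x + x\<^sup>2 * \<psi>2 x
               + (\<gamma> * (\<psi>1 x)\<^sup>2 + (\<psi>2 x)\<^sup>2 - 1) * \<psi>2 x = 0))"

definition positive_scalar_state :: "real \<Rightarrow> (real \<Rightarrow> real) \<Rightarrow> bool" where
  "positive_scalar_state \<epsilon> \<eta> \<longleftrightarrow>
     \<eta> \<in> H1_space \<inter> L21_space \<and> (\<forall>x. \<eta> x > 0) \<and>
     (\<exists>\<eta>''. has_second_derivative \<eta> \<eta>'' \<and>
        (\<forall>x. \<epsilon>\<^sup>2 * \<eta>'' x + (1 - x\<^sup>2 - (\<eta> x)\<^sup>2) * \<eta> x = 0))"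

definition eta :: "real \<Rightarrow> real \<Rightarrow> real" where
  "eta \<epsilon> = (THE \<eta>. positive_scalar_state \<epsilon> \<eta>)"

definition symmetric_state :: "real \<Rightarrow> real \<Rightarrow> state" where
  "symmetric_state \<epsilon> \<gamma> =
     (\<lambda>x. (1 + \<gamma>) powr (- 1 / 2) * eta \<epsilon> x, \<lambda>x. (1 + \<gamma>) powr (- 1 / 2) * eta \<epsilon> x)"

fun domain_wall_state :: "real \<Rightarrow> real \<Rightarrow> state \<Rightarrow> bool" where
  "domain_wall_state \<epsilon> \<gamma> (\<psi>1, \<psi>2) \<longleftrightarrow>
     euler_lagrange \<epsilon> \<gamma> (\<psi>1, \<psi>2) \<and> (\<forall>x. \<psi>1 x = \<psi>2 (- x)) \<and> \<psi>1 \<noteq> \<psi>2"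

end

theory Submission
  imports Defs "HOL-Complex_Analysis.Great_Picard"
begin

text \<open>Write \<open>a\<close> and \<open>b\<close> for the even and odd parts of \<open>(1 + \<gamma>)\<^sup>1\<^sup>/\<^sup>2 \<psi>\<^sub>1\<close> and
  \<open>Q u = \<integral> \<epsilon>\<^sup>2 u'\<^sup>2 + (x\<^sup>2 - 1 + \<eta>\<^sup>2) u\<^sup>2\<close>, a nonnegative form that vanishes at \<open>\<eta>\<close>. Then \<open>(1 + \<gamma>) G\<close> equals
  \<open>Q a + Q b + 1/2 \<integral> (\<eta>\<^sup>2 - a\<^sup>2 - b\<^sup>2)\<^sup>2 - \<mu> \<integral> a\<^sup>2 b\<^sup>2 - 1/2 \<integral> \<eta>\<^sup>4\<close> with \<open>\<mu> = 2(\<gamma> - 1)/(\<gamma> + 1) < 2\<close>.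
  Let \<open>\<Lambda>\<close> be the infimum of \<open>Q b / \<integral> \<eta>\<^sup>2 b\<^sup>2\<close> over odd \<open>b\<close>, and let \<open>\<gamma>\<^sub>0\<close> correspond to \<open>\<mu> = \<Lambda>\<close>.
  If \<open>\<mu> \<le> \<Lambda> \<le> 2\<close>, the integrand left after \<open>Q b \<ge> \<Lambda> \<integral> \<eta>\<^sup>2 b\<^sup>2\<close> is pointwise nonnegative, so
  \<open>(\<eta>, 0)\<close> is a global minimizer; if \<open>\<mu> > \<Lambda>\<close>, an odd perturbation lowers the energy. The trial
  function \<open>b = \<eta> arctan x\<close> gives \<open>\<Lambda> = O(\<epsilon>\<^sup>2)\<close>.
  Minimizers are obtained by the direct method. Replacing \<open>(\<psi>\<^sub>1, \<psi>\<^sub>2)\<close> for \<open>x > 0\<close> by the maximum and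
  the minimum of \<open>\<bar>\<psi>\<^sub>1\<bar>, \<bar>\<psi>\<^sub>2\<bar>\<close> does not increase the energy, so a minimizer may be taken ordered;
  uniqueness for linear second-order equations makes the order strict. At \<open>\<gamma> = 0\<close> the two
  components decouple, which yields \<open>\<eta>\<close> itself.\<close>

section \<open>Weak derivatives and indefinite integrals\<close>

text \<open>The factor (1 + \<gamma>)^(1/2) moves every symmetric state to the same pair (\<eta>,
  0), so \<gamma> acts only through \<mu>, which increases with \<gamma>; hence one number separates
  the two regimes. The weight \<eta>^2 in the quotient is the one by which \<mu> multiplies b^2 to
  second order at (\<eta>, 0). With it, the remaining integrand is a polynomial in \<eta>^2, a^2 and
  b^2 that can be tested point by point. A second-order condition therefore decides global
  minimality, and it does so at \<mu> = \<Lambda> as well. No eigenfunction is constructed: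
  \<Lambda> is used only as an infimum, so its positivity has to come from a coercivity estimate,
  which odd functions satisfy because they vanish at 0. The other obstacle is the unbounded line. No
  decay rate of \<eta> is derived; boundary terms are controlled by the sign of \<eta>' outside
  [-1,1] or removed by cutoffs.\<close>

definition flat :: "nat \<Rightarrow> real \<Rightarrow> real" where
  "flat n x = (if x > 0 then exp (- 1 / x) / x ^ n else 0)"

text \<open>The powers of 1/x make the family closed under differentiation up to linear
  combinations. At the origin, substituting y = 1/x turns the right difference quotient into y^(n+1)
  / exp y.\<close>

lemma flat_has_derivative:
  "(flat n has_real_derivative (flat (n + 2) x - real n * flat (n + 1) x)) (at x)"
proof -
  consider "x > 0" | "x < 0" | "x = 0" by linarith
  then show ?thesis
  proof cases
    case 1
    have "((\<lambda>x. exp (- 1 / x) / x ^ n) has_real_derivative (flat (n + 2) x - real n * flat (n + 1) x)) (at x)"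
      using 1
      apply (auto intro!: derivative_eq_intros simp: flat_def)
      apply (cases n)
       apply (auto simp: field_simps power2_eq_square)
      done
    then show ?thesis
      by (rule has_field_derivative_transform_within_open[of _ _ _ "{0<..}"])
        (use 1 in \<open>auto simp: flat_def\<close>)
  next
    case 2
    have "((\<lambda>x. 0) has_real_derivative (flat (n + 2) x - real n * flat (n + 1) x)) (at x)"
      using 2 by (auto simp: flat_def)
    then show ?thesis
      by (rule has_field_derivative_transform_within_open[of _ _ _ "{..<0}"])
        (use 2 in \<open>auto simp: flat_def\<close>)
  next
    case 3
    have l: "((\<lambda>y. flat n y / y) \<longlongrightarrow> 0) (at_left 0)"
      by (rule tendsto_eventually) (auto simp: eventually_at_filter flat_def)
    have "(((\<lambda>y. y ^ (n + 1) / exp y) \<circ> inverse) \<longlongrightarrow> (0::real)) (at_right 0)"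
      unfolding o_def
      by (rule filterlim_compose[OF tendsto_power_div_exp_0 filterlim_inverse_at_top_right])
    moreover have "\<forall>\<^sub>F y in at_right 0. ((\<lambda>y. y ^ (n + 1) / exp y) \<circ> inverse) y = flat n y / (y::real)"
      by (auto simp: eventually_at_filter flat_def exp_minus field_simps)
    ultimately have r: "((\<lambda>y. flat n y / y) \<longlongrightarrow> 0) (at_right 0)"
      by (rule Lim_transform_eventually)
    show ?thesis
      using filterlim_split_at[OF l r] 3 by (simp add: has_field_derivative_iff flat_def)
  qed
qed

text \<open>Membership in \<open>test_functions\<close> asks for differentiability of every iterate
  of \<open>deriv\<close>. An algebra that contains a derivative of each member yields this by
  induction, with no formula for higher derivatives.\<close>

inductive flat_algebra :: "(real \<Rightarrow> real) \<Rightarrow> bool" where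
  flat: "flat_algebra (\<lambda>x. flat n (c * x + d))"
| const: "flat_algebra (\<lambda>x. c)"
| add: "flat_algebra f \<Longrightarrow> flat_algebra g \<Longrightarrow> flat_algebra (\<lambda>x. f x + g x)"
| mult: "flat_algebra f \<Longrightarrow> flat_algebra g \<Longrightarrow> flat_algebra (\<lambda>x. f x * g x)"

lemma flat_algebra_has_derivative:
  assumes "flat_algebra f"
  shows "\<exists>f'. flat_algebra f' \<and> (\<forall>x. (f has_real_derivative f' x) (at x))"
  using assms
proof induction
  case (flat n c d)
  let ?f = "\<lambda>x. (flat (n + 2) (c * x + d) + (- real n) * flat (n + 1) (c * x + d)) * c"
  have "flat_algebra ?f"
    by (intro flat_algebra.intros)
  moreover have "((\<lambda>x. flat n (c * x + d)) has_real_derivative ?f x) (at x)" for x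
    by (rule DERIV_cong[OF DERIV_chain2[OF flat_has_derivative]])
      (auto intro!: derivative_eq_intros)
  ultimately show ?case by blast
next
  case (const c)
  then show ?case
    by (intro exI[of _ "\<lambda>x. 0"]) (auto intro: flat_algebra.intros)
next
  case (add f g)
  then obtain f' g' where *: "flat_algebra f'" "flat_algebra g'"
    "\<And>x. (f has_real_derivative f' x) (at x)" "\<And>x. (g has_real_derivative g' x) (at x)"
    by blast
  then show ?case
    by (intro exI[of _ "\<lambda>x. f' x + g' x"]) (auto intro!: flat_algebra.intros derivative_eq_intros)
next
  case (mult f g)
  then obtain f' g' where *: "flat_algebra f'" "flat_algebra g'"
    "\<And>x. (f has_real_derivative f' x) (at x)" "\<And>x. (g has_real_derivative g' x) (at x)"
    by blast
  then show ?case using mult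
    by (intro exI[of _ "\<lambda>x. f' x * g x + g' x * f x"])
      (auto intro!: flat_algebra.intros derivative_eq_intros)
qed

lemma flat_algebra_funpow_deriv: "flat_algebra f \<Longrightarrow> flat_algebra ((deriv ^^ n) f)"
proof (induction n)
  case (Suc n)
  then obtain f' where "flat_algebra f'" "\<forall>x. ((deriv ^^ n) f has_real_derivative f' x) (at x)"
    using flat_algebra_has_derivative by blast
  then have "deriv ((deriv ^^ n) f) = f'"
    by (auto intro!: ext DERIV_imp_deriv)
  then show ?case using \<open>flat_algebra f'\<close> by simp
qed simp

lemma flat_algebra_continuous: "flat_algebra f \<Longrightarrow> continuous_on S f"
  by (meson DERIV_continuous continuous_at_imp_continuous_on flat_algebra_has_derivative)

text \<open>Only the derivative has to lie in the algebra: the cutoffs below are differences of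
  \<open>smooth_step\<close>, which is an integral of \<open>bump\<close>.\<close>

lemma test_functionI:
  assumes "\<And>x. (\<phi> has_real_derivative \<psi> x) (at x)" "flat_algebra \<psi>"
    and "\<And>x. x \<notin> {a..b} \<Longrightarrow> \<phi> x = 0"
  shows "\<phi> \<in> test_functions"
proof -
  have d: "deriv \<phi> = \<psi>"
    using assms(1) by (auto intro!: ext DERIV_imp_deriv)
  have "(deriv ^^ n) \<phi> field_differentiable at x" for n x
  proof (cases n)
    case 0
    then show ?thesis using assms(1) by (auto simp: field_differentiable_def)
  next
    case (Suc m)
    have "(deriv ^^ n) \<phi> = (deriv ^^ m) \<psi>"
      by (simp add: Suc funpow_swap1 d)
    then show ?thesis
      using flat_algebra_has_derivative[OF flat_algebra_funpow_deriv[OF assms(2), of m]]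
      by (auto simp: field_differentiable_def)
  qed
  moreover have "{x. \<phi> x \<noteq> 0} \<subseteq> {a..b}"
    using assms(3) by blast
  then have "bounded {x. \<phi> x \<noteq> 0}"
    by (rule bounded_subset[rotated]) simp
  ultimately show ?thesis
    by (simp add: test_functions_def)
qed

text \<open>A nonnegative kernel of mass one supported in [0,1]. Its rescaled translates form an
  approximate identity that closes in on a point from the right.\<close>

definition bump :: "real \<Rightarrow> real" where
  "bump x = flat 0 x * flat 0 (1 - x) / integral {0..1} (\<lambda>x. flat 0 x * flat 0 (1 - x))"

lemma flat_algebra_bump: "flat_algebra bump"
proof -
  define c where "c = 1 / integral {0..1} (\<lambda>x. flat 0 x * flat 0 (1 - x))"
  have "flat_algebra (\<lambda>x. c * (flat 0 (1 * x + 0) * flat 0 ((- 1) * x + 1)))"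
    by (intro flat_algebra.intros)
  then show ?thesis
    by (simp add: bump_def[abs_def] c_def)
qed

lemma bump_outside: "x \<notin> {0<..<1} \<Longrightarrow> bump x = 0"
  by (auto simp: bump_def flat_def)

lemma flat_nonneg: "0 \<le> flat n x"
  by (simp add: flat_def)

lemma bump_nonneg: "0 \<le> bump x"
  unfolding bump_def
  by (intro divide_nonneg_nonneg mult_nonneg_nonneg flat_nonneg integral_nonneg
      integrable_continuous_interval continuous_intros
      continuous_on_compose2[OF flat_algebra_continuous[OF flat_algebra.flat[of 0 1 0], simplified, of UNIV]]) auto

lemma bump_has_integral: "(bump has_integral 1) {0..1}"
proof -
  let ?k = "\<lambda>x. flat 0 x * flat 0 (1 - x)"
  have c: "continuous_on {0..1} ?k"
    using flat_algebra_continuous[OF flat_algebra.mult[OF flat_algebra.flat[of 0 1 0] flat_algebra.flat[of 0 "-1" 1]]]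
    by simp
  have i: "(?k has_integral integral {0..1} ?k) {0..1}"
    using c by (simp add: integrable_continuous_interval integrable_integral)
  have "integral {0..1} ?k \<noteq> 0"
  proof
    assume "integral {0..1} ?k = 0"
    then have "(?k has_integral 0) (cbox 0 1)" using i by (simp add: cbox_interval)
    then have "?k (1/2) = 0"
      by (intro has_integral_0_cbox_imp_0[OF _ _ \<open>(?k has_integral 0) (cbox 0 1)\<close>])
        (use c in \<open>auto simp: flat_nonneg\<close>)
    then show False by (simp add: flat_def)
  qed
  then show ?thesis
    using has_integral_divide[OF i, of "integral {0..1} ?k"] by (simp add: bump_def[abs_def])
qed

definition smooth_step :: "real \<Rightarrow> real" where
  "smooth_step x = integral {0..x} bump"

lemma bump_integrable_on: "bump integrable_on {a..b}"
  by (intro integrable_continuous_interval flat_algebra_continuous flat_algebra_bump)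

lemma smooth_step_nonpos: "x \<le> 0 \<Longrightarrow> smooth_step x = 0"
  by (cases "x = 0") (auto simp: smooth_step_def)

lemma smooth_step_ge_1: "x \<ge> 1 \<Longrightarrow> smooth_step x = 1"
proof -
  assume "x \<ge> 1"
  have "integral {0..1} bump + integral {1..x} bump = integral {0..x} bump"
    using \<open>x \<ge> 1\<close> by (intro Henstock_Kurzweil_Integration.integral_combine bump_integrable_on) auto
  moreover have "integral {1..x} bump = integral {1..x} (\<lambda>x. 0)"
    by (intro integral_cong bump_outside) auto
  ultimately show ?thesis
    using bump_has_integral by (simp add: smooth_step_def integral_unique)
qed

lemma smooth_step_has_derivative: "(smooth_step has_real_derivative bump x) (at x)"
proof (cases "x > 0")
  case True
  have "((\<lambda>u. integral {0..u} bump) has_real_derivative bump x) (at x within {0..x + 1})"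
    by (intro integral_has_real_derivative flat_algebra_continuous flat_algebra_bump) (use True in auto)
  then have "((\<lambda>u. integral {0..u} bump) has_real_derivative bump x) (at x)"
    using True by (simp add: at_within_Icc_at)
  then show ?thesis by (simp add: smooth_step_def[abs_def])
next
  case False
  \<comment> \<open>For x \<le> 0 the interval \<open>{0..u}\<close> degenerates to the left of 0,
    so the integral is based at x - 1. The value is the same because \<open>bump\<close> vanishes on
    the negative axis.\<close>
  have *: "((\<lambda>u. integral {-1+x..u} bump) has_real_derivative bump x) (at x within {-1+x..x + 1})"
    by (intro integral_has_real_derivative flat_algebra_continuous flat_algebra_bump) auto
  have d: "((\<lambda>u. integral {-1+x..u} bump) has_real_derivative bump x) (at x)"
    using * at_within_Icc_at[of "-1+x" x "x+1"] by simp
  have eq: "integral {-1+x..u} bump = smooth_step u" if "u \<in> {x-1<..}" for u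
  proof (cases "u \<ge> 0")
    case True
    have "integral {-1+x..0} bump + integral {0..u} bump = integral {-1+x..u} bump"
      using True False by (intro Henstock_Kurzweil_Integration.integral_combine bump_integrable_on) auto
    moreover have "integral {-1+x..0} bump = integral {-1+x..0} (\<lambda>x. 0)"
      by (intro integral_cong bump_outside) auto
    ultimately show ?thesis by (simp add: smooth_step_def)
  next
    case nu: False
    have "integral {-1+x..u} bump = integral {-1+x..u} (\<lambda>x. 0)"
      using nu by (intro integral_cong bump_outside) auto
    then show ?thesis using nu by (simp add: smooth_step_def)
  qed
  show ?thesis
    by (rule has_field_derivative_transform_within_open[OF d open_greaterThan[of "x - 1"] _ eq]) auto
qed

lemma smooth_step_bounds: "0 \<le> smooth_step x" "smooth_step x \<le> 1"
proof -
  have m: "mono smooth_step"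
    by (rule monoI) (metis DERIV_nonneg_imp_nondecreasing bump_nonneg smooth_step_has_derivative)
  show "0 \<le> smooth_step x"
    using monoD[OF m, of "min 0 x" x] smooth_step_nonpos[of "min 0 x"] by simp
  show "smooth_step x \<le> 1"
    using monoD[OF m, of x "max 1 x"] smooth_step_ge_1[of "max 1 x"] by simp
qed

section \<open>Indefinite integrals and weak derivatives\<close>

text \<open>Local absolute continuity of \<open>f\<close> with density \<open>g\<close>, expressed
  by the fundamental theorem of calculus. Lebesgue integrability on intervals is recorded next to
  the gauge integral: the first feeds dominated convergence, the second gives additivity over
  adjacent intervals.\<close>

definition primitive :: "(real \<Rightarrow> real) \<Rightarrow> (real \<Rightarrow> real) \<Rightarrow> bool" where
  "primitive f g \<longleftrightarrow> g \<in> borel_measurable borel \<and>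
     (\<forall>a b. a \<le> b \<longrightarrow> set_integrable lborel {a..b} g \<and> (g has_integral (f b - f a)) {a..b})"

lemma primitiveI:
  assumes "g \<in> borel_measurable borel" "\<And>a b. a \<le> b \<Longrightarrow> set_integrable lborel {a..b} g"
    "\<And>a b. a < b \<Longrightarrow> integral {a..b} g = f b - f a"
  shows "primitive f g"
  unfolding primitive_def
proof (intro conjI allI impI)
  fix a b :: real assume ab: "a \<le> b"
  show "(g has_integral (f b - f a)) {a..b}"
  proof (cases "a < b")
    case True
    then show ?thesis
      using assms(3)[of a b] set_borel_integral_eq_integral(1)[OF assms(2)[OF ab]]
      by (simp add: integrable_integral has_integral_iff)
  qed (use ab in \<open>auto simp: has_integral_refl\<close>)
qed (use assms in auto)

lemma primitive_measurable [measurable_dest]: "primitive f g \<Longrightarrow> g \<in> borel_measurable borel"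
  by (simp add: primitive_def)

lemma primitive_set_integrable: "primitive f g \<Longrightarrow> set_integrable lborel {a..b} g"
  by (cases "a \<le> b") (auto simp: primitive_def set_integrable_def)

lemma primitive_has_integral: "primitive f g \<Longrightarrow> a \<le> b \<Longrightarrow> (g has_integral (f b - f a)) {a..b}"
  by (simp add: primitive_def)

lemma primitive_integrable_on: "primitive f g \<Longrightarrow> g integrable_on {a..b}"
  by (meson primitive_set_integrable set_borel_integral_eq_integral(1))

lemma primitive_integral: "primitive f g \<Longrightarrow> a \<le> b \<Longrightarrow> integral {a..b} g = f b - f a"
  by (simp add: primitive_has_integral integral_unique)

lemma primitive_continuous:
  assumes "primitive f g" shows "continuous_on S f"
proof -
  have "isCont f x" for x
  proof -
    have "continuous_on {x-1..x+1} (\<lambda>t. f (x-1) + integral {x-1..t} g)"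
      by (intro continuous_intros indefinite_integral_continuous_1 primitive_integrable_on[OF assms])
    then have "continuous_on {x-1..x+1} f"
      by (rule continuous_on_eq) (use primitive_integral[OF assms] in auto)
    then show ?thesis
      by (rule continuous_on_interior) auto
  qed
  then show ?thesis by (simp add: continuous_at_imp_continuous_on)
qed

lemma primitive_borel [measurable_dest]: "primitive f g \<Longrightarrow> f \<in> borel_measurable borel"
  using primitive_continuous borel_measurable_continuous_onI by blast

lemma integrable_continuous_support:
  fixes h :: "real \<Rightarrow> real"
  assumes "continuous_on UNIV h" "\<And>x. x \<notin> {a..b} \<Longrightarrow> h x = 0"
  shows "integrable lborel h"
proof -
  have "set_integrable lborel {a..b} h"
    using assms(1) by (intro borel_integrable_atLeastAtMost') (auto intro: continuous_on_subset)
  moreover have "(\<lambda>x. indicator {a..b} x *\<^sub>R h x) = h"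
    using assms(2) by (auto simp: indicator_def fun_eq_iff)
  ultimately show ?thesis by (simp add: set_integrable_def)
qed

lemma L2_set_integrable:
  assumes "g \<in> L2_space" shows "set_integrable lborel {a..b} g"
proof -
  have [measurable]: "g \<in> borel_measurable borel" and i: "integrable lborel (\<lambda>x. (g x)\<^sup>2)"
    using assms by (auto simp: L2_space_def)
  have "integrable lborel (\<lambda>x. indicator {a..b} x + (g x)\<^sup>2 :: real)"
    using i by (intro Bochner_Integration.integrable_add) (auto intro: integrable_real_indicator simp: emeasure_lborel_Icc_eq)
  then show ?thesis
    unfolding set_integrable_def
  proof (rule Bochner_Integration.integrable_bound)
    have "\<bar>y\<bar> \<le> 1 + y\<^sup>2" for y :: real
      by (sos)
    then show "AE x in lborel. norm (indicator {a..b} x *\<^sub>R g x) \<le> norm (indicator {a..b} x + (g x)\<^sup>2)"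
      by (intro AE_I2) (auto simp: indicator_def)
  qed auto
qed

lemma integral_bump: "integrable lborel bump" "(\<integral>x. bump x \<partial>lborel) = 1"
proof -
  have b0: "bump x = 0" if "x \<notin> {0..1}" for x using that by (intro bump_outside) auto
  show "integrable lborel bump"
    by (rule integrable_continuous_support[OF flat_algebra_continuous[OF flat_algebra_bump] b0])
  have i: "set_integrable lborel {0..1} bump"
    by (intro borel_integrable_atLeastAtMost' flat_algebra_continuous flat_algebra_bump)
  have "indicator {0..1} x *\<^sub>R bump x = bump x" for x
    by (cases "x \<in> {0..1}") (simp_all add: b0)
  then have "(\<lambda>x. indicator {0..1} x *\<^sub>R bump x) = bump"
    by (rule ext)
  then show "(\<integral>x. bump x \<partial>lborel) = 1"
    using set_borel_integral_eq_integral(2)[OF i] bump_has_integral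
    by (simp add: set_lebesgue_integral_def integral_unique)
qed

lemma bump_measurable [measurable]: "bump \<in> borel_measurable borel"
  by (intro borel_measurable_continuous_onI flat_algebra_continuous flat_algebra_bump)

text \<open>Substituting t = x + s / (n+1) moves the scaling from the kernel into \<open>f\<close>.
  Since \<open>bump\<close> lives on [0,1], only values of \<open>f\<close> on [x, x+1] occur, and
  their bound dominates the integrand.\<close>

lemma integral_scaled_bump_tendsto:
  fixes f :: "real \<Rightarrow> real"
  assumes f: "continuous_on UNIV f"
  shows "integrable lborel (\<lambda>t. f t * (real (Suc n) * bump (real (Suc n) * (t - x))))"
    and "(\<lambda>n. \<integral>t. f t * (real (Suc n) * bump (real (Suc n) * (t - x))) \<partial>lborel) \<longlonglongrightarrow> f x"
proof -
  have cb: "continuous_on UNIV (\<lambda>t. bump (real (Suc n) * (t - x)))" for n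
    by (rule continuous_on_compose2[OF flat_algebra_continuous[OF flat_algebra_bump, of UNIV]])
      (auto intro!: continuous_intros)
  have out: "bump (real (Suc n) * (t - x)) = 0" if "t \<notin> {x..x+1}" for n t
  proof (rule bump_outside, clarsimp)
    assume *: "0 < (1 + real n) * (t - x)" "(1 + real n) * (t - x) < 1"
    then have "t - x > 0" by (simp add: zero_less_mult_iff)
    moreover have "1 * (t - x) \<le> (1 + real n) * (t - x)"
      using \<open>t - x > 0\<close> by (intro mult_right_mono) auto
    ultimately have "1 * (t - x) < 1" using *(2) by (metis le_less_trans)
    then show False using that \<open>t - x > 0\<close> by simp
  qed
  show "integrable lborel (\<lambda>t. f t * (real (Suc n) * bump (real (Suc n) * (t - x))))"
    by (rule integrable_continuous_support[of _ x "x + 1"])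
      (auto intro!: continuous_intros f cb[simplified] simp: out[simplified])
  have eq: "(\<integral>t. f t * (real (Suc n) * bump (real (Suc n) * (t - x))) \<partial>lborel)
      = (\<integral>s. f (x + s / real (Suc n)) * bump s \<partial>lborel)" for n
    by (subst lborel_integral_real_affine[where c = "1 / real (Suc n)" and t = x])
      (auto simp: integral_divide_zero[symmetric] simp del: integral_divide_zero)
  have [measurable]: "f \<in> borel_measurable borel"
    using f by (rule borel_measurable_continuous_onI)
  have "bounded (f ` {x..x+1})"
    by (intro compact_imp_bounded compact_continuous_image continuous_on_subset[OF f]) auto
  then obtain M where M: "\<forall>t\<in>{x..x+1}. \<bar>f t\<bar> \<le> M"
    by (auto simp: bounded_iff)
  have "(\<lambda>n. \<integral>s. f (x + s / real (Suc n)) * bump s \<partial>lborel) \<longlonglongrightarrow> (\<integral>s. f x * bump s \<partial>lborel)"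
  proof (rule integral_dominated_convergence[where w = "\<lambda>s. M * bump s"])
    show "AE s in lborel. (\<lambda>n. f (x + s / real (Suc n)) * bump s) \<longlonglongrightarrow> f x * bump s"
    proof (intro AE_I2 tendsto_intros)
      fix s
      have "(\<lambda>n. x + s / real (Suc n)) \<longlonglongrightarrow> x + 0"
        by (intro tendsto_intros LIMSEQ_Suc lim_const_over_n)
      moreover have "isCont f x" using f by (simp add: continuous_on_eq_continuous_at)
      ultimately show "(\<lambda>n. f (x + s / real (Suc n))) \<longlonglongrightarrow> f x"
        using isCont_tendsto_compose by force
    qed
    show "AE s in lborel. norm (f (x + s / real (Suc n)) * bump s) \<le> M * bump s" for n
    proof (intro AE_I2)
      fix s
      show "norm (f (x + s / real (Suc n)) * bump s) \<le> M * bump s"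
      proof (cases "s \<in> {0<..<1}")
        case True
        then have "s / real (Suc n) \<le> s / 1" by (intro divide_left_mono) auto
        then have "\<bar>f (x + s / real (Suc n))\<bar> \<le> M"
          using True by (intro M[rule_format]) auto
        then show ?thesis
          using bump_nonneg[of s] by (simp add: abs_mult mult_right_mono)
      qed (simp add: bump_outside)
    qed
  qed (use integral_bump in \<open>auto intro!: Bochner_Integration.integrable_mult_right\<close>)
  then show "(\<lambda>n. \<integral>t. f t * (real (Suc n) * bump (real (Suc n) * (t - x))) \<partial>lborel) \<longlonglongrightarrow> f x"
    unfolding eq by (simp add: integral_bump)
qed

text \<open>Testing against smoothed indicators of [x, y] turns the weak identity into the
  fundamental theorem: their derivatives are differences of two approximate identities and recover
  f(x) - f(y), while the indicators themselves recover the integral of g.\<close>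

lemma weak_derivative_imp_primitive:
  assumes f: "continuous_on UNIV f" and g: "g \<in> L2_space" and wd: "has_weak_derivative f g"
  shows "primitive f g"
proof (rule primitiveI)
  show [measurable]: "g \<in> borel_measurable borel" using g by (simp add: L2_space_def)
  show gi: "set_integrable lborel {a..b} g" for a b by (rule L2_set_integrable[OF g])
  fix x y :: real assume xy: "x < y"
  define \<phi> where "\<phi> n t = smooth_step (real (Suc n) * (t - x)) - smooth_step (real (Suc n) * (t - y))" for n t
  define \<psi> where "\<psi> n t = real (Suc n) * bump (real (Suc n) * (t - x)) - real (Suc n) * bump (real (Suc n) * (t - y))" for n t
  have d: "(\<phi> n has_real_derivative \<psi> n t) (at t)" for n t
    unfolding \<phi>_def[abs_def] \<psi>_def
    by (rule derivative_eq_intros DERIV_chain2[OF smooth_step_has_derivative] refl | simp)+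
  have bump_affine: "flat_algebra (\<lambda>t. bump (c * t + d))" for c d
  proof -
    define k where "k = 1 / integral {0..1} (\<lambda>x. flat 0 x * flat 0 (1 - x))"
    have "flat_algebra (\<lambda>t. k * (flat 0 (c * t + d) * flat 0 ((- c) * t + (1 - d))))"
      by (intro flat_algebra.intros)
    also have "(\<lambda>t. k * (flat 0 (c * t + d) * flat 0 ((- c) * t + (1 - d)))) = (\<lambda>t. bump (c * t + d))"
      by (auto simp: bump_def k_def fun_eq_iff algebra_simps)
    finally show ?thesis .
  qed
  have fa: "flat_algebra (\<psi> n)" for n
  proof -
    have "flat_algebra (\<lambda>t. real (Suc n) * bump (real (Suc n) * t + (- real (Suc n) * x)) + (- real (Suc n)) * bump (real (Suc n) * t + (- real (Suc n) * y)))"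
      by (intro flat_algebra.add flat_algebra.mult flat_algebra.const bump_affine)
    then show ?thesis
      by (rule back_subst[of flat_algebra]) (auto simp: \<psi>_def fun_eq_iff algebra_simps)
  qed
  have out: "\<phi> n t = 0" if "t \<notin> {x..y+1}" for n t
  proof -
    consider "t < x" | "t > y + 1" using \<open>t \<notin> {x..y+1}\<close> by fastforce
    then show ?thesis
    proof cases
      case 1
      then have "real (Suc n) * (t - x) \<le> 0" "real (Suc n) * (t - y) \<le> 0"
        using xy by (auto intro!: mult_nonneg_nonpos)
      then show ?thesis by (simp add: \<phi>_def smooth_step_nonpos)
    next
      case 2
      then have "1 * 1 \<le> real (Suc n) * (t - x)" "1 * 1 \<le> real (Suc n) * (t - y)"
        using xy by (intro mult_mono; simp)+
      then show ?thesis by (simp add: \<phi>_def smooth_step_ge_1)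
    qed
  qed
  have "\<phi> n \<in> test_functions" for n
    by (rule test_functionI[OF d fa out])
  moreover have "deriv (\<phi> n) = \<psi> n" for n
    using d by (auto intro!: ext DERIV_imp_deriv)
  ultimately have eq: "(\<integral>t. f t * \<psi> n t \<partial>lborel) = - (\<integral>t. g t * \<phi> n t \<partial>lborel)" for n
    using wd unfolding has_weak_derivative_def by metis
  have "(\<lambda>n. \<integral>t. f t * \<psi> n t \<partial>lborel) \<longlonglongrightarrow> f x - f y"
  proof -
    have "(\<integral>t. f t * \<psi> n t \<partial>lborel) = (\<integral>t. f t * (real (Suc n) * bump (real (Suc n) * (t - x))) \<partial>lborel)
        - (\<integral>t. f t * (real (Suc n) * bump (real (Suc n) * (t - y))) \<partial>lborel)" for n
    proof -
      have "f t * \<psi> n t = f t * (real (Suc n) * bump (real (Suc n) * (t - x)))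
          - f t * (real (Suc n) * bump (real (Suc n) * (t - y)))" for t
        unfolding \<psi>_def by (rule right_diff_distrib)
      then show ?thesis
        by (simp only:) (intro Bochner_Integration.integral_diff integral_scaled_bump_tendsto(1)[OF f])
    qed
    then show ?thesis
      by (simp only:) (intro tendsto_intros integral_scaled_bump_tendsto(2)[OF f])
  qed
  moreover have "(\<lambda>n. \<integral>t. g t * \<phi> n t \<partial>lborel) \<longlonglongrightarrow> (\<integral>t. indicator {x..y} t *\<^sub>R g t \<partial>lborel)"
  proof (rule integral_dominated_convergence[where w = "\<lambda>t. \<bar>indicator {x..y+1} t *\<^sub>R g t\<bar>"])
    show "integrable lborel (\<lambda>t. \<bar>indicator {x..y+1} t *\<^sub>R g t\<bar>)"
      using gi[of x "y+1"] by (intro Bochner_Integration.integrable_abs) (simp add: set_integrable_def)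
    have [measurable]: "\<phi> n \<in> borel_measurable borel" for n
      using d by (intro borel_measurable_continuous_onI) (meson DERIV_continuous continuous_at_imp_continuous_on)
    show "(\<lambda>t. g t * \<phi> n t) \<in> borel_measurable lborel" for n
      by simp
    show "(\<lambda>t. indicator {x..y} t *\<^sub>R g t) \<in> borel_measurable lborel" by simp
    show "AE t in lborel. norm (g t * \<phi> n t) \<le> \<bar>indicator {x..y+1} t *\<^sub>R g t\<bar>" for n
    proof (intro AE_I2)
      fix t
      have "\<bar>\<phi> n t\<bar> \<le> 1"
        using smooth_step_bounds[of "real (Suc n) * (t - x)"] smooth_step_bounds[of "real (Suc n) * (t - y)"]
        by (simp add: \<phi>_def)
      then show "norm (g t * \<phi> n t) \<le> \<bar>indicator {x..y+1} t *\<^sub>R g t\<bar>"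
        using out[of t n] by (auto simp: indicator_def abs_mult mult_left_le)
    qed
    have lim: "(\<lambda>n. smooth_step (real (Suc n) * s)) \<longlonglongrightarrow> indicator {0<..} s" for s
    proof (cases "s > 0")
      case True
      have "\<forall>\<^sub>F n in sequentially. real n > 1 / s"
        using filterlim_real_sequentially by (simp add: filterlim_at_top_dense)
      then have "\<forall>\<^sub>F n in sequentially. smooth_step (real (Suc n) * s) = indicator {0<..} s"
        by eventually_elim (use True in \<open>auto intro!: smooth_step_ge_1 simp: field_simps\<close>)
      then show ?thesis by (rule tendsto_eventually)
    next
      case False
      then have "smooth_step (real (Suc n) * s) = 0" for n
        by (intro smooth_step_nonpos) (auto intro: mult_nonneg_nonpos)
      then show ?thesis using False by simp
    qed
    have "(\<lambda>n. g t * \<phi> n t) \<longlonglongrightarrow> g t * (indicator {0<..} (t - x) - indicator {0<..} (t - y))" for t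
      unfolding \<phi>_def by (intro tendsto_intros lim)
    \<comment> \<open>The limit of the cutoffs is the indicator of the half-open interval from x
      (excluded) to y (included), so it differs from the closed one only at t = x.\<close>
    moreover have "g t * (indicator {0<..} (t - x) - indicator {0<..} (t - y)) = indicator {x..y} t *\<^sub>R g t" if "t \<noteq> x" for t
      using that xy by (auto simp: indicator_def)
    ultimately have "(\<lambda>n. g t * \<phi> n t) \<longlonglongrightarrow> indicator {x..y} t *\<^sub>R g t" if "t \<noteq> x" for t
      using that by metis
    then show "AE t in lborel. (\<lambda>n. g t * \<phi> n t) \<longlonglongrightarrow> indicator {x..y} t *\<^sub>R g t"
      using AE_lborel_singleton[of x] by (rule eventually_mono[rotated])
  qed
  then have "(\<lambda>n. \<integral>t. f t * \<psi> n t \<partial>lborel) \<longlonglongrightarrow> - (LINT t:{x..y}|lborel. g t)"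
    unfolding eq set_lebesgue_integral_def by (rule tendsto_minus)
  ultimately have "f x - f y = - (LINT t:{x..y}|lborel. g t)"
    by (rule LIMSEQ_unique)
  then show "integral {x..y} g = f y - f x"
    using set_borel_integral_eq_integral(2)[OF gi[of x y]] by simp
qed

section \<open>Calculus of indefinite integrals\<close>

lemma set_integrable_continuous_mult:
  fixes h g :: "real \<Rightarrow> real"
  assumes "continuous_on UNIV h" "set_integrable lborel {a..b} g" "g \<in> borel_measurable borel"
  shows "set_integrable lborel {a..b} (\<lambda>x. h x * g x)"
proof -
  have [measurable]: "h \<in> borel_measurable borel" "g \<in> borel_measurable borel"
    using assms by (auto intro: borel_measurable_continuous_onI)
  have "bounded (h ` {a..b})"
    by (intro compact_imp_bounded compact_continuous_image continuous_on_subset[OF assms(1)]) auto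
  then obtain M where M: "\<forall>t\<in>{a..b}. \<bar>h t\<bar> \<le> M"
    by (auto simp: bounded_iff)
  have "integrable lborel (\<lambda>x. M * (indicator {a..b} x *\<^sub>R g x))"
    using assms(2) unfolding set_integrable_def by (rule integrable_mult_right)
  then show ?thesis
    unfolding set_integrable_def
  proof (rule Bochner_Integration.integrable_bound)
    show "AE x in lborel. norm (indicator {a..b} x *\<^sub>R (h x * g x)) \<le> norm (M * (indicator {a..b} x *\<^sub>R g x))"
      using M by (intro AE_I2) (force simp: indicator_def abs_mult intro!: mult_right_mono)
  qed auto
qed

lemma integrable_on_of_set_integrable: 
  "set_integrable lborel {a..b} g \<Longrightarrow> (g::real \<Rightarrow> real) integrable_on {a..b}"
  by (rule set_borel_integral_eq_integral(1))

lemma set_integrable_abs_real: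
  "set_integrable lborel {a..b} g \<Longrightarrow> set_integrable lborel {a..b} (\<lambda>x. \<bar>g x :: real\<bar>)"
  by (rule set_integrable_abs)

text \<open>Locally the two sides differ by \<open>o(1)\<close> times the integral of \<open>\<bar>g\<bar>\<close>; this error is additive over
  intervals, so it is arbitrarily small globally.\<close>

lemma primitive_compose:
  fixes F F' :: "real \<Rightarrow> real"
  assumes p: "primitive f g" and F: "\<And>t. (F has_real_derivative F' t) (at t)"
    and F': "continuous_on UNIV F'"
  shows "primitive (\<lambda>x. F (f x)) (\<lambda>x. F' (f x) * g x)"
proof (rule primitiveI)
  have cf: "continuous_on S f" for S by (rule primitive_continuous[OF p])
  have cF'f: "continuous_on UNIV (\<lambda>x. F' (f x))"
    by (rule continuous_on_compose2[OF F' cf]) auto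
  have [measurable]: "g \<in> borel_measurable borel" "(\<lambda>x. F' (f x)) \<in> borel_measurable borel"
    using p cF'f by (auto intro: borel_measurable_continuous_onI primitive_measurable)
  show "(\<lambda>x. F' (f x) * g x) \<in> borel_measurable borel" by measurable
  have gi: "set_integrable lborel {a..b} g" for a b
    by (rule primitive_set_integrable[OF p])
  show si: "set_integrable lborel {a..b} (\<lambda>x. F' (f x) * g x)" for a b
    by (rule set_integrable_continuous_mult[OF cF'f gi]) simp
  note io = integrable_on_of_set_integrable[OF si]
  note ia = integrable_on_of_set_integrable[OF set_integrable_abs_real[OF gi]]
  define D where "D a b = F (f b) - F (f a) - integral {a..b} (\<lambda>x. F' (f x) * g x)" for a b
  fix a b :: real assume ab: "a < b"
  have bound: "\<bar>D a b\<bar> \<le> e * integral {a..b} (\<lambda>x. \<bar>g x\<bar>)" if e: "e > 0" for e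
    using less_imp_le[OF ab]
  proof (induction rule: Bolzano)
    case (trans a b c)
    have "integral {a..b} (\<lambda>x. F' (f x) * g x) + integral {b..c} (\<lambda>x. F' (f x) * g x) = integral {a..c} (\<lambda>x. F' (f x) * g x)"
      by (rule Henstock_Kurzweil_Integration.integral_combine) (use trans io in auto)
    then have "D a c = D a b + D b c"
      by (simp add: D_def)
    moreover have "integral {a..b} (\<lambda>x. \<bar>g x\<bar>) + integral {b..c} (\<lambda>x. \<bar>g x\<bar>) = integral {a..c} (\<lambda>x. \<bar>g x\<bar>)"
      by (rule Henstock_Kurzweil_Integration.integral_combine) (use trans ia in auto)
    ultimately show ?case
      using trans(1,2) abs_triangle_ineq[of "D a b" "D b c"]
      by (smt (verit) distrib_left)
  next
    case (local x)
    have "isCont F' (f x)" using F' by (simp add: continuous_on_eq_continuous_at)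
    then obtain d1 where d1: "d1 > 0" "\<And>y. \<bar>y - f x\<bar> < d1 \<Longrightarrow> \<bar>F' y - F' (f x)\<bar> < e / 2"
      using e unfolding continuous_at_eps_delta dist_real_def by (meson half_gt_zero)
    have "isCont f x" using cf[of UNIV] by (simp add: continuous_on_eq_continuous_at)
    then obtain d where d: "d > 0" "\<And>y. \<bar>y - x\<bar> < d \<Longrightarrow> \<bar>f y - f x\<bar> < d1"
      using d1(1) unfolding continuous_at_eps_delta dist_real_def by meson
    show ?case
    proof (intro exI[of _ d] conjI allI impI d(1))
      fix a b assume ab: "a \<le> x \<and> x \<le> b \<and> b - a < d"
      then have near: "\<bar>f y - f x\<bar> < d1" if "y \<in> {a..b}" for y
        using that by (intro d(2)) auto
      \<comment> \<open>The mean value theorem is applied to \<open>F\<close> between the values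
        f(a) and f(b), since \<open>f\<close> itself need not be differentiable. The point \<xi> is
        thus a value close to f(x).\<close>
      obtain \<xi> where \<xi>: "F (f b) - F (f a) = F' \<xi> * (f b - f a)" "\<bar>\<xi> - f x\<bar> < d1"
      proof (cases "f a" "f b" rule: linorder_cases)
        case less
        then obtain \<xi> where "\<xi> > f a" "\<xi> < f b" "F (f b) - F (f a) = (f b - f a) * F' \<xi>"
          using MVT2[of "f a" "f b" F F'] F by blast
        then show ?thesis using near[of a] near[of b] ab by (intro that[of \<xi>]) (auto simp: mult.commute)
      next
        case equal
        then show ?thesis using d1(1) by (intro that[of "f x"]) auto
      next
        case greater
        then obtain \<xi> where "\<xi> > f b" "\<xi> < f a" "F (f a) - F (f b) = (f a - f b) * F' \<xi>"
          using MVT2[of "f b" "f a" F F'] F by blast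
        then show ?thesis using near[of a] near[of b] ab
          by (intro that[of \<xi>]) (auto simp: algebra_simps)
      qed
      have "(\<lambda>x. F' \<xi> * g x) integrable_on {a..b}"
        using integrable_on_of_set_integrable[OF gi] by (rule integrable_on_mult_right)
      moreover have "F' \<xi> * (f b - f a) = integral {a..b} (\<lambda>x. F' \<xi> * g x)"
        using ab primitive_integral[OF p, of a b] by simp
      ultimately have "D a b = integral {a..b} (\<lambda>t. F' \<xi> * g t - F' (f t) * g t)"
        by (simp add: D_def \<xi>(1) Henstock_Kurzweil_Integration.integral_diff[OF _ io])
      also have "norm \<dots> \<le> integral {a..b} (\<lambda>t. e * \<bar>g t\<bar>)"
      proof (rule integral_norm_bound_integral)
        show "(\<lambda>t. F' \<xi> * g t - F' (f t) * g t) integrable_on {a..b}"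
          using \<open>(\<lambda>x. F' \<xi> * g x) integrable_on {a..b}\<close> io by (rule integrable_diff)
        show "(\<lambda>t. e * \<bar>g t\<bar>) integrable_on {a..b}"
          using ia by (rule integrable_on_mult_right)
        fix t assume "t \<in> {a..b}"
        then have "\<bar>F' \<xi> - F' (f t)\<bar> \<le> e"
          using d1(2)[OF \<xi>(2)] d1(2)[OF near[of t]] by linarith
        then have "\<bar>F' \<xi> - F' (f t)\<bar> * \<bar>g t\<bar> \<le> e * \<bar>g t\<bar>"
          by (intro mult_right_mono) auto
        then show "norm (F' \<xi> * g t - F' (f t) * g t) \<le> e * \<bar>g t\<bar>"
          by (simp add: abs_mult left_diff_distrib[symmetric])
      qed
      finally show "\<bar>D a b\<bar> \<le> e * integral {a..b} (\<lambda>x. \<bar>g x\<bar>)" by simp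
    qed
  qed
  have "\<bar>D a b\<bar> \<le> 0"
  proof (rule field_le_epsilon)
    fix e :: real assume e: "e > 0"
    define I where "I = integral {a..b} (\<lambda>x. \<bar>g x\<bar>)"
    have "I \<ge> 0" unfolding I_def by (rule integral_nonneg[OF ia]) auto
    have "\<bar>D a b\<bar> \<le> e / (I + 1) * I"
      unfolding I_def[symmetric] using bound[of "e / (I + 1)"] e \<open>I \<ge> 0\<close> by (simp add: I_def)
    also have "\<dots> \<le> e" using e \<open>I \<ge> 0\<close> by (simp add: field_simps)
    finally show "\<bar>D a b\<bar> \<le> 0 + e" by simp
  qed
  then show "integral {a..b} (\<lambda>x. F' (f x) * g x) = F (f b) - F (f a)"
    by (simp add: D_def)
qed

lemma primitive_add:
  assumes "primitive f1 g1" "primitive f2 g2"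
  shows "primitive (\<lambda>x. f1 x + f2 x) (\<lambda>x. g1 x + g2 x)"
  unfolding primitive_def
proof (intro conjI allI impI)
  fix a b :: real assume "a \<le> b"
  then show "((\<lambda>x. g1 x + g2 x) has_integral (f1 b + f2 b - (f1 a + f2 a))) {a..b}"
    using has_integral_add[OF primitive_has_integral[OF assms(1)] primitive_has_integral[OF assms(2)], of a b]
    by (simp add: algebra_simps)
qed (use assms in \<open>auto intro: primitive_measurable primitive_set_integrable\<close>)

lemma primitive_cmult:
  assumes "primitive f g" shows "primitive (\<lambda>x. c * f x) (\<lambda>x. c * g x)"
  unfolding primitive_def
proof (intro conjI allI impI)
  fix a b :: real assume "a \<le> b"
  then show "((\<lambda>x. c * g x) has_integral (c * f b - c * f a)) {a..b}"
    using has_integral_mult_right[OF primitive_has_integral[OF assms], of a b c]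
    by (simp add: algebra_simps)
qed (use assms in \<open>auto intro: primitive_measurable primitive_set_integrable\<close>)

text \<open>Polarisation, f1 f2 = ((f1 + f2)^2 - f1^2 - f2^2) / 2, reduces the product rule to the
  chain rule for squares.\<close>

lemma primitive_mult:
  assumes "primitive f1 g1" "primitive f2 g2"
  shows "primitive (\<lambda>x. f1 x * f2 x) (\<lambda>x. f1 x * g2 x + g1 x * f2 x)"
proof -
  have sq: "primitive (\<lambda>x. (f x)\<^sup>2) (\<lambda>x. 2 * f x * g x)" if "primitive f g" for f g
    by (rule primitive_compose[OF that, of "\<lambda>t. t\<^sup>2" "\<lambda>t. 2 * t"])
      (auto intro!: derivative_eq_intros continuous_intros)
  have "primitive (\<lambda>x. 1/2 * (f1 x + f2 x)\<^sup>2 + (-1/2) * (f1 x)\<^sup>2 + (-1/2) * (f2 x)\<^sup>2)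
     (\<lambda>x. 1/2 * (2 * (f1 x + f2 x) * (g1 x + g2 x)) + (-1/2) * (2 * f1 x * g1 x) + (-1/2) * (2 * f2 x * g2 x))"
    by (intro primitive_add primitive_cmult sq assms)
  moreover have "(\<lambda>x. 1/2 * (f1 x + f2 x)\<^sup>2 + (-1/2) * (f1 x)\<^sup>2 + (-1/2) * (f2 x)\<^sup>2) = (\<lambda>x. f1 x * f2 x)"
    by (auto simp: power2_eq_square algebra_simps)
  moreover have "(\<lambda>x. 1/2 * (2 * (f1 x + f2 x) * (g1 x + g2 x)) + (-1/2) * (2 * f1 x * g1 x) + (-1/2) * (2 * f2 x * g2 x))
     = (\<lambda>x. f1 x * g2 x + g1 x * f2 x)"
    by (auto simp: algebra_simps)
  ultimately show ?thesis by simp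
qed

lemma primitive_C1:
  assumes "\<And>x. (f has_real_derivative f' x) (at x)" "continuous_on UNIV f'"
  shows "primitive f f'"
proof (rule primitiveI)
  show "f' \<in> borel_measurable borel" using assms(2) by (rule borel_measurable_continuous_onI)
  show "set_integrable lborel {a..b} f'" for a b
    by (rule borel_integrable_atLeastAtMost') (rule continuous_on_subset[OF assms(2)], simp)
  show "integral {a..b} f' = f b - f a" if "a < b" for a b
    using that assms(1)
    by (intro integral_unique fundamental_theorem_of_calculus)
      (auto simp: has_real_derivative_iff_has_vector_derivative[symmetric] intro: has_field_derivative_at_within)
qed

lemma primitive_reflect:
  assumes "primitive f g" shows "primitive (\<lambda>x. f (- x)) (\<lambda>x. - g (- x))"
  unfolding primitive_def
proof (intro conjI allI impI)
  have [measurable]: "g \<in> borel_measurable borel" using assms by (rule primitive_measurable)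
  show "(\<lambda>x. - g (- x)) \<in> borel_measurable borel" by measurable
  fix a b :: real assume ab: "a \<le> b"
  have i: "integrable lborel (\<lambda>x. indicator {-b..-a} x *\<^sub>R g x)"
    using primitive_set_integrable[OF assms, of "-b" "-a"] by (simp add: set_integrable_def)
  have "integrable lborel (\<lambda>x. indicator {-b..-a} (0 + -1 * x) *\<^sub>R g (0 + -1 * x))"
    by (rule lborel_integrable_real_affine[OF i]) simp
  moreover have "indicator {-b..-a} (- x) = (indicator {a..b} x :: real)" for x by (auto simp: indicator_def)
  ultimately show "set_integrable lborel {a..b} (\<lambda>x. - g (- x))"
    by (simp add: set_integrable_def)
  have "(g has_integral (f (-a) - f (-b))) {-b..-a}"
    using ab by (intro primitive_has_integral[OF assms]) auto
  then have "((\<lambda>x. g (- x)) has_integral (f (-a) - f (-b))) {a..b}"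
    by (subst (asm) has_integral_reflect_real[symmetric]) simp
  from has_integral_neg[OF this]
  show "((\<lambda>x. - g (- x)) has_integral (f (- b) - f (- a))) {a..b}" by simp
qed

lemma deriv_test_function:
  assumes "\<phi> \<in> test_functions"
  shows "(\<phi> has_real_derivative deriv \<phi> x) (at x)" "continuous_on UNIV (deriv \<phi>)" 
    "\<exists>r>0. \<forall>x. r \<le> \<bar>x\<bar> \<longrightarrow> \<phi> x = 0 \<and> deriv \<phi> x = 0"
proof -
  have d: "(deriv ^^ n) \<phi> field_differentiable at x" for n x
    using assms by (simp add: test_functions_def)
  show 1: "(\<phi> has_real_derivative deriv \<phi> x) (at x)" for x
    using d[of 0 x] by (simp add: DERIV_deriv_iff_field_differentiable)
  have "isCont (deriv \<phi>) x" for x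
    using d[of 1 x] by (simp add: field_differentiable_imp_continuous_at)
  then show "continuous_on UNIV (deriv \<phi>)" by (simp add: continuous_at_imp_continuous_on)
  have "bounded {x. \<phi> x \<noteq> 0}"
    using assms by (simp add: test_functions_def)
  then obtain r where r: "\<And>x. \<phi> x \<noteq> 0 \<Longrightarrow> \<bar>x\<bar> \<le> r" by (auto simp: bounded_iff)
  have z: "\<phi> x = 0" if "\<bar>x\<bar> > r" for x using r[of x] that by auto
  have "deriv \<phi> x = 0" if "\<bar>x\<bar> > r" for x
  proof -
    have "open {x::real. \<bar>x\<bar> > r}" by (intro open_Collect_less continuous_intros)
    have "((\<lambda>x. 0) has_real_derivative deriv \<phi> x) (at x)"
      using 1[of x] \<open>open {x::real. \<bar>x\<bar> > r}\<close>
      by (rule has_field_derivative_transform_within_open) (use that z in auto)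
    then show ?thesis using DERIV_unique DERIV_const by blast
  qed
  then show "\<exists>r>0. \<forall>x. r \<le> \<bar>x\<bar> \<longrightarrow> \<phi> x = 0 \<and> deriv \<phi> x = 0"
    using z by (intro exI[of _ "\<bar>r\<bar> + 1"]) auto
qed

text \<open>This is the product rule integrated over an interval [-r, r] at whose end points \<phi>
  already vanishes.\<close>

lemma primitive_imp_weak_derivative:
  assumes "primitive f g" shows "has_weak_derivative f g"
  unfolding has_weak_derivative_def
proof
  fix \<phi> assume \<phi>: "\<phi> \<in> test_functions"
  note d = deriv_test_function[OF \<phi>]
  obtain r where r: "r > 0" "\<And>x. r \<le> \<bar>x\<bar> \<Longrightarrow> \<phi> x = 0 \<and> deriv \<phi> x = 0"
    using d(3) by blast
  have p\<phi>: "primitive \<phi> (deriv \<phi>)" by (rule primitive_C1[OF d(1,2)])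
  have pm: "primitive (\<lambda>x. f x * \<phi> x) (\<lambda>x. f x * deriv \<phi> x + g x * \<phi> x)"
    by (rule primitive_mult[OF assms p\<phi>])
  have supp: "h = (\<lambda>x. indicator {-r..r} x *\<^sub>R h x)" if "\<And>x. r \<le> \<bar>x\<bar> \<Longrightarrow> h x = 0" for h :: "real \<Rightarrow> real"
  proof
    fix x show "h x = indicator {-r..r} x *\<^sub>R h x"
      by (cases "r \<le> \<bar>x\<bar>") (auto simp: that indicator_def)
  qed
  have i1: "set_integrable lborel {-r..r} (\<lambda>x. f x * deriv \<phi> x)"
    by (rule set_integrable_continuous_mult[OF primitive_continuous[OF assms] primitive_set_integrable[OF p\<phi>] primitive_measurable[OF p\<phi>]])
  have i2: "set_integrable lborel {-r..r} (\<lambda>x. \<phi> x * g x)"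
    by (rule set_integrable_continuous_mult[OF primitive_continuous[OF p\<phi>] primitive_set_integrable[OF assms] primitive_measurable[OF assms]])
  have s1: "(\<integral>x. f x * deriv \<phi> x \<partial>lborel) = (LINT x:{-r..r}|lborel. f x * deriv \<phi> x)"
    unfolding set_lebesgue_integral_def by (subst supp[of "\<lambda>x. f x * deriv \<phi> x"]) (use r in auto)
  have s2: "(\<integral>x. g x * \<phi> x \<partial>lborel) = (LINT x:{-r..r}|lborel. \<phi> x * g x)"
    unfolding set_lebesgue_integral_def by (subst supp[of "\<lambda>x. g x * \<phi> x"]) (use r in \<open>auto simp: mult.commute\<close>)
  have "integral {-r..r} (\<lambda>x. f x * deriv \<phi> x + g x * \<phi> x) = 0"
    using primitive_integral[OF pm, of "-r" r] r by simp
  then show "(\<integral>x. f x * deriv \<phi> x \<partial>lborel) = - (\<integral>x. g x * \<phi> x \<partial>lborel)"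
    unfolding s1 s2 set_borel_integral_eq_integral(2)[OF i1] set_borel_integral_eq_integral(2)[OF i2]
    using Henstock_Kurzweil_Integration.integral_add[OF integrable_on_of_set_integrable[OF i1] integrable_on_of_set_integrable[OF i2]]
    by (simp add: mult.commute)
qed

text \<open>All interval integrals of h vanish, so the measures with densities given by the positive
  and the negative part agree on half-lines, hence everywhere, and then so do the densities.
  Truncating to [-n, n] makes both parts integrable.\<close>

lemma primitive_zero_AE:
  assumes p: "primitive (\<lambda>x. 0) h" shows "AE x in lborel. h x = 0"
proof -
  have [measurable]: "h \<in> borel_measurable borel" by (rule primitive_measurable[OF p])
  have "AE x in lborel. indicator {-real n..real n} x * h x = 0" for n
  proof -
    define k where "k x = indicator {-real n..real n} x * h x" for x
    have ki: "integrable lborel k"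
      using primitive_set_integrable[OF p, of "-real n" "real n"]
      by (simp add: k_def[abs_def] set_integrable_def)
    have [measurable]: "k \<in> borel_measurable borel" unfolding k_def[abs_def] by simp
    let ?P = "\<lambda>x. max (k x) 0" and ?N = "\<lambda>x. max (- k x) 0"
    have iP: "integrable lborel (\<lambda>y. indicator A y * ?P y)" "integrable lborel (\<lambda>y. indicator A y * ?N y)"
      if [measurable]: "A \<in> sets borel" for A
      by (rule Bochner_Integration.integrable_bound[OF ki]; auto simp: indicator_def)+
    have e: "emeasure (density lborel (\<lambda>x. ennreal (?P x))) A = ennreal (\<integral>y. indicator A y * ?P y \<partial>lborel)"
      "emeasure (density lborel (\<lambda>x. ennreal (?N x))) A = ennreal (\<integral>y. indicator A y * ?N y \<partial>lborel)"
      if A[measurable]: "A \<in> sets borel" for A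
    proof -
      have "emeasure (density lborel (\<lambda>x. ennreal (?P x))) A = (\<integral>\<^sup>+ y. ennreal (indicator A y * ?P y) \<partial>lborel)"
        by (subst emeasure_density) (auto intro!: nn_integral_cong simp: indicator_def)
      then show "emeasure (density lborel (\<lambda>x. ennreal (?P x))) A = ennreal (\<integral>y. indicator A y * ?P y \<partial>lborel)"
        using iP(1)[OF A] by (simp add: nn_integral_eq_integral)
      have "emeasure (density lborel (\<lambda>x. ennreal (?N x))) A = (\<integral>\<^sup>+ y. ennreal (indicator A y * ?N y) \<partial>lborel)"
        by (subst emeasure_density) (auto intro!: nn_integral_cong simp: indicator_def)
      then show "emeasure (density lborel (\<lambda>x. ennreal (?N x))) A = ennreal (\<integral>y. indicator A y * ?N y \<partial>lborel)"
        using iP(2)[OF A] by (simp add: nn_integral_eq_integral)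
    qed
    have eq: "(\<integral>y. indicator {x<..} y * ?P y \<partial>lborel) = (\<integral>y. indicator {x<..} y * ?N y \<partial>lborel)" for x
    proof -
      have "(\<integral>y. indicator {x<..} y * ?P y \<partial>lborel) - (\<integral>y. indicator {x<..} y * ?N y \<partial>lborel)
          = (\<integral>y. indicator {x<..} y * ?P y - indicator {x<..} y * ?N y \<partial>lborel)"
        by (rule Bochner_Integration.integral_diff[symmetric]) (rule iP, simp)+
      \<comment> \<open>Cutting the open half-line by the window [-n, n] leaves a compact interval
        up to the single point x.\<close>
      also have "\<dots> = (\<integral>y. indicator {max x (-real n)..real n} y *\<^sub>R h y \<partial>lborel)"
        using AE_lborel_singleton[of x]
        by (intro integral_cong_AE) (auto elim!: eventually_mono simp: k_def indicator_def max_def)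
      also have "\<dots> = 0"
      proof -
        have "(LINT y:{max x (-real n)..real n}|lborel. h y) = integral {max x (-real n)..real n} h"
          by (intro set_borel_integral_eq_integral(2) primitive_set_integrable[OF p])
        also have "\<dots> = 0"
          using primitive_integral[OF p, of "max x (-real n)" "real n"]
          by (cases "max x (-real n) \<le> real n") auto
        finally show ?thesis by (simp add: set_lebesgue_integral_def)
      qed
      finally show ?thesis by simp
    qed
    have "density lborel (\<lambda>x. ennreal (?P x)) = density lborel (\<lambda>x. ennreal (?N x))"
      by (rule measure_eqI_lessThan) (simp_all add: e eq)
    then have "AE x in lborel. ennreal (?P x) = ennreal (?N x)"
      by (subst (asm) sigma_finite_measure.density_unique_iff[OF sigma_finite_lborel]) simp_all
    then show ?thesis
    proof (rule eventually_mono)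
      fix x assume "ennreal (?P x) = ennreal (?N x)"
      then have "k x = 0" by (auto simp: max_def split: if_splits)
      then show "indicator {-real n..real n} x * h x = 0" by (simp add: k_def)
    qed
  qed
  then have "AE x in lborel. \<forall>n. indicator {-real n..real n} x * h x = 0"
    unfolding AE_all_countable by blast
  then show ?thesis
  proof (rule eventually_mono)
    fix x assume *: "\<forall>n. indicator {-real n..real n} x * h x = 0"
    obtain n where "\<bar>x\<bar> \<le> real n" using real_arch_simple by blast
    then show "h x = 0" using *[rule_format, of n] by (simp add: indicator_def)
  qed
qed

lemma primitive_AE_unique:
  assumes "primitive f g1" "primitive f g2"
  shows "AE x in lborel. g1 x = g2 x"
proof -
  have "primitive (\<lambda>x. f x + (-1) * f x) (\<lambda>x. g1 x + (-1) * g2 x)"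
    by (intro primitive_add primitive_cmult assms)
  then have "AE x in lborel. g1 x + (-1) * g2 x = 0"
    by (intro primitive_zero_AE) simp
  then show ?thesis by (rule eventually_mono) simp
qed

text \<open>The functions sqrt(t^2 + \<delta>^2) are C^1 and tend to \<bar>t\<bar>; their
  derivatives are bounded by 1, so \<bar>g\<bar> dominates. Where f = 0 every approximating
  derivative is 0, which matches \<open>sgn 0 = 0\<close>.\<close>

lemma primitive_abs:
  assumes p: "primitive f g"
  shows "primitive (\<lambda>x. \<bar>f x\<bar>) (\<lambda>x. sgn (f x) * g x)"
proof (rule primitiveI)
  have [measurable]: "f \<in> borel_measurable borel" "g \<in> borel_measurable borel"
    using primitive_borel[OF p] primitive_measurable[OF p] by auto
  show "(\<lambda>x. sgn (f x) * g x) \<in> borel_measurable borel" by measurable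
  have gi: "set_integrable lborel {a..b} g" for a b by (rule primitive_set_integrable[OF p])
  show si: "set_integrable lborel {a..b} (\<lambda>x. sgn (f x) * g x)" for a b
    using gi[of a b] unfolding set_integrable_def
    by (rule Bochner_Integration.integrable_bound) (auto simp: abs_mult sgn_if)
  fix a b :: real assume ab: "a < b"
  define \<delta> where "\<delta> n = 1 / real (Suc n)" for n
  have \<delta>: "\<delta> n > 0" for n by (simp add: \<delta>_def)
  have \<delta>0: "\<delta> \<longlonglongrightarrow> 0" unfolding \<delta>_def[abs_def]
    using LIMSEQ_inverse_real_of_nat by (simp add: inverse_eq_divide)
  define h where "h n x = f x / sqrt ((f x)\<^sup>2 + (\<delta> n)\<^sup>2) * g x" for n x
  have pn: "primitive (\<lambda>x. sqrt ((f x)\<^sup>2 + (\<delta> n)\<^sup>2)) (h n)" for n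
  proof -
    have pos: "t\<^sup>2 + (\<delta> n)\<^sup>2 > 0" for t using \<delta>[of n] by (simp add: sum_power2_gt_zero_iff)
    have "primitive (\<lambda>x. sqrt ((f x)\<^sup>2 + (\<delta> n)\<^sup>2)) (\<lambda>x. f x / sqrt ((f x)\<^sup>2 + (\<delta> n)\<^sup>2) * g x)"
    proof (rule primitive_compose[OF p])
      show "((\<lambda>t. sqrt (t\<^sup>2 + (\<delta> n)\<^sup>2)) has_real_derivative t / sqrt (t\<^sup>2 + (\<delta> n)\<^sup>2)) (at t)" for t
        using pos[of t] by (auto intro!: derivative_eq_intros simp: field_simps)
      show "continuous_on UNIV (\<lambda>t. t / sqrt (t\<^sup>2 + (\<delta> n)\<^sup>2))"
        using pos less_imp_neq[OF \<delta>[of n]] by (intro continuous_intros ballI) auto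
    qed
    then show ?thesis by (simp add: h_def[abs_def])
  qed
  have "(\<lambda>n. \<integral>x. indicator {a..b} x *\<^sub>R h n x \<partial>lborel) \<longlonglongrightarrow> (\<integral>x. indicator {a..b} x *\<^sub>R (sgn (f x) * g x) \<partial>lborel)"
  proof (rule integral_dominated_convergence[where w = "\<lambda>x. \<bar>indicator {a..b} x *\<^sub>R g x\<bar>"])
    show "integrable lborel (\<lambda>x. \<bar>indicator {a..b} x *\<^sub>R g x\<bar>)"
      using gi[of a b] unfolding set_integrable_def by (rule Bochner_Integration.integrable_abs)
    show "AE x in lborel. norm (indicator {a..b} x *\<^sub>R h n x) \<le> \<bar>indicator {a..b} x *\<^sub>R g x\<bar>" for n
    proof (intro AE_I2)
      fix x
      have "\<bar>f x\<bar> \<le> sqrt ((f x)\<^sup>2 + (\<delta> n)\<^sup>2)"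
        by (metis le_add_same_cancel1 real_sqrt_abs real_sqrt_le_iff zero_le_power2)
      moreover have "sqrt ((f x)\<^sup>2 + (\<delta> n)\<^sup>2) > 0"
        using \<delta>[of n] by (simp add: sum_power2_gt_zero_iff)
      ultimately have "\<bar>f x / sqrt ((f x)\<^sup>2 + (\<delta> n)\<^sup>2)\<bar> \<le> 1"
        by (simp add: abs_divide)
      then have "\<bar>f x / sqrt ((f x)\<^sup>2 + (\<delta> n)\<^sup>2)\<bar> * \<bar>g x\<bar> \<le> 1 * \<bar>g x\<bar>"
        by (rule mult_right_mono) simp
      then show "norm (indicator {a..b} x *\<^sub>R h n x) \<le> \<bar>indicator {a..b} x *\<^sub>R g x\<bar>"
        unfolding h_def by (auto simp: indicator_def abs_mult)
    qed
    show "AE x in lborel. (\<lambda>n. indicator {a..b} x *\<^sub>R h n x) \<longlonglongrightarrow> indicator {a..b} x *\<^sub>R (sgn (f x) * g x)"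
    proof (intro AE_I2 tendsto_intros)
      fix x
      show "(\<lambda>n. h n x) \<longlonglongrightarrow> sgn (f x) * g x"
      proof (cases "f x = 0")
        case True then show ?thesis by (simp add: h_def)
      next
        case False
        have "(\<lambda>n. f x / sqrt ((f x)\<^sup>2 + (\<delta> n)\<^sup>2) * g x) \<longlonglongrightarrow> f x / sqrt ((f x)\<^sup>2 + 0\<^sup>2) * g x"
          using False by (intro tendsto_intros \<delta>0) auto
        then show ?thesis using False by (simp add: h_def sgn_div_norm sgn_real_def field_simps abs_if)
      qed
    qed
  qed (auto simp: h_def[abs_def])
  moreover have "(\<integral>x. indicator {a..b} x *\<^sub>R h n x \<partial>lborel) = sqrt ((f b)\<^sup>2 + (\<delta> n)\<^sup>2) - sqrt ((f a)\<^sup>2 + (\<delta> n)\<^sup>2)" for n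
    using set_borel_integral_eq_integral(2)[OF primitive_set_integrable[OF pn[of n]], of a b]
      primitive_integral[OF pn[of n], of a b] ab by (simp add: set_lebesgue_integral_def)
  moreover have "(\<lambda>n. sqrt ((f b)\<^sup>2 + (\<delta> n)\<^sup>2) - sqrt ((f a)\<^sup>2 + (\<delta> n)\<^sup>2)) \<longlonglongrightarrow> sqrt ((f b)\<^sup>2 + 0\<^sup>2) - sqrt ((f a)\<^sup>2 + 0\<^sup>2)"
    by (intro tendsto_intros \<delta>0)
  ultimately have "(\<integral>x. indicator {a..b} x *\<^sub>R (sgn (f x) * g x) \<partial>lborel) = \<bar>f b\<bar> - \<bar>f a\<bar>"
    using LIMSEQ_unique by fastforce
  then show "integral {a..b} (\<lambda>x. sgn (f x) * g x) = \<bar>f b\<bar> - \<bar>f a\<bar>"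
    using set_borel_integral_eq_integral(2)[OF si[of a b]] by (simp add: set_lebesgue_integral_def)
qed

text \<open>The zero of f at c removes the jump that the sign change would cause. This serves to
  build ordered states from their even and odd parts and to integrate against derivatives of
  tents.\<close>

lemma primitive_sign_mult:
  assumes p: "primitive f g" and f0: "f c = 0"
  shows "primitive (\<lambda>x. sgn (x - c) * f x) (\<lambda>x. sgn (x - c) * g x)"
  unfolding primitive_def
proof (intro conjI allI impI)
  have [measurable]: "g \<in> borel_measurable borel" by (rule primitive_measurable[OF p])
  show "(\<lambda>x. sgn (x - c) * g x) \<in> borel_measurable borel" by measurable
  fix a b :: real assume ab: "a \<le> b"
  show "set_integrable lborel {a..b} (\<lambda>x. sgn (x - c) * g x)"
    using primitive_set_integrable[OF p, of a b] unfolding set_integrable_def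
    by (rule Bochner_Integration.integrable_bound) (auto simp: abs_mult sgn_if)
  have pos: "((\<lambda>x. sgn (x - c) * g x) has_integral (sgn (b - c) * f b - sgn (a - c) * f a)) {a..b}" if "c \<le> a" "a \<le> b" for a b
  proof -
    have "((\<lambda>x. sgn (x - c) * g x) has_integral (f b - f a)) {a..b}"
      by (rule has_integral_spike_finite[OF _ _ primitive_has_integral[OF p that(2)], of "{c}"])
        (use that in \<open>simp_all add: sgn_if\<close>)
    moreover have "f b - f a = sgn (b - c) * f b - sgn (a - c) * f a"
      using that f0 by (cases "a = c"; cases "b = c") (simp_all add: sgn_if)
    ultimately show ?thesis by simp
  qed
  have neg: "((\<lambda>x. sgn (x - c) * g x) has_integral (sgn (b - c) * f b - sgn (a - c) * f a)) {a..b}" if "b \<le> c" "a \<le> b" for a b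
  proof -
    have "((\<lambda>x. sgn (x - c) * g x) has_integral - (f b - f a)) {a..b}"
      by (rule has_integral_spike_finite[OF _ _ has_integral_neg[OF primitive_has_integral[OF p that(2)]], of "{c}"])
        (use that in \<open>simp_all add: sgn_if\<close>)
    moreover have "- (f b - f a) = sgn (b - c) * f b - sgn (a - c) * f a"
      using that f0 by (cases "a = c"; cases "b = c") (simp_all add: sgn_if)
    ultimately show ?thesis by simp
  qed
  consider "c \<le> a" | "b \<le> c" | "a \<le> c" "c \<le> b" by linarith
  then show "((\<lambda>x. sgn (x - c) * g x) has_integral (sgn (b - c) * f b - sgn (a - c) * f a)) {a..b}"
  proof cases
    case 3
    then show ?thesis
      using has_integral_combine[OF 3 neg[of c a] pos[of c b]] by simp
  qed (use pos neg ab in auto)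
qed

section \<open>The weighted Sobolev space and the energy\<close>

lemma L2_iff: "f \<in> L2_space \<longleftrightarrow> f \<in> borel_measurable borel \<and> integrable lborel (\<lambda>x. (f x)\<^sup>2)"
  by (simp add: L2_space_def)

lemma L2_measurable [measurable_dest]: "f \<in> L2_space \<Longrightarrow> f \<in> borel_measurable borel"
  by (simp add: L2_iff)

lemma L2_integrable_square: "f \<in> L2_space \<Longrightarrow> integrable lborel (\<lambda>x. (f x)\<^sup>2)"
  by (simp add: L2_iff)

lemma L2_integrable_mult:
  assumes "f \<in> L2_space" "g \<in> L2_space" shows "integrable lborel (\<lambda>x. f x * g x)"
proof (rule Bochner_Integration.integrable_bound)
  note [measurable] = assms[THEN L2_measurable]
  show "integrable lborel (\<lambda>x. (f x)\<^sup>2 + (g x)\<^sup>2)"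
    using assms by (simp add: L2_iff)
  have "\<bar>a * b\<bar> \<le> a\<^sup>2 + b\<^sup>2" for a b :: real
  proof -
    have "2 * \<bar>a * b\<bar> \<le> a\<^sup>2 + b\<^sup>2"
      using zero_le_power2[of "\<bar>a\<bar> - \<bar>b\<bar>"] by (simp add: power2_diff abs_mult)
    then show ?thesis using abs_ge_zero[of "a * b"] by linarith
  qed
  then show "AE x in lborel. norm (f x * g x) \<le> norm ((f x)\<^sup>2 + (g x)\<^sup>2)"
    by simp
  show "(\<lambda>x. f x * g x) \<in> borel_measurable lborel" by measurable
qed

lemma L2_add:
  assumes "f \<in> L2_space" "g \<in> L2_space" shows "(\<lambda>x. f x + g x) \<in> L2_space"
proof -
  note [measurable] = assms[THEN L2_measurable]
  have "integrable lborel (\<lambda>x. (f x)\<^sup>2 + (g x)\<^sup>2 + 2 * (f x * g x))"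
    using assms L2_integrable_mult[OF assms] by (auto simp: L2_iff)
  then show ?thesis
    by (simp add: L2_iff power2_sum mult.assoc)
qed

lemma L2_bounded_mult:
  assumes "f \<in> L2_space" and [measurable]: "h \<in> borel_measurable borel" and "\<And>x. \<bar>h x\<bar> \<le> M"
  shows "(\<lambda>x. h x * f x) \<in> L2_space"
proof -
  note [measurable] = assms(1)[THEN L2_measurable]
  have "integrable lborel (\<lambda>x. M\<^sup>2 * (f x)\<^sup>2)"
    using assms by (simp add: L2_iff)
  then have "integrable lborel (\<lambda>x. (h x * f x)\<^sup>2)"
  proof (rule Bochner_Integration.integrable_bound)
    have "(h x)\<^sup>2 \<le> M\<^sup>2" for x
      using assms(3)[of x] by (metis abs_ge_zero power2_abs power_mono)
    then show "AE x in lborel. norm ((h x * f x)\<^sup>2) \<le> norm (M\<^sup>2 * (f x)\<^sup>2)"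
      by (auto simp: power_mult_distrib intro!: mult_right_mono)
  qed measurable
  then show ?thesis by (simp add: L2_iff)
qed

lemma L2_cmult: "f \<in> L2_space \<Longrightarrow> (\<lambda>x. c * f x) \<in> L2_space"
  by (rule L2_bounded_mult[of _ _ "\<bar>c\<bar>"]) auto

lemma L2_diff: "f \<in> L2_space \<Longrightarrow> g \<in> L2_space \<Longrightarrow> (\<lambda>x. f x - g x) \<in> L2_space"
  using L2_add[of f "\<lambda>x. (-1) * g x"] L2_cmult[of g "-1"] by simp

lemma integrable_reflect:
  fixes f :: "real \<Rightarrow> real"
  shows "integrable lborel f \<Longrightarrow> integrable lborel (\<lambda>x. f (- x))"
  using lborel_integrable_real_affine[of f "-1" 0] by simp

lemma integral_reflect:
  fixes f :: "real \<Rightarrow> real"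
  shows "(\<integral>x. f (- x) \<partial>lborel) = (\<integral>x. f x \<partial>lborel)"
  using lborel_integral_real_affine[of "-1" f 0] by simp

lemma L2_reflect: "f \<in> L2_space \<Longrightarrow> (\<lambda>x. f (- x)) \<in> L2_space"
  using integrable_reflect[of "\<lambda>x. (f x)\<^sup>2"] by (auto simp: L2_iff)

lemma integral_Icc_le:
  fixes h :: "real \<Rightarrow> real"
  assumes "integrable lborel h" "\<And>x. 0 \<le> h x"
  shows "h integrable_on {a..b}" "integral {a..b} h \<le> (\<integral>x. h x \<partial>lborel)"
proof -
  have si: "set_integrable lborel {a..b} h"
    unfolding set_integrable_def
    by (rule integrable_mult_indicator) (use assms in auto)
  show "h integrable_on {a..b}" by (rule integrable_on_of_set_integrable[OF si])
  have "integral {a..b} h = (LINT x:{a..b}|lborel. h x)"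
    using set_borel_integral_eq_integral(2)[OF si] by simp
  also have "\<dots> \<le> (\<integral>x. h x \<partial>lborel)"
    unfolding set_lebesgue_integral_def
    by (rule integral_mono) (use assms si in \<open>auto simp: set_integrable_def indicator_def\<close>)
  finally show "integral {a..b} h \<le> (\<integral>x. h x \<partial>lborel)" .
qed

text \<open>From 2 \<bar>f g\<bar> \<le> f^2 + g^2 one gets f(x)^2 \<le> f(y)^2 + K for all y in
  [x, x+1]; averaging over y gives the bound. The factor 2 collects one contribution from the
  average and one from K.\<close>

lemma primitive_L2_bound:
  assumes p: "primitive f g" and f: "f \<in> L2_space" and g: "g \<in> L2_space"
  shows "(f x)\<^sup>2 \<le> 2 * (\<integral>x. (f x)\<^sup>2 \<partial>lborel) + (\<integral>x. (g x)\<^sup>2 \<partial>lborel)"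
proof -
  define K where "K = (\<integral>x. (f x)\<^sup>2 + (g x)\<^sup>2 \<partial>lborel)"
  have i: "integrable lborel (\<lambda>x. (f x)\<^sup>2 + (g x)\<^sup>2)"
    using f g by (simp add: L2_iff)
  have p2: "primitive (\<lambda>x. (f x)\<^sup>2) (\<lambda>x. 2 * f x * g x)"
    by (rule primitive_compose[OF p, of "\<lambda>t. t\<^sup>2" "\<lambda>t. 2 * t"])
      (auto intro!: derivative_eq_intros continuous_intros)
  have "(f x)\<^sup>2 \<le> (f y)\<^sup>2 + K" if "y \<in> {x..x+1}" for y
  proof -
    have "(f x)\<^sup>2 = (f y)\<^sup>2 + (- integral {x..y} (\<lambda>x. 2 * f x * g x))"
      using primitive_integral[OF p2, of x y] that by simp
    also have "- integral {x..y} (\<lambda>x. 2 * f x * g x) \<le> integral {x..y} (\<lambda>x. (f x)\<^sup>2 + (g x)\<^sup>2)"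
      unfolding integral_neg[symmetric]
    proof (rule integral_le)
      show "(\<lambda>x. - (2 * f x * g x)) integrable_on {x..y}"
        by (rule integrable_neg[OF primitive_integrable_on[OF p2]])
      show "(\<lambda>x. (f x)\<^sup>2 + (g x)\<^sup>2) integrable_on {x..y}"
        by (rule integral_Icc_le(1)[OF i]) simp
      show "- (2 * f z * g z) \<le> (f z)\<^sup>2 + (g z)\<^sup>2" for z
        using zero_le_power2[of "f z + g z"] by (simp add: power2_sum)
    qed
    also have "integral {x..y} (\<lambda>x. (f x)\<^sup>2 + (g x)\<^sup>2) \<le> K"
      unfolding K_def by (rule integral_Icc_le(2)[OF i]) simp
    finally show ?thesis by simp
  qed
  moreover have fi: "(\<lambda>y. (f y)\<^sup>2) integrable_on {x..x+1}"
    using f by (intro integral_Icc_le(1)) (auto simp: L2_iff)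
  ultimately have "integral {x..x+1} (\<lambda>y. (f x)\<^sup>2) \<le> integral {x..x+1} (\<lambda>y. (f y)\<^sup>2 + K)"
    by (intro integral_le integrable_add) auto
  also have "\<dots> = integral {x..x+1} (\<lambda>y. (f y)\<^sup>2) + K"
    using fi by (subst Henstock_Kurzweil_Integration.integral_add) auto
  also have "integral {x..x+1} (\<lambda>y. (f y)\<^sup>2) \<le> (\<integral>x. (f x)\<^sup>2 \<partial>lborel)"
    using f by (intro integral_Icc_le) (auto simp: L2_iff)
  also have "K = (\<integral>x. (f x)\<^sup>2 \<partial>lborel) + (\<integral>x. (g x)\<^sup>2 \<partial>lborel)"
    unfolding K_def using f g by (simp add: L2_iff)
  finally show ?thesis by simp
qed

definition weighted_H1 :: "(real \<Rightarrow> real) set" where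
  "weighted_H1 = H1_space \<inter> L21_space"

lemma weak_deriv:
  assumes "f \<in> weighted_H1"
  shows "primitive f (weak_deriv f)" "weak_deriv f \<in> L2_space"
proof -
  have "\<exists>g. g \<in> L2_space \<and> has_weak_derivative f g" and c: "continuous_on UNIV f"
    using assms by (auto simp: weighted_H1_def H1_space_def)
  from this(1) have "weak_deriv f \<in> L2_space \<and> has_weak_derivative f (weak_deriv f)"
    unfolding weak_deriv_def by (rule someI_ex)
  then show "primitive f (weak_deriv f)" "weak_deriv f \<in> L2_space"
    using weak_derivative_imp_primitive[OF c] by auto
qed

lemma weighted_H1_L2:
  assumes "f \<in> weighted_H1" shows "f \<in> L2_space" "(\<lambda>x. x * f x) \<in> L2_space"
proof -
  show f: "f \<in> L2_space"
    using assms by (auto simp: weighted_H1_def H1_space_def)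
  have "(\<lambda>x. \<bar>x\<bar> * f x) \<in> L2_space"
    using assms by (auto simp: weighted_H1_def L21_space_def)
  then show "(\<lambda>x. x * f x) \<in> L2_space"
    using f by (auto simp: L2_iff power_mult_distrib)
qed

lemma weighted_H1_continuous: "f \<in> weighted_H1 \<Longrightarrow> continuous_on S f"
  by (rule primitive_continuous[OF weak_deriv(1)])

lemma weighted_H1_measurable [measurable_dest]: "f \<in> weighted_H1 \<Longrightarrow> f \<in> borel_measurable borel"
  by (rule L2_measurable[OF weighted_H1_L2(1)])

lemma weak_deriv_measurable [measurable_dest]: "f \<in> weighted_H1 \<Longrightarrow> weak_deriv f \<in> borel_measurable borel"
  by (rule L2_measurable[OF weak_deriv(2)])

text \<open>Since \<open>weak_deriv\<close> is an arbitrary choice, it can be identified only almost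
  everywhere. That is enough to evaluate every integral with a derivative computed by hand.\<close>

lemma weighted_H1I:
  assumes "primitive f g" "g \<in> L2_space" "f \<in> L2_space" "(\<lambda>x. x * f x) \<in> L2_space"
  shows "f \<in> weighted_H1" "AE x in lborel. weak_deriv f x = g x"
proof -
  have [measurable]: "f \<in> borel_measurable borel" by (rule L2_measurable[OF assms(3)])
  have "(\<lambda>x. \<bar>x\<bar> * f x) \<in> L2_space"
    using assms(4) by (auto simp: L2_iff power_mult_distrib)
  then show f: "f \<in> weighted_H1"
    using assms primitive_imp_weak_derivative[OF assms(1)] primitive_continuous[OF assms(1)]
    by (auto simp: weighted_H1_def H1_space_def L21_space_def)
  show "AE x in lborel. weak_deriv f x = g x"
    by (rule primitive_AE_unique[OF weak_deriv(1)[OF f] assms(1)])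
qed

lemma weighted_H1_add:
  assumes "f \<in> weighted_H1" "g \<in> weighted_H1"
  shows "(\<lambda>x. f x + g x) \<in> weighted_H1"
    "AE x in lborel. weak_deriv (\<lambda>x. f x + g x) x = weak_deriv f x + weak_deriv g x"
proof -
  have "(\<lambda>x. x * f x + x * g x) \<in> L2_space"
    by (intro L2_add weighted_H1_L2 assms)
  then have "(\<lambda>x. x * (f x + g x)) \<in> L2_space"
    by (simp add: distrib_left)
  from weighted_H1I[OF primitive_add[OF assms[THEN weak_deriv(1)]] L2_add[OF assms[THEN weak_deriv(2)]]
      L2_add[OF assms[THEN weighted_H1_L2(1)]] this]
  show "(\<lambda>x. f x + g x) \<in> weighted_H1"
    "AE x in lborel. weak_deriv (\<lambda>x. f x + g x) x = weak_deriv f x + weak_deriv g x" .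
qed

lemma weighted_H1_cmult:
  assumes "f \<in> weighted_H1"
  shows "(\<lambda>x. c * f x) \<in> weighted_H1"
    "AE x in lborel. weak_deriv (\<lambda>x. c * f x) x = c * weak_deriv f x"
proof -
  have "(\<lambda>x. c * (x * f x)) \<in> L2_space"
    by (intro L2_cmult weighted_H1_L2 assms)
  then have "(\<lambda>x. x * (c * f x)) \<in> L2_space"
    by (simp add: mult.left_commute)
  from weighted_H1I[OF primitive_cmult[OF weak_deriv(1)[OF assms]] L2_cmult[OF weak_deriv(2)[OF assms]]
      L2_cmult[OF weighted_H1_L2(1)[OF assms]] this]
  show "(\<lambda>x. c * f x) \<in> weighted_H1"
    "AE x in lborel. weak_deriv (\<lambda>x. c * f x) x = c * weak_deriv f x" .
qed

lemma weighted_H1_reflect: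
  assumes "f \<in> weighted_H1"
  shows "(\<lambda>x. f (- x)) \<in> weighted_H1"
    "AE x in lborel. weak_deriv (\<lambda>x. f (- x)) x = - weak_deriv f (- x)"
proof -
  have "(\<lambda>x. (-1) * (- x * f (- x))) \<in> L2_space"
    using L2_cmult[OF L2_reflect[OF weighted_H1_L2(2)[OF assms]], of "-1"] .
  then have x: "(\<lambda>x. x * f (- x)) \<in> L2_space" by simp
  have d: "(\<lambda>x. - weak_deriv f (- x)) \<in> L2_space"
    using L2_cmult[OF L2_reflect[OF weak_deriv(2)[OF assms]], of "-1"] by simp
  from weighted_H1I[OF primitive_reflect[OF weak_deriv(1)[OF assms]] d
      L2_reflect[OF weighted_H1_L2(1)[OF assms]] x]
  show "(\<lambda>x. f (- x)) \<in> weighted_H1"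
    "AE x in lborel. weak_deriv (\<lambda>x. f (- x)) x = - weak_deriv f (- x)" .
qed

lemma weighted_H1_sign_mult:
  assumes f: "f \<in> weighted_H1" and p: "primitive (\<lambda>x. s x * f x) (\<lambda>x. s x * weak_deriv f x)"
    and m: "s \<in> borel_measurable borel" and s: "\<And>x. \<bar>s x\<bar> \<le> 1"
  shows "(\<lambda>x. s x * f x) \<in> weighted_H1"
    "AE x in lborel. weak_deriv (\<lambda>x. s x * f x) x = s x * weak_deriv f x"
proof -
  have "(\<lambda>x. s x * (x * f x)) \<in> L2_space"
    by (intro L2_bounded_mult[OF _ m s] weighted_H1_L2 f)
  then have x: "(\<lambda>x. x * (s x * f x)) \<in> L2_space" by (simp add: mult.left_commute)
  have d: "(\<lambda>x. s x * weak_deriv f x) \<in> L2_space"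
    by (rule L2_bounded_mult[OF weak_deriv(2)[OF f] m s])
  have sf: "(\<lambda>x. s x * f x) \<in> L2_space"
    by (rule L2_bounded_mult[OF weighted_H1_L2(1)[OF f] m s])
  show "(\<lambda>x. s x * f x) \<in> weighted_H1"
    by (rule weighted_H1I(1)[OF p d sf x])
  show "AE x in lborel. weak_deriv (\<lambda>x. s x * f x) x = s x * weak_deriv f x"
    by (rule weighted_H1I(2)[OF p d sf x])
qed

lemma weighted_H1_abs:
  assumes f: "f \<in> weighted_H1"
  shows "(\<lambda>x. \<bar>f x\<bar>) \<in> weighted_H1"
    "AE x in lborel. weak_deriv (\<lambda>x. \<bar>f x\<bar>) x = sgn (f x) * weak_deriv f x"
proof -
  note [measurable] = weighted_H1_measurable[OF f]
  have eq: "(\<lambda>x. \<bar>f x\<bar>) = (\<lambda>x. sgn (f x) * f x)" by (rule ext) (simp add: sgn_real_def abs_if)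
  have p: "primitive (\<lambda>x. sgn (f x) * f x) (\<lambda>x. sgn (f x) * weak_deriv f x)"
    using primitive_abs[OF weak_deriv(1)[OF f]] by (simp only: eq)
  have s: "\<bar>sgn (f x)\<bar> \<le> 1" for x by (simp add: sgn_if)
  have m: "(\<lambda>x. sgn (f x)) \<in> borel_measurable borel" by measurable
  show "(\<lambda>x. \<bar>f x\<bar>) \<in> weighted_H1"
    "AE x in lborel. weak_deriv (\<lambda>x. \<bar>f x\<bar>) x = sgn (f x) * weak_deriv f x"
    unfolding eq by (rule weighted_H1_sign_mult[OF f p m s])+
qed

lemma weighted_H1_sign_at:
  assumes f: "f \<in> weighted_H1" and "f c = 0"
  shows "(\<lambda>x. sgn (x - c) * f x) \<in> weighted_H1"
    "AE x in lborel. weak_deriv (\<lambda>x. sgn (x - c) * f x) x = sgn (x - c) * weak_deriv f x"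
  by (rule weighted_H1_sign_mult[OF f primitive_sign_mult[OF weak_deriv(1)[OF f] assms(2)]]; simp add: sgn_if)+

lemma weighted_H1_bounded:
  assumes f: "f \<in> weighted_H1" obtains M where "M > 0" "\<And>x. \<bar>f x\<bar> \<le> M"
proof -
  define K where "K = 2 * (\<integral>x. (f x)\<^sup>2 \<partial>lborel) + (\<integral>x. (weak_deriv f x)\<^sup>2 \<partial>lborel)"
  have "\<bar>f x\<bar> \<le> sqrt K" for x
    using primitive_L2_bound[OF weak_deriv(1)[OF f] weighted_H1_L2(1)[OF f] weak_deriv(2)[OF f], of x]
    by (simp add: K_def real_le_rsqrt)
  then have "\<bar>f x\<bar> \<le> \<bar>sqrt K\<bar> + 1" for x
    by (meson abs_ge_self le_add_same_cancel1 order_trans zero_le_one)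
  then show thesis by (intro that[of "\<bar>sqrt K\<bar> + 1"]) auto
qed

lemma weighted_H1_mult_L2:
  assumes f: "f \<in> weighted_H1" and g: "g \<in> weighted_H1"
  shows "(\<lambda>x. f x * g x) \<in> L2_space"
proof -
  obtain M where "\<And>x. \<bar>f x\<bar> \<le> M" using weighted_H1_bounded[OF f] by blast
  then show ?thesis
    using f by (intro L2_bounded_mult[OF weighted_H1_L2(1)[OF g]]) auto
qed

lemma weighted_H1_mult_C1:
  assumes f: "f \<in> weighted_H1" and q: "\<And>x. (q has_real_derivative q' x) (at x)" "continuous_on UNIV q'"
    and b: "\<And>x. \<bar>q x\<bar> \<le> M" "\<And>x. \<bar>q' x\<bar> \<le> M"
  shows "(\<lambda>x. f x * q x) \<in> weighted_H1"
    "AE x in lborel. weak_deriv (\<lambda>x. f x * q x) x = f x * q' x + weak_deriv f x * q x"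
proof -
  have pq: "primitive q q'" by (rule primitive_C1[OF q])
  have [measurable]: "q \<in> borel_measurable borel" "q' \<in> borel_measurable borel"
    using primitive_borel[OF pq] primitive_measurable[OF pq] by auto
  have "(\<lambda>x. q' x * f x + q x * weak_deriv f x) \<in> L2_space"
    by (intro L2_add L2_bounded_mult[OF _ _ b(1)] L2_bounded_mult[OF _ _ b(2)] weighted_H1_L2 weak_deriv f) simp_all
  moreover have "(\<lambda>x. q x * f x) \<in> L2_space" "(\<lambda>x. q x * (x * f x)) \<in> L2_space"
    by (intro L2_bounded_mult[OF _ _ b(1)] weighted_H1_L2 f; simp)+
  ultimately show "(\<lambda>x. f x * q x) \<in> weighted_H1"
    "AE x in lborel. weak_deriv (\<lambda>x. f x * q x) x = f x * q' x + weak_deriv f x * q x"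
    using weighted_H1I[OF primitive_mult[OF weak_deriv(1)[OF f] pq]] by (simp_all add: mult_ac)
qed

text \<open>It allows a symmetric state to be represented by its first component alone, so that
  minimization runs over an unconstrained linear space.\<close>

lemma sym_energy_space_iff:
  "\<Psi> \<in> sym_energy_space \<longleftrightarrow> (\<exists>f\<in>weighted_H1. \<Psi> = (f, \<lambda>x. f (- x)))"
proof
  assume "\<Psi> \<in> sym_energy_space"
  then obtain f g where fg: "\<Psi> = (f, g)" "f \<in> weighted_H1" "\<forall>x. f x = g (- x)"
    by (auto simp: sym_energy_space_def energy_space_def weighted_H1_def)
  moreover have "g = (\<lambda>x. f (- x))" using fg(3) by auto
  ultimately show "\<exists>f\<in>weighted_H1. \<Psi> = (f, \<lambda>x. f (- x))" by blast
next
  assume "\<exists>f\<in>weighted_H1. \<Psi> = (f, \<lambda>x. f (- x))"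
  then show "\<Psi> \<in> sym_energy_space"
    using weighted_H1_reflect(1) by (auto simp: sym_energy_space_def energy_space_def weighted_H1_def)
qed

section \<open>The energy as a functional of one function\<close>

text \<open>The energy density of (f, f(-x)) is the sum of this expression at x and at -x. The cross
  term has coefficient 1 + (\<gamma> - 1) = \<gamma>, half of it on each side. The derivative is a
  separate argument because \<open>weak_deriv\<close> may be replaced by any almost everywhere equal
  function.\<close>

definition sym_density :: "real \<Rightarrow> real \<Rightarrow> (real \<Rightarrow> real) \<Rightarrow> (real \<Rightarrow> real) \<Rightarrow> real \<Rightarrow> real" where
  "sym_density \<epsilon> \<gamma> f g x = \<epsilon>\<^sup>2 * (g x)\<^sup>2 + (x\<^sup>2 - 1) * (f x)\<^sup>2 + 1/2 * (f x)^4 + \<gamma>/2 * (f x)\<^sup>2 * (f (- x))\<^sup>2"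

definition sym_energy :: "real \<Rightarrow> real \<Rightarrow> (real \<Rightarrow> real) \<Rightarrow> real" where
  "sym_energy \<epsilon> \<gamma> f = (\<integral>x. sym_density \<epsilon> \<gamma> f (weak_deriv f) x \<partial>lborel)"

lemma weighted_H1_integrable:
  assumes "f \<in> weighted_H1" "g \<in> weighted_H1"
  shows "integrable lborel (\<lambda>x. (f x)\<^sup>2)" "integrable lborel (\<lambda>x. x\<^sup>2 * (f x)\<^sup>2)"
    "integrable lborel (\<lambda>x. (weak_deriv f x)\<^sup>2)" "integrable lborel (\<lambda>x. (f x)^4)"
    "integrable lborel (\<lambda>x. (f x)\<^sup>2 * (g x)\<^sup>2)"
proof -
  show "integrable lborel (\<lambda>x. (f x)\<^sup>2)" "integrable lborel (\<lambda>x. x\<^sup>2 * (f x)\<^sup>2)"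
    "integrable lborel (\<lambda>x. (weak_deriv f x)\<^sup>2)"
    using weighted_H1_L2[OF assms(1)] weak_deriv[OF assms(1)] by (auto simp: L2_iff power_mult_distrib)
  have "integrable lborel (\<lambda>x. (f x * f x)\<^sup>2)"
    by (intro L2_integrable_square weighted_H1_mult_L2 assms)
  then show "integrable lborel (\<lambda>x. (f x)^4)" by (simp add: power_mult_distrib power4_eq_xxxx power2_eq_square mult.assoc)
  have "integrable lborel (\<lambda>x. (f x * g x)\<^sup>2)"
    by (intro L2_integrable_square weighted_H1_mult_L2 assms)
  then show "integrable lborel (\<lambda>x. (f x)\<^sup>2 * (g x)\<^sup>2)" by (simp add: power_mult_distrib)
qed

lemma sym_density_integrable:
  assumes f: "f \<in> weighted_H1" and g: "g \<in> L2_space"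
  shows "integrable lborel (sym_density \<epsilon> \<gamma> f g)"
proof -
  have "integrable lborel (\<lambda>x. \<epsilon>\<^sup>2 * (g x)\<^sup>2 + (x\<^sup>2 * (f x)\<^sup>2 - (f x)\<^sup>2) + 1/2 * (f x)^4 + \<gamma>/2 * ((f x)\<^sup>2 * (f (- x))\<^sup>2))"
    using weighted_H1_integrable[OF f weighted_H1_reflect(1)[OF f]] L2_integrable_square[OF g] by simp
  then show ?thesis
    by (rule back_subst[of "integrable lborel"]) (auto simp: sym_density_def algebra_simps)
qed

lemma energy_symmetric:
  assumes f: "f \<in> weighted_H1"
  shows "energy \<epsilon> \<gamma> (f, \<lambda>x. f (- x)) = sym_energy \<epsilon> \<gamma> f"
proof -
  note [measurable] = weighted_H1_measurable[OF f] weak_deriv_measurable[OF f]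
    weak_deriv_measurable[OF weighted_H1_reflect(1)[OF f]]
  let ?d = "sym_density \<epsilon> \<gamma> f (weak_deriv f)"
  have m[measurable]: "?d \<in> borel_measurable borel"
    unfolding sym_density_def[abs_def] by measurable
  have i: "integrable lborel ?d" by (rule sym_density_integrable[OF f weak_deriv(2)[OF f]])
  have "energy \<epsilon> \<gamma> (f, \<lambda>x. f (- x)) = 1/2 * (\<integral>x. ?d x + ?d (- x) \<partial>lborel)"
    unfolding energy.simps
  proof (intro arg_cong2[of _ _ _ _ "(*)"] refl integral_cong_AE)
    show "AE x in lborel. \<epsilon>\<^sup>2 * (weak_deriv f x)\<^sup>2 + \<epsilon>\<^sup>2 * (weak_deriv (\<lambda>x. f (- x)) x)\<^sup>2
        + (x\<^sup>2 - 1) * ((f x)\<^sup>2 + (f (- x))\<^sup>2) + 1 / 2 * ((f x)\<^sup>2 + (f (- x))\<^sup>2)\<^sup>2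
        + (\<gamma> - 1) * (f x)\<^sup>2 * (f (- x))\<^sup>2 = ?d x + ?d (- x)"
      using weighted_H1_reflect(2)[OF f]
    proof (rule eventually_mono)
      fix x assume *: "weak_deriv (\<lambda>x. f (- x)) x = - weak_deriv f (- x)"
      show "\<epsilon>\<^sup>2 * (weak_deriv f x)\<^sup>2 + \<epsilon>\<^sup>2 * (weak_deriv (\<lambda>x. f (- x)) x)\<^sup>2
        + (x\<^sup>2 - 1) * ((f x)\<^sup>2 + (f (- x))\<^sup>2) + 1 / 2 * ((f x)\<^sup>2 + (f (- x))\<^sup>2)\<^sup>2
        + (\<gamma> - 1) * (f x)\<^sup>2 * (f (- x))\<^sup>2 = ?d x + ?d (- x)"
        unfolding * sym_density_def by (simp, algebra)
    qed
  qed measurable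
  also have "(\<integral>x. ?d x + ?d (- x) \<partial>lborel) = (\<integral>x. ?d x \<partial>lborel) + (\<integral>x. ?d (- x) \<partial>lborel)"
    by (rule Bochner_Integration.integral_add[OF i integrable_reflect[OF i]])
  finally show ?thesis
    unfolding integral_reflect sym_energy_def by simp
qed

lemma global_minimizer_symmetric:
  assumes f: "f \<in> weighted_H1" and min: "\<And>h. h \<in> weighted_H1 \<Longrightarrow> sym_energy \<epsilon> \<gamma> f \<le> sym_energy \<epsilon> \<gamma> h"
  shows "global_minimizer (energy \<epsilon> \<gamma>) sym_energy_space (f, \<lambda>x. f (- x))"
  unfolding global_minimizer_def
proof (intro conjI ballI)
  show "(f, \<lambda>x. f (- x)) \<in> sym_energy_space"
    using f sym_energy_space_iff by blast
  fix \<Phi> assume "\<Phi> \<in> sym_energy_space"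
  then obtain h where h: "h \<in> weighted_H1" "\<Phi> = (h, \<lambda>x. h (- x))"
    using sym_energy_space_iff by blast
  then show "energy \<epsilon> \<gamma> (f, \<lambda>x. f (- x)) \<le> energy \<epsilon> \<gamma> \<Phi>"
    using min[OF h(1)] by (simp only: energy_symmetric[OF f] energy_symmetric[OF h(1)])
qed

lemma weighted_H1_primitive_L2:
  assumes f: "f \<in> weighted_H1" and p: "primitive f g"
  shows "g \<in> L2_space"
proof -
  note [measurable] = primitive_measurable[OF p] weak_deriv_measurable[OF f]
  have ae: "AE x in lborel. weak_deriv f x = g x"
    by (rule primitive_AE_unique[OF weak_deriv(1)[OF f] p])
  have "integrable lborel (\<lambda>x. (weak_deriv f x)\<^sup>2) \<longleftrightarrow> integrable lborel (\<lambda>x. (g x)\<^sup>2)"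
    by (rule integrable_cong_AE) (use ae in \<open>auto elim: eventually_mono\<close>)
  then show ?thesis
    using L2_integrable_square[OF weak_deriv(2)[OF f]] by (simp add: L2_iff)
qed

lemma sym_density_measurable [measurable]:
  assumes [measurable]: "f \<in> borel_measurable borel" "g \<in> borel_measurable borel"
  shows "sym_density \<epsilon> \<gamma> f g \<in> borel_measurable borel"
  unfolding sym_density_def[abs_def] by measurable

lemma sym_energy_eq:
  assumes f: "f \<in> weighted_H1" and p: "primitive f g"
  shows "sym_energy \<epsilon> \<gamma> f = (\<integral>x. sym_density \<epsilon> \<gamma> f g x \<partial>lborel)"
  unfolding sym_energy_def
proof (rule integral_cong_AE)
  note [measurable] = weighted_H1_measurable[OF f] primitive_measurable[OF p] weak_deriv_measurable[OF f]
  show "sym_density \<epsilon> \<gamma> f (weak_deriv f) \<in> borel_measurable lborel"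
    "sym_density \<epsilon> \<gamma> f g \<in> borel_measurable lborel" by simp_all
  show "AE x in lborel. sym_density \<epsilon> \<gamma> f (weak_deriv f) x = sym_density \<epsilon> \<gamma> f g x"
    using primitive_AE_unique[OF weak_deriv(1)[OF f] p]
    by (rule eventually_mono) (simp add: sym_density_def)
qed

text \<open>Splitting x^2 - 1 into (1 + x^2)/2 + (x^2 - 3)/2 leaves a term that is negative only
  where x^2 < 3, inside [-2, 2]. There s^2/2 - 3s/2 \<ge> -9/8 with s = f(x)^2, the minimum being at
  s = 3/2.\<close>

lemma sym_density_lower:
  assumes "\<gamma> \<ge> 0"
  shows "\<epsilon>\<^sup>2 * (g x)\<^sup>2 + 1/2 * (1 + x\<^sup>2) * (f x)\<^sup>2 - 9/8 * indicator {-2..2} x \<le> sym_density \<epsilon> \<gamma> f g x"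
proof -
  define s where "s = (f x)\<^sup>2"
  have s0: "s \<ge> 0" by (simp add: s_def)
  have "0 \<le> (1/2 * x\<^sup>2 - 3/2) * s + 1/2 * s\<^sup>2 + 9/8 * indicator {-2..2} x"
  proof (cases "x \<in> {-2..2}")
    case True
    have "0 \<le> ((s - 3/2)\<^sup>2 + x\<^sup>2 * s) / 2" using s0 by simp
    also have "\<dots> = (1/2 * x\<^sup>2 - 3/2) * s + 1/2 * s\<^sup>2 + 9/8"
      by (simp add: power2_eq_square field_simps)
    finally show ?thesis using True by simp
  next
    case False
    then have "2 < \<bar>x\<bar>" by auto
    then have "2\<^sup>2 < \<bar>x\<bar>\<^sup>2" by (intro power_strict_mono) auto
    then have "0 \<le> (1/2 * x\<^sup>2 - 3/2) * s" using s0 by (intro mult_nonneg_nonneg) auto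
    then show ?thesis using False by simp
  qed
  moreover have "0 \<le> \<gamma>/2 * (f x)\<^sup>2 * (f (- x))\<^sup>2" using assms by simp
  moreover have "(f x)^4 = s\<^sup>2" by (simp add: s_def)
  ultimately show ?thesis
    by (simp add: sym_density_def s_def[symmetric] algebra_simps)
qed

lemma sym_density_nonneg:
  assumes "\<gamma> \<ge> 0" "1 \<le> \<bar>x\<bar>"
  shows "0 \<le> sym_density \<epsilon> \<gamma> f g x"
proof -
  have "1 \<le> x\<^sup>2" using assms(2) by (metis one_le_power power2_abs)
  then show ?thesis unfolding sym_density_def using assms(1) by (intro add_nonneg_nonneg mult_nonneg_nonneg) auto
qed

text \<open>The constant 9/2 is 9/8 times the length 4 of the interval [-2, 2].\<close>

lemma sym_energy_coercive:
  assumes f: "f \<in> weighted_H1" and p: "primitive f g" and \<gamma>: "\<gamma> \<ge> 0"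
  shows "\<epsilon>\<^sup>2 * (\<integral>x. (g x)\<^sup>2 \<partial>lborel) + 1/2 * (\<integral>x. (f x)\<^sup>2 \<partial>lborel) \<le> sym_energy \<epsilon> \<gamma> f + 9/2"
proof -
  note g = weighted_H1_primitive_L2[OF f p]
  have i: "integrable lborel (\<lambda>x. \<epsilon>\<^sup>2 * (g x)\<^sup>2)" "integrable lborel (\<lambda>x. 1/2 * (f x)\<^sup>2)"
    using L2_integrable_square[OF g] weighted_H1_integrable(1)[OF f f] by simp_all
  have j: "integrable lborel (\<lambda>x. 9/8 * indicator {-2..2::real} x :: real)"
    by (intro integrable_mult_right integrable_real_indicator) auto
  have "\<epsilon>\<^sup>2 * (\<integral>x. (g x)\<^sup>2 \<partial>lborel) + 1/2 * (\<integral>x. (f x)\<^sup>2 \<partial>lborel)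
      = (\<integral>x. \<epsilon>\<^sup>2 * (g x)\<^sup>2 + 1/2 * (f x)\<^sup>2 \<partial>lborel)"
    using i by simp
  also have "\<dots> \<le> (\<integral>x. sym_density \<epsilon> \<gamma> f g x + 9/8 * indicator {-2..2::real} x \<partial>lborel)"
  proof (rule integral_mono)
    show "integrable lborel (\<lambda>x. \<epsilon>\<^sup>2 * (g x)\<^sup>2 + 1/2 * (f x)\<^sup>2)" using i by (rule Bochner_Integration.integrable_add)
    show "integrable lborel (\<lambda>x. sym_density \<epsilon> \<gamma> f g x + 9/8 * indicator {-2..2::real} x)"
      using sym_density_integrable[OF f g] j by (rule Bochner_Integration.integrable_add)
    show "\<epsilon>\<^sup>2 * (g x)\<^sup>2 + 1/2 * (f x)\<^sup>2 \<le> sym_density \<epsilon> \<gamma> f g x + 9/8 * indicator {-2..2::real} x" for x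
    proof -
      have "0 \<le> x\<^sup>2 * (f x)\<^sup>2" by simp
      then have "1/2 * (f x)\<^sup>2 \<le> 1/2 * (1 + x\<^sup>2) * (f x)\<^sup>2" by (simp add: distrib_right)
      then show ?thesis
        using sym_density_lower[OF \<gamma>, of \<epsilon> g x f] by linarith
    qed
  qed
  also have "\<dots> = sym_energy \<epsilon> \<gamma> f + (\<integral>x. 9/8 * indicator {-2..2::real} x \<partial>lborel)"
    using Bochner_Integration.integral_add[OF sym_density_integrable[OF f g] j] sym_energy_eq[OF f p] by simp
  also have "(\<integral>x. 9/8 * indicator {-2..2::real} x \<partial>lborel) = (9/2::real)"
    by simp
  finally show ?thesis .
qed

lemma L2_compact_support:
  assumes [measurable]: "h \<in> borel_measurable borel" and "\<And>x. \<bar>h x\<bar> \<le> M" "\<And>x. x \<notin> {a..b} \<Longrightarrow> h x = 0"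
  shows "h \<in> L2_space"
proof -
  have "indicator {a..b::real} \<in> L2_space"
    by (auto simp: L2_iff power2_eq_square indicator_inter_arith[symmetric] emeasure_lborel_Icc_eq intro!: integrable_real_indicator)
  then have "(\<lambda>x. h x * indicator {a..b} x) \<in> L2_space"
    by (rule L2_bounded_mult[OF _ _ assms(2)]) simp
  moreover have "h x * indicator {a..b} x = h x" for x
    using assms(3)[of x] by (cases "x \<in> {a..b}") auto
  ultimately show ?thesis by simp
qed

section \<open>Piecewise linear test functions\<close>

text \<open>For a < b < c this is the hat on [a, c] with apex b, scaled to height (b - a)(c - b), so
  that its slopes are c - b and -(b - a). As a combination of absolute values it gets its derivative
  from \<open>primitive_abs\<close> without case distinctions.\<close>

definition tent :: "real \<Rightarrow> real \<Rightarrow> real \<Rightarrow> real \<Rightarrow> real" where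
  "tent a b c x = ((c - b) * \<bar>x - a\<bar> - (c - a) * \<bar>x - b\<bar> + (b - a) * \<bar>x - c\<bar>) / 2"

definition tent_deriv :: "real \<Rightarrow> real \<Rightarrow> real \<Rightarrow> real \<Rightarrow> real" where
  "tent_deriv a b c x = ((c - b) * sgn (x - a) - (c - a) * sgn (x - b) + (b - a) * sgn (x - c)) / 2"

lemma primitive_tent: "primitive (tent a b c) (tent_deriv a b c)"
proof -
  have p: "primitive (\<lambda>x. \<bar>x - a\<bar>) (\<lambda>x. sgn (x - a))" for a
  proof -
    have "primitive (\<lambda>x. x - a) (\<lambda>x. 1)"
      by (rule primitive_C1) (auto intro!: derivative_eq_intros)
    from primitive_abs[OF this] show ?thesis by simp
  qed
  have "primitive (\<lambda>x. (c - b)/2 * \<bar>x - a\<bar> + (- (c - a)/2) * \<bar>x - b\<bar> + (b - a)/2 * \<bar>x - c\<bar>)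
     (\<lambda>x. (c - b)/2 * sgn (x - a) + (- (c - a)/2) * sgn (x - b) + (b - a)/2 * sgn (x - c))"
    by (intro primitive_add primitive_cmult p)
  then show ?thesis
    by (rule arg_cong2[of _ _ _ _ primitive, THEN iffD1, rotated -1])
      (auto simp: tent_def tent_deriv_def fun_eq_iff field_simps)
qed

lemma tent_outside:
  assumes "a < b" "b < c" "x \<notin> {a..c}"
  shows "tent a b c x = 0" "tent_deriv a b c x = 0"
  using assms by (auto simp: tent_def tent_deriv_def algebra_simps sgn_if abs_if not_le)

lemma tent_bounds:
  assumes "a < b" "b < c"
  shows "\<bar>tent a b c x\<bar> \<le> (c - a)\<^sup>2" "\<bar>tent_deriv a b c x\<bar> \<le> c - a"
proof -
  show "\<bar>tent_deriv a b c x\<bar> \<le> c - a"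
    using assms by (auto simp: tent_deriv_def sgn_if abs_if field_simps)
  show "\<bar>tent a b c x\<bar> \<le> (c - a)\<^sup>2"
  proof (cases "x \<in> {a..c}")
    case True
    have "tent a b c x = (if x \<le> b then (x - a) * (c - b) else (c - x) * (b - a))"
      using True by (auto simp: tent_def abs_if field_simps)
    moreover have "\<bar>(x - a) * (c - b)\<bar> \<le> (c - a)\<^sup>2" "\<bar>(c - x) * (b - a)\<bar> \<le> (c - a)\<^sup>2"
      unfolding abs_mult power2_eq_square using True assms by (intro mult_mono; simp)+
    ultimately show ?thesis by auto
  qed (simp add: tent_outside[OF assms])
qed

lemma tent_weighted_H1:
  assumes "a < b" "b < c" shows "tent a b c \<in> weighted_H1"
proof (rule weighted_H1I(1)[OF primitive_tent])
  note m[measurable] = primitive_measurable[OF primitive_tent[of a b c]] primitive_borel[OF primitive_tent[of a b c]]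
  show "tent_deriv a b c \<in> L2_space"
    by (rule L2_compact_support[OF m(1) tent_bounds(2)[OF assms] tent_outside(2)[OF assms]])
  show "tent a b c \<in> L2_space"
    by (rule L2_compact_support[OF m(2) tent_bounds(1)[OF assms] tent_outside(1)[OF assms]])
  show "(\<lambda>x. x * tent a b c x) \<in> L2_space"
  proof (rule L2_compact_support)
    show "\<bar>x * tent a b c x\<bar> \<le> (\<bar>a\<bar> + \<bar>c\<bar>) * (c - a)\<^sup>2" for x
      using tent_outside(1)[OF assms, of x] tent_bounds(1)[OF assms, of x]
      by (cases "x \<in> {a..c}") (auto simp: abs_mult intro!: mult_mono)
    show "x * tent a b c x = 0" if "x \<notin> {a..c}" for x
      using tent_outside(1)[OF assms that] by simp
  qed simp
qed

text \<open>The integral of sgn(x - d) g over [l, r] is f(l) + f(r) - 2 f(d), as one sees by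
  subtracting the constant f(d) first. The three weights of the tent sum to zero, so the values at l
  and r cancel and a second difference remains.\<close>

lemma tent_deriv_has_integral:
  assumes p: "primitive f g" and abc: "a < b" "b < c" "l \<le> a" "c \<le> r"
  shows "((\<lambda>x. g x * tent_deriv a b c x) has_integral ((c - a) * f b - (c - b) * f a - (b - a) * f c)) {l..r}"
proof -
  have s: "((\<lambda>x. sgn (x - d) * g x) has_integral (f l + f r - 2 * f d)) {l..r}" if "l \<le> d" "d \<le> r" for d
  proof -
    have pc: "primitive (\<lambda>x. - f d) (\<lambda>x. 0)"
      by (rule primitive_C1) auto
    have "primitive (\<lambda>x. sgn (x - d) * (f x + - f d)) (\<lambda>x. sgn (x - d) * (g x + 0))"
      by (rule primitive_sign_mult[OF primitive_add[OF p pc]]) simp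
    from primitive_has_integral[OF this, of l r]
    have "((\<lambda>x. sgn (x - d) * g x) has_integral (sgn (r - d) * (f r - f d) - sgn (l - d) * (f l - f d))) {l..r}"
      using that by simp
    moreover have "sgn (r - d) * (f r - f d) - sgn (l - d) * (f l - f d) = f l + f r - 2 * f d"
      using that by (cases "r = d"; cases "l = d") (auto simp: sgn_if)
    ultimately show ?thesis by simp
  qed
  have "((\<lambda>x. (c - b)/2 * (sgn (x - a) * g x) + (- (c - a)/2) * (sgn (x - b) * g x) + (b - a)/2 * (sgn (x - c) * g x))
    has_integral ((c - b)/2 * (f l + f r - 2 * f a) + (- (c - a)/2) * (f l + f r - 2 * f b) + (b - a)/2 * (f l + f r - 2 * f c))) {l..r}"
    using abc by (intro has_integral_add has_integral_mult_right s) auto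
  then show ?thesis
    by (rule arg_cong2[of _ _ _ _ "\<lambda>u v. (u has_integral v) {l..r}", THEN iffD1, rotated -1])
      (auto simp: tent_deriv_def fun_eq_iff field_simps)
qed

section \<open>Rearrangement and compactness\<close>

text \<open>With A and B the even and odd parts of \<bar>f\<bar>, the maximum and minimum of its
  values at x and -x are A + \<bar>B\<bar> and A - \<bar>B\<bar>. Both are captured by the single
  function A + sgn(x) \<bar>B\<bar>, which stays in the space because B(0) = 0.\<close>

lemma reorder_states:
  assumes f: "f \<in> weighted_H1"
  shows "\<exists>h\<in>weighted_H1. (\<forall>x. 0 \<le> h x) \<and> (\<forall>x\<ge>0. h (- x) \<le> h x) \<and> sym_energy \<epsilon> \<gamma> h \<le> sym_energy \<epsilon> \<gamma> f"
proof -
  define g where "g = weak_deriv f"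
  have p: "primitive f g" unfolding g_def by (rule weak_deriv(1)[OF f])
  define F dF where "F x = \<bar>f x\<bar>" and "dF x = sgn (f x) * g x" for x
  have F: "F \<in> weighted_H1" unfolding F_def[abs_def] by (rule weighted_H1_abs[OF f])
  have pF: "primitive F dF" unfolding F_def[abs_def] dF_def[abs_def] by (rule primitive_abs[OF p])
  define A dA where "A x = 1/2 * (F x + F (- x))" and "dA x = 1/2 * (dF x + - dF (- x))" for x
  define B dB where "B x = 1/2 * (F x + (-1) * F (- x))" and "dB x = 1/2 * (dF x + (-1) * - dF (- x))" for x
  have A: "A \<in> weighted_H1" and B: "B \<in> weighted_H1"
    unfolding A_def[abs_def] B_def[abs_def]
    by (intro weighted_H1_cmult weighted_H1_add weighted_H1_reflect F)+
  have pA: "primitive A dA" and pB: "primitive B dB"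
    unfolding A_def[abs_def] B_def[abs_def] dA_def[abs_def] dB_def[abs_def]
    by (intro primitive_cmult primitive_add primitive_reflect pF)+
  have B0: "\<bar>B 0\<bar> = 0" by (simp add: B_def)
  define h dh where "h x = A x + sgn (x - 0) * \<bar>B x\<bar>" and "dh x = dA x + sgn (x - 0) * (sgn (B x) * dB x)" for x
  have h: "h \<in> weighted_H1" unfolding h_def[abs_def]
    by (intro weighted_H1_add A weighted_H1_sign_at weighted_H1_abs B B0)
  have ph: "primitive h dh" unfolding h_def[abs_def] dh_def[abs_def]
    by (intro primitive_add pA primitive_sign_mult primitive_abs pB B0)
  have BF: "\<bar>B x\<bar> = 1/2 * \<bar>F x - F (- x)\<bar>" for x by (auto simp: B_def abs_if field_simps)
  have mm: "1/2 * (p + q) + 1/2 * \<bar>p - q\<bar> = max p q" "1/2 * (p + q) - 1/2 * \<bar>p - q\<bar> = min p q" for p q :: real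
    by (cases "p \<le> q"; simp add: field_simps)+
  have hpos: "h x = max (F x) (F (- x))" "h (- x) = min (F x) (F (- x))" if "x \<ge> 0" for x
  proof -
    have "h x = A x + \<bar>B x\<bar>" "h (- x) = A x - \<bar>B x\<bar>"
      using that B0 by (cases "x = 0"; simp add: h_def A_def BF abs_minus_commute)+
    then show "h x = max (F x) (F (- x))" "h (- x) = min (F x) (F (- x))"
      unfolding A_def BF by (simp_all only: mm)
  qed
  have "0 \<le> h x" for x
    using hpos[of x] hpos[of "- x"] by (cases "x \<ge> 0") (auto simp: F_def min_def max_def)
  moreover have "h (- x) \<le> h x" if "x \<ge> 0" for x using hpos[OF that] by simp
  moreover have "sym_energy \<epsilon> \<gamma> h \<le> sym_energy \<epsilon> \<gamma> f"
  proof -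
    have dble: "2 * (\<integral>x. k x \<partial>lborel) = (\<integral>x. k x + k (- x) \<partial>lborel)" if "integrable lborel k" for k :: "real \<Rightarrow> real"
      using that by (simp add: Bochner_Integration.integral_add[OF that integrable_reflect[OF that]] integral_reflect)
    note ih = sym_density_integrable[OF h weighted_H1_primitive_L2[OF h ph], of \<epsilon> \<gamma>]
    note jf = sym_density_integrable[OF f weighted_H1_primitive_L2[OF f p], of \<epsilon> \<gamma>]
    \<comment> \<open>The densities are comparable only after adding the values at x and -x: the
      reordering may exchange these two points, and the squared derivatives combine as 2 A'^2 + 2
      B'^2.\<close>
    have "(\<integral>x. sym_density \<epsilon> \<gamma> h dh x + sym_density \<epsilon> \<gamma> h dh (- x) \<partial>lborel)
      \<le> (\<integral>x. sym_density \<epsilon> \<gamma> f g x + sym_density \<epsilon> \<gamma> f g (- x) \<partial>lborel)"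
    proof (rule integral_mono)
      show "integrable lborel (\<lambda>x. sym_density \<epsilon> \<gamma> h dh x + sym_density \<epsilon> \<gamma> h dh (- x))"
        by (rule Bochner_Integration.integrable_add[OF ih integrable_reflect[OF ih]])
      show "integrable lborel (\<lambda>x. sym_density \<epsilon> \<gamma> f g x + sym_density \<epsilon> \<gamma> f g (- x))"
        by (rule Bochner_Integration.integrable_add[OF jf integrable_reflect[OF jf]])
      fix x
      have "(h x = F x \<and> h (- x) = F (- x)) \<or> (h x = F (- x) \<and> h (- x) = F x)"
        using hpos[of x] hpos[of "- x"] by (cases "x \<ge> 0") (auto simp: min_def max_def)
      then have sq: "((h x)\<^sup>2 = (f x)\<^sup>2 \<and> (h (- x))\<^sup>2 = (f (- x))\<^sup>2) \<or> ((h x)\<^sup>2 = (f (- x))\<^sup>2 \<and> (h (- x))\<^sup>2 = (f x)\<^sup>2)"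
        by (auto simp: F_def)
      have q: "k^4 = (k\<^sup>2)\<^sup>2" for k :: real by simp
      have alg: "(u + v)\<^sup>2 + (- u + v)\<^sup>2 = 2 * u\<^sup>2 + 2 * v\<^sup>2" for u v :: real
        by (simp add: power2_eq_square algebra_simps)
      have sb: "(s * b)\<^sup>2 \<le> b\<^sup>2" if "\<bar>s\<bar> \<le> 1" for s b :: real
        using that by (metis abs_mult mult_left_le_one_le abs_ge_zero abs_le_square_iff)
      have "sgn (- x - 0) * (sgn (B (- x)) * dB (- x)) = sgn (x - 0) * (sgn (B x) * dB x)"
        by (auto simp: B_def dB_def sgn_if)
      moreover have "dA (- x) = - dA x" by (simp add: dA_def field_simps)
      ultimately have "(dh x)\<^sup>2 + (dh (- x))\<^sup>2 = 2 * (dA x)\<^sup>2 + 2 * ((sgn (x - 0) * sgn (B x)) * dB x)\<^sup>2"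
        unfolding dh_def using alg[of "dA x" "sgn (x - 0) * (sgn (B x) * dB x)"] by (simp only: mult.assoc)
      also have "\<dots> \<le> 2 * (dA x)\<^sup>2 + 2 * (dB x)\<^sup>2"
        using sb[of "sgn (x - 0) * sgn (B x)" "dB x"] by (auto simp: sgn_if)
      also have "\<dots> = (dF x)\<^sup>2 + (dF (- x))\<^sup>2"
        by (simp add: dA_def dB_def power2_eq_square algebra_simps)
      also have "\<dots> \<le> (g x)\<^sup>2 + (g (- x))\<^sup>2"
        unfolding dF_def by (intro add_mono sb) (auto simp: sgn_if)
      finally have "\<epsilon>\<^sup>2 * ((dh x)\<^sup>2 + (dh (- x))\<^sup>2) \<le> \<epsilon>\<^sup>2 * ((g x)\<^sup>2 + (g (- x))\<^sup>2)"
        by (intro mult_left_mono) auto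
      then show "sym_density \<epsilon> \<gamma> h dh x + sym_density \<epsilon> \<gamma> h dh (- x)
        \<le> sym_density \<epsilon> \<gamma> f g x + sym_density \<epsilon> \<gamma> f g (- x)"
        using sq unfolding sym_density_def q by (elim disjE conjE) (simp_all add: algebra_simps)
    qed
    then show ?thesis
      unfolding sym_energy_eq[OF h ph] sym_energy_eq[OF f p] using dble[OF ih] dble[OF jf] by linarith
  qed
  ultimately show ?thesis using h by blast
qed

text \<open>The derivative bound gives equicontinuity uniformly in n. Convergence along a diagonal
  subsequence on the rationals then extends to every point, and the modulus of continuity passes to
  the limit.\<close>

lemma bounded_H1_pointwise_convergent_subseq:
  fixes f g :: "nat \<Rightarrow> real \<Rightarrow> real"
  assumes p: "\<And>n. primitive (f n) (g n)" and f2: "\<And>n. f n \<in> L2_space" and g2: "\<And>n. g n \<in> L2_space"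
    and K: "\<And>n. (\<integral>x. (g n x)\<^sup>2 \<partial>lborel) \<le> K" and M: "\<And>n x. \<bar>f n x\<bar> \<le> M"
  obtains r F where "strict_mono r" "\<And>x. (\<lambda>n. f (r n) x) \<longlonglongrightarrow> F x" "continuous_on UNIV F"
proof -
  have "0 \<le> (\<integral>x. (g 0 x)\<^sup>2 \<partial>lborel)" by simp
  then have K0: "K \<ge> 0" using K[of 0] by linarith
  have equi: "\<exists>d>0. \<forall>n x y. \<bar>x - y\<bar> < d \<longrightarrow> \<bar>f n x - f n y\<bar> < e" if e: "e > 0" for e
  proof -
    \<comment> \<open>Young's inequality \<bar>g\<bar> \<le> k + g^2/(4k) replaces Cauchy-Schwarz.
      This k makes K/(4k) at most e/4, after which \<bar>x - y\<bar> < e/(4k) controls the other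
      term.\<close>
    define k where "k = (K + 1) / e"
    have k: "k > 0" using K0 e by (simp add: k_def)
    have le: "\<bar>f n y - f n x\<bar> \<le> k * (y - x) + K / (4 * k)" if "x \<le> y" for n x y
    proof -
      have i: "integrable lborel (\<lambda>x. (g n x)\<^sup>2 / (4 * k))"
        using L2_integrable_square[OF g2] by simp
      have j: "(\<lambda>z. (g n z)\<^sup>2 / (4 * k)) integrable_on {x..y}"
        using k by (intro integral_Icc_le(1)[OF i]) auto
      have "norm (integral {x..y} (g n)) \<le> integral {x..y} (\<lambda>z. k + (g n z)\<^sup>2 / (4 * k))"
      proof (rule integral_norm_bound_integral)
        show "g n integrable_on {x..y}" by (rule primitive_integrable_on[OF p])
        show "(\<lambda>z. k + (g n z)\<^sup>2 / (4 * k)) integrable_on {x..y}"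
          by (rule integrable_add[OF integrable_const_ivl j])
        fix z
        have "0 \<le> (2 * k - \<bar>g n z\<bar>)\<^sup>2 / (4 * k)" using k by simp
        also have "\<dots> = k + (g n z)\<^sup>2 / (4 * k) - \<bar>g n z\<bar>"
          using k by (simp add: power2_diff field_simps power2_eq_square)
        finally show "norm (g n z) \<le> k + (g n z)\<^sup>2 / (4 * k)" by simp
      qed
      also have "\<dots> = k * (y - x) + integral {x..y} (\<lambda>z. (g n z)\<^sup>2 / (4 * k))"
        using Henstock_Kurzweil_Integration.integral_add[OF integrable_const_ivl j, of k] that by simp
      also have "integral {x..y} (\<lambda>z. (g n z)\<^sup>2 / (4 * k)) \<le> (\<integral>z. (g n z)\<^sup>2 / (4 * k) \<partial>lborel)"
        using k by (intro integral_Icc_le(2)[OF i]) auto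
      also have "\<dots> \<le> K / (4 * k)"
        using K[of n] k by (simp add: divide_right_mono)
      finally show ?thesis using primitive_integral[OF p that] by simp
    qed
    have "K / (4 * k) \<le> e / 4"
      using K0 e unfolding k_def by (simp add: field_simps)
    then have "\<bar>f n x - f n y\<bar> < e" if "\<bar>x - y\<bar> < e / (4 * k)" for n x y
    proof -
      have "\<bar>f n x - f n y\<bar> \<le> k * \<bar>x - y\<bar> + K / (4 * k)"
        using le[of x y n] le[of y x n] by (cases "x \<le> y") auto
      moreover have "k * \<bar>x - y\<bar> < k * (e / (4 * k))"
        using that k by (intro mult_strict_left_mono) auto
      moreover have "k * (e / (4 * k)) = e / 4" using k by simp
      ultimately show ?thesis using \<open>K / (4 * k) \<le> e / 4\<close> e by linarith
    qed
    then show ?thesis using e k by (intro exI[of _ "e / (4 * k)"]) auto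
  qed
  obtain r :: "nat \<Rightarrow> nat" where r: "strict_mono r" "\<And>x. x \<in> \<rat> \<Longrightarrow> \<exists>l. (\<lambda>n. f (r n) x) \<longlonglongrightarrow> l"
    using function_convergent_subsequence[of "\<rat>" f M] M countable_rat by auto
  have "Cauchy (\<lambda>n. f (r n) x)" for x
  proof (rule metric_CauchyI)
    fix e :: real assume "e > 0"
    then obtain d where d: "d > 0" "\<And>n x y. \<bar>x - y\<bar> < d \<Longrightarrow> \<bar>f n x - f n y\<bar> < e / 3"
      using equi[of "e / 3"] by auto
    obtain q where q: "q \<in> \<rat>" "x < q" "q < x + d"
      using Rats_dense_in_real[of x "x + d"] d(1) by auto
    have "Cauchy (\<lambda>n. f (r n) q)"
      using r(2)[OF q(1)] LIMSEQ_imp_Cauchy by blast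
    then obtain N where N: "\<And>m n. m \<ge> N \<Longrightarrow> n \<ge> N \<Longrightarrow> dist (f (r m) q) (f (r n) q) < e / 3"
      using \<open>e > 0\<close> unfolding Cauchy_def by (meson divide_pos_pos zero_less_numeral)
    show "\<exists>N. \<forall>m\<ge>N. \<forall>n\<ge>N. dist (f (r m) x) (f (r n) x) < e"
    proof (intro exI allI impI)
      fix m n assume mn: "N \<le> m" "N \<le> n"
      have "\<bar>x - q\<bar> < d" using q by simp
      from d(2)[OF this, of "r m"] d(2)[OF this, of "r n"] N[OF mn]
      show "dist (f (r m) x) (f (r n) x) < e"
        unfolding dist_real_def by linarith
    qed
  qed
  then have "\<forall>x. \<exists>l. (\<lambda>n. f (r n) x) \<longlonglongrightarrow> l"
    by (simp add: Cauchy_convergent_iff convergent_def)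
  then obtain F where F: "\<And>x. (\<lambda>n. f (r n) x) \<longlonglongrightarrow> F x" by metis
  have "continuous_on UNIV F"
    unfolding continuous_on_iff
  proof (intro ballI allI impI)
    fix x e :: real assume "e > 0"
    then obtain d where d: "d > 0" "\<And>n x y. \<bar>x - y\<bar> < d \<Longrightarrow> \<bar>f n x - f n y\<bar> < e / 2"
      using equi[of "e / 2"] by auto
    have "dist (F y) (F x) < e" if "dist y x < d" for y
    proof -
      have "(\<lambda>n. \<bar>f (r n) y - f (r n) x\<bar>) \<longlonglongrightarrow> \<bar>F y - F x\<bar>"
        by (intro tendsto_intros F)
      then have "\<bar>F y - F x\<bar> \<le> e / 2"
        using d(2)[of y x] that by (intro LIMSEQ_le_const2) (auto simp: dist_real_def intro!: exI[of _ 0] less_imp_le)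
      then show ?thesis using \<open>e > 0\<close> by (simp add: dist_real_def)
    qed
    then show "\<exists>d>0. \<forall>x'\<in>UNIV. dist x' x < d \<longrightarrow> dist (F x') (F x) < e"
      using d(1) by auto
  qed
  then show thesis using that r(1) F by blast
qed

section \<open>Existence of symmetric minimizers\<close>

lemma integral_eq_integral_Icc:
  fixes h :: "real \<Rightarrow> real"
  assumes "integrable lborel h" "\<And>x. x \<notin> {l..r} \<Longrightarrow> h x = 0"
  shows "(\<integral>x. h x \<partial>lborel) = integral {l..r} h"
proof -
  have e: "(\<lambda>x. indicator {l..r} x *\<^sub>R h x) = h"
  proof
    fix x show "indicator {l..r} x *\<^sub>R h x = h x"
      using assms(2)[of x] by (cases "x \<in> {l..r}") auto
  qed
  have "set_integrable lborel {l..r} h" using assms(1) by (simp only: set_integrable_def e)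
  from set_borel_integral_eq_integral(2)[OF this] show ?thesis
    by (simp only: set_lebesgue_integral_def e)
qed

text \<open>The first variation argument: along a line the energy is a quartic polynomial with a
  minimum at t = 0.\<close>

lemma quartic_nonneg_imp_linear_zero:
  fixes A B C D :: real
  assumes "\<And>t. 0 \<le> t * A + t\<^sup>2 * B + t^3 * C + t^4 * D"
  shows "A = 0"
proof (rule DERIV_local_min)
  show "((\<lambda>t. t * A + t\<^sup>2 * B + t^3 * C + t^4 * D) has_real_derivative A) (at 0)"
    by (auto intro!: derivative_eq_intros)
  show "(0::real) < 1" by simp
  show "\<forall>y. \<bar>0 - y\<bar> < 1 \<longrightarrow> 0 * A + 0\<^sup>2 * B + 0 ^ 3 * C + 0 ^ 4 * D \<le> y * A + y\<^sup>2 * B + y ^ 3 * C + y ^ 4 * D"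
    using assms by simp
qed

lemma continuous_antiderivative:
  fixes h :: "real \<Rightarrow> real"
  assumes "continuous_on UNIV h"
  obtains H where "\<And>x. (H has_real_derivative h x) (at x)"
proof -
  have "\<exists>F. \<forall>x :: real. -\<infinity> < ereal x \<longrightarrow> ereal x < \<infinity> \<longrightarrow> (F has_vector_derivative h x) (at x)"
    by (rule einterval_antiderivative) (use assms in \<open>auto simp: continuous_on_eq_continuous_at\<close>)
  then show thesis using that by (auto simp: has_real_derivative_iff_has_vector_derivative)
qed

lemma quartic_expansion:
  fixes y u v p q t \<gamma> :: real
  shows "(y * (u + t * p)\<^sup>2 + 1/2 * (u + t * p)^4 + \<gamma>/2 * (u + t * p)\<^sup>2 * (v + t * q)\<^sup>2)
      - (y * u\<^sup>2 + 1/2 * u^4 + \<gamma>/2 * u\<^sup>2 * v\<^sup>2)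
    = t * (2 * y * u * p + 2 * u^3 * p + \<gamma> * (u * p * v\<^sup>2 + u\<^sup>2 * v * q))
      + t\<^sup>2 * (y * p\<^sup>2 + 3 * u\<^sup>2 * p\<^sup>2 + \<gamma>/2 * (p\<^sup>2 * v\<^sup>2 + 4 * u * v * p * q + u\<^sup>2 * q\<^sup>2))
      + t^3 * (2 * u * p^3 + \<gamma> * (u * p * q\<^sup>2 + v * p\<^sup>2 * q))
      + t^4 * (1/2 * p^4 + \<gamma>/2 * p\<^sup>2 * q\<^sup>2)"
  by (simp add: field_simps power2_eq_square power3_eq_cube power4_eq_xxxx)

lemma potential_bound:
  fixes u v x :: real
  assumes "\<bar>x\<bar> \<le> R" "\<bar>u\<bar> \<le> K" "\<bar>v\<bar> \<le> K"
  shows "\<bar>(x\<^sup>2 - 1) * u\<^sup>2 + 1/2 * u^4 + \<gamma>/2 * u\<^sup>2 * v\<^sup>2\<bar> \<le> (R\<^sup>2 + 1) * K\<^sup>2 + 1/2 * K^4 + \<bar>\<gamma>/2\<bar> * K\<^sup>2 * K\<^sup>2"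
proof -
  have x2: "\<bar>x\<^sup>2 - 1\<bar> \<le> R\<^sup>2 + 1"
  proof -
    have "\<bar>x\<bar>\<^sup>2 \<le> R\<^sup>2" using assms(1) by (intro power_mono) auto
    then show ?thesis using zero_le_power2[of x] by (simp add: abs_le_iff)
  qed
  have e: "\<bar>u\<bar>\<^sup>2 \<le> K\<^sup>2" "\<bar>v\<bar>\<^sup>2 \<le> K\<^sup>2" "\<bar>u\<bar>^4 \<le> K^4"
    by (intro power_mono abs_ge_zero assms)+
  have "\<bar>(x\<^sup>2 - 1) * u\<^sup>2 + 1/2 * u^4 + \<gamma>/2 * u\<^sup>2 * v\<^sup>2\<bar>
      \<le> \<bar>(x\<^sup>2 - 1) * u\<^sup>2\<bar> + \<bar>1/2 * u^4\<bar> + \<bar>\<gamma>/2 * u\<^sup>2 * v\<^sup>2\<bar>"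
    by linarith
  also have "\<dots> = \<bar>x\<^sup>2 - 1\<bar> * \<bar>u\<bar>\<^sup>2 + 1/2 * \<bar>u\<bar>^4 + \<bar>\<gamma>/2\<bar> * \<bar>u\<bar>\<^sup>2 * \<bar>v\<bar>\<^sup>2"
    by (simp add: abs_mult)
  also have "\<dots> \<le> (R\<^sup>2 + 1) * K\<^sup>2 + 1/2 * K^4 + \<bar>\<gamma>/2\<bar> * K\<^sup>2 * K\<^sup>2"
    by (intro add_mono mult_mono x2 e mult_left_mono) auto
  finally show ?thesis .
qed

section \<open>The Euler-Lagrange equation in weak form\<close>

text \<open>Inserting the symmetry \<psi>2(x) = f(-x) turns the first Euler-Lagrange equation for
  \<psi>1 = f into \<epsilon>^2 f'' = \<open>reaction \<gamma> f\<close>, an equation for one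
  function with a nonlocal term.\<close>

definition reaction :: "real \<Rightarrow> (real \<Rightarrow> real) \<Rightarrow> real \<Rightarrow> real" where
  "reaction \<gamma> f x = (x\<^sup>2 - 1) * f x + (f x)^3 + \<gamma> * f x * (f (- x))\<^sup>2"

lemma reaction_continuous:
  "continuous_on UNIV f \<Longrightarrow> continuous_on UNIV (reaction \<gamma> f)"
  unfolding reaction_def[abs_def]
  by (intro continuous_intros continuous_on_compose2[of UNIV f UNIV uminus]) auto

text \<open>Testing with tents instead of smooth functions turns the derivative term into a second
  difference of \<open>f\<close>, so that pointwise convergence of the sequence suffices.\<close>

lemma minimizing_sequence_euler_lagrange:
  fixes f g :: "nat \<Rightarrow> real \<Rightarrow> real"
  assumes f: "\<And>n. f n \<in> weighted_H1" and p: "\<And>n. primitive (f n) (g n)"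
    and M: "\<And>n x. \<bar>f n x\<bar> \<le> M" and lim: "\<And>x. (\<lambda>n. f n x) \<longlonglongrightarrow> F x"
    and F: "continuous_on UNIV F"
    and m: "(\<lambda>n. sym_energy \<epsilon> \<gamma> (f n)) \<longlonglongrightarrow> m"
    and min: "\<And>h. h \<in> weighted_H1 \<Longrightarrow> m \<le> sym_energy \<epsilon> \<gamma> h"
    and abc: "a < b" "b < c"
  shows "\<epsilon>\<^sup>2 * ((c - a) * F b - (c - b) * F a - (b - a) * F c)
    + (\<integral>x. reaction \<gamma> F x * tent a b c x \<partial>lborel) = 0"
proof -
  define T dT where "T = tent a b c" and "dT = tent_deriv a b c"
  note T = tent_weighted_H1[OF abc, folded T_def] and pT = primitive_tent[of a b c, folded T_def dT_def]
  note TL = weighted_H1_primitive_L2[OF T pT]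
  define R where "R = max \<bar>a\<bar> \<bar>c\<bar>"
  have out: "T x = 0" "T (- x) = 0" "dT x = 0" if "x \<notin> {-R..R}" for x
  proof -
    have "x \<notin> {a..c}" "- x \<notin> {a..c}" using that unfolding R_def by auto
    then show "T x = 0" "T (- x) = 0" "dT x = 0"
      unfolding T_def dT_def using tent_outside[OF abc] by blast+
  qed
  define S where "S = (c - a)\<^sup>2"
  have TS: "\<bar>T x\<bar> \<le> S" for x unfolding T_def S_def by (rule tent_bounds(1)[OF abc])
  have [measurable]: "T \<in> borel_measurable borel" "dT \<in> borel_measurable borel"
    "f n \<in> borel_measurable borel" "g n \<in> borel_measurable borel" "F \<in> borel_measurable borel" for n
    using primitive_borel[OF pT] primitive_measurable[OF pT] primitive_borel[OF p] primitive_measurable[OF p]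
      borel_measurable_continuous_onI[OF F] by auto
  have FM: "\<bar>F x\<bar> \<le> M" for x
    by (rule LIMSEQ_le_const2[OF tendsto_rabs[OF lim]]) (use M in auto)
  have cT: "continuous_on UNIV T" by (rule primitive_continuous[OF pT])
  define \<rho> where "\<rho> x u v = (x\<^sup>2 - 1) * u\<^sup>2 + 1/2 * u^4 + \<gamma>/2 * u\<^sup>2 * v\<^sup>2" for x u v :: real
  define D where "D t h x = \<rho> x (h x + t * T x) (h (- x) + t * T (- x)) - \<rho> x (h x) (h (- x))" for t h x
  have \<rho>_meas[measurable]: "(\<lambda>x. \<rho> x (h x) (k x)) \<in> borel_measurable borel"
    if [measurable]: "h \<in> borel_measurable borel" "k \<in> borel_measurable borel" for h k
    unfolding \<rho>_def by measurable
  have D_meas[measurable]: "D t h \<in> borel_measurable borel" if [measurable]: "h \<in> borel_measurable borel" for t h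
    unfolding D_def[abs_def] by measurable
  have D_out: "D t h x = 0" if "x \<notin> {-R..R}" for t h x
    unfolding D_def using out[OF that] by simp
  define \<kappa> where "\<kappa> t = 2 * ((R\<^sup>2 + 1) * (M + \<bar>t\<bar> * S)\<^sup>2 + 1/2 * (M + \<bar>t\<bar> * S)^4 + \<bar>\<gamma>/2\<bar> * (M + \<bar>t\<bar> * S)\<^sup>2 * (M + \<bar>t\<bar> * S)\<^sup>2)" for t
  have D_bound: "\<bar>D t h x\<bar> \<le> \<kappa> t * indicator {-R..R} x" if h: "\<And>x. \<bar>h x\<bar> \<le> M" for t h x
  proof (cases "x \<in> {-R..R}")
    case True
    define K where "K = M + \<bar>t\<bar> * S"
    have K: "M \<le> K" using TS[of 0] unfolding K_def by simp
    have b: "\<bar>\<rho> x u v\<bar> \<le> (R\<^sup>2 + 1) * K\<^sup>2 + 1/2 * K^4 + \<bar>\<gamma>/2\<bar> * K\<^sup>2 * K\<^sup>2" if "\<bar>u\<bar> \<le> K" "\<bar>v\<bar> \<le> K" for u v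
      unfolding \<rho>_def by (rule potential_bound) (use True that in auto)
    have tT: "\<bar>t * T y\<bar> \<le> \<bar>t\<bar> * S" for y
      unfolding abs_mult by (intro mult_left_mono TS) auto
    have kt: "\<bar>h y + t * T y\<bar> \<le> K" for y
      using h[of y] tT[of y] unfolding K_def by linarith
    have k: "\<bar>h y\<bar> \<le> K" for y using h[of y] K by linarith
    have "\<bar>D t h x\<bar> \<le> 2 * ((R\<^sup>2 + 1) * K\<^sup>2 + 1/2 * K^4 + \<bar>\<gamma>/2\<bar> * K\<^sup>2 * K\<^sup>2)"
      unfolding D_def mult_2
      by (rule order_trans[OF abs_triangle_ineq4 add_mono[OF b[OF kt[of x] kt[of "- x"]] b[OF k[of x] k[of "- x"]]]])
    then show ?thesis using True by (simp add: \<kappa>_def K_def)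
  qed (simp add: D_out)
  have i\<kappa>: "integrable lborel (\<lambda>x. \<kappa> t * indicator {-R..R} x)" for t
    by (intro integrable_mult_right integrable_real_indicator) (auto simp: emeasure_lborel_Icc_eq)
  have D_int: "integrable lborel (D t h)" if [measurable]: "h \<in> borel_measurable borel" and "\<And>x. \<bar>h x\<bar> \<le> M" for t h
  proof (rule Bochner_Integration.integrable_bound[OF i\<kappa>[of t]])
    show "AE x in lborel. norm (D t h x) \<le> norm (\<kappa> t * indicator {-R..R} x)"
    proof (rule AE_I2)
      fix x
      have "\<bar>D t h x\<bar> \<le> \<kappa> t * indicator {-R..R} x" by (rule D_bound) (rule that)
      then show "norm (D t h x) \<le> norm (\<kappa> t * indicator {-R..R} x)" by simp
    qed
  qed simp
  have gT: "(\<integral>x. g n x * dT x \<partial>lborel) = (c - a) * f n b - (c - b) * f n a - (b - a) * f n c" for n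
  proof -
    have "(\<integral>x. g n x * dT x \<partial>lborel) = integral {-R..R} (\<lambda>x. g n x * dT x)"
      by (rule integral_eq_integral_Icc[OF L2_integrable_mult[OF weighted_H1_primitive_L2[OF f p] TL]]) (simp add: out(3))
    also have "\<dots> = (c - a) * f n b - (c - b) * f n a - (b - a) * f n c"
      unfolding dT_def by (rule integral_unique[OF tent_deriv_has_integral[OF p abc]]) (auto simp: R_def)
    finally show ?thesis .
  qed
  define E2 where "E2 = (\<integral>x. (dT x)\<^sup>2 \<partial>lborel)"
  define V where "V = (c - a) * F b - (c - b) * F a - (b - a) * F c"
  \<comment> \<open>The energies of the competitors f_n + tT are at least m, while those of f_n tend
    to m. In the difference the square of g_n cancels, so all remaining terms converge under
    pointwise convergence of f_n.\<close>
  have step: "0 \<le> 2 * t * \<epsilon>\<^sup>2 * V + t\<^sup>2 * \<epsilon>\<^sup>2 * E2 + (\<integral>x. D t F x \<partial>lborel)" for t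
  proof -
    have "sym_energy \<epsilon> \<gamma> (\<lambda>x. f n x + t * T x) - sym_energy \<epsilon> \<gamma> (f n) =
      2 * t * \<epsilon>\<^sup>2 * ((c - a) * f n b - (c - b) * f n a - (b - a) * f n c) + t\<^sup>2 * \<epsilon>\<^sup>2 * E2 + (\<integral>x. D t (f n) x \<partial>lborel)" for n
    proof -
      have ft: "(\<lambda>x. f n x + t * T x) \<in> weighted_H1"
        by (intro weighted_H1_add weighted_H1_cmult f T)
      have pt: "primitive (\<lambda>x. f n x + t * T x) (\<lambda>x. g n x + t * dT x)"
        by (intro primitive_add primitive_cmult p pT)
      have "sym_energy \<epsilon> \<gamma> (\<lambda>x. f n x + t * T x) - sym_energy \<epsilon> \<gamma> (f n) =
        (\<integral>x. sym_density \<epsilon> \<gamma> (\<lambda>x. f n x + t * T x) (\<lambda>x. g n x + t * dT x) x - sym_density \<epsilon> \<gamma> (f n) (g n) x \<partial>lborel)"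
        unfolding sym_energy_eq[OF ft pt] sym_energy_eq[OF f p]
        by (rule Bochner_Integration.integral_diff[symmetric])
          (rule sym_density_integrable weighted_H1_primitive_L2 ft pt f p)+
      also have "\<dots> = (\<integral>x. 2 * t * \<epsilon>\<^sup>2 * (g n x * dT x) + t\<^sup>2 * \<epsilon>\<^sup>2 * (dT x)\<^sup>2 + D t (f n) x \<partial>lborel)"
        by (rule Bochner_Integration.integral_cong)
          (simp_all add: sym_density_def D_def \<rho>_def power2_sum power_mult_distrib algebra_simps)
      also have "\<dots> = 2 * t * \<epsilon>\<^sup>2 * (\<integral>x. g n x * dT x \<partial>lborel) + t\<^sup>2 * \<epsilon>\<^sup>2 * E2 + (\<integral>x. D t (f n) x \<partial>lborel)"
        using L2_integrable_mult[OF weighted_H1_primitive_L2[OF f[of n] p] TL] L2_integrable_square[OF TL] D_int[of "f n" t] M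
        by (simp add: E2_def)
      finally show ?thesis unfolding gT .
    qed
    moreover have "m \<le> sym_energy \<epsilon> \<gamma> (\<lambda>x. f n x + t * T x)" for n
      by (intro min weighted_H1_add weighted_H1_cmult f T)
    ultimately have le: "m - sym_energy \<epsilon> \<gamma> (f n) \<le>
      2 * t * \<epsilon>\<^sup>2 * ((c - a) * f n b - (c - b) * f n a - (b - a) * f n c) + t\<^sup>2 * \<epsilon>\<^sup>2 * E2 + (\<integral>x. D t (f n) x \<partial>lborel)" for n
      by (metis diff_right_mono)
    have "(\<lambda>n. \<integral>x. D t (f n) x \<partial>lborel) \<longlonglongrightarrow> (\<integral>x. D t F x \<partial>lborel)"
    proof (rule integral_dominated_convergence[OF _ _ i\<kappa>[of t]])
      show "AE x in lborel. (\<lambda>n. D t (f n) x) \<longlonglongrightarrow> D t F x"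
        unfolding D_def \<rho>_def by (intro AE_I2 tendsto_intros lim)
    qed (use D_bound M in auto)
    then have l1: "(\<lambda>n. 2 * t * \<epsilon>\<^sup>2 * ((c - a) * f n b - (c - b) * f n a - (b - a) * f n c) + t\<^sup>2 * \<epsilon>\<^sup>2 * E2 + (\<integral>x. D t (f n) x \<partial>lborel))
      \<longlonglongrightarrow> 2 * t * \<epsilon>\<^sup>2 * V + t\<^sup>2 * \<epsilon>\<^sup>2 * E2 + (\<integral>x. D t F x \<partial>lborel)"
      unfolding V_def by (intro tendsto_intros lim)
    have l2: "(\<lambda>n. m - sym_energy \<epsilon> \<gamma> (f n)) \<longlonglongrightarrow> m - m"
      by (intro tendsto_intros m)
    have "m - m \<le> 2 * t * \<epsilon>\<^sup>2 * V + t\<^sup>2 * \<epsilon>\<^sup>2 * E2 + (\<integral>x. D t F x \<partial>lborel)"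
      by (rule LIMSEQ_le[OF l2 l1]) (use le in blast)
    then show ?thesis by simp
  qed
  define q1 q2 q3 q4 where
    "q1 x = 2 * (x\<^sup>2 - 1) * F x * T x + 2 * (F x)^3 * T x + \<gamma> * (F x * T x * (F (- x))\<^sup>2 + (F x)\<^sup>2 * F (- x) * T (- x))" and
    "q2 x = (x\<^sup>2 - 1) * (T x)\<^sup>2 + 3 * (F x)\<^sup>2 * (T x)\<^sup>2 + \<gamma>/2 * ((T x)\<^sup>2 * (F (- x))\<^sup>2 + 4 * F x * F (- x) * T x * T (- x) + (F x)\<^sup>2 * (T (- x))\<^sup>2)" and
    "q3 x = 2 * F x * (T x)^3 + \<gamma> * (F x * T x * (T (- x))\<^sup>2 + F (- x) * (T x)\<^sup>2 * T (- x))" and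
    "q4 x = 1/2 * (T x)^4 + \<gamma>/2 * (T x)\<^sup>2 * (T (- x))\<^sup>2" for x
  have cr: "continuous_on UNIV (\<lambda>x. F (- x))" "continuous_on UNIV (\<lambda>x. T (- x))"
    by (rule continuous_on_compose2[OF F] continuous_on_compose2[OF cT]; auto intro: continuous_intros)+
  have iq: "integrable lborel q1" "integrable lborel q2" "integrable lborel q3" "integrable lborel q4"
    by (rule integrable_continuous_support[of _ "-R" R];
        (unfold q1_def[abs_def] q2_def[abs_def] q3_def[abs_def] q4_def[abs_def], intro continuous_intros F cT cr)?;
        simp add: out q1_def q2_def q3_def q4_def)+
  have "D t F x = t * q1 x + t\<^sup>2 * q2 x + t^3 * q3 x + t^4 * q4 x" for t x
    unfolding D_def \<rho>_def q1_def q2_def q3_def q4_def by (rule quartic_expansion)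
  then have DF: "(\<integral>x. D t F x \<partial>lborel) = t * (\<integral>x. q1 x \<partial>lborel) + t\<^sup>2 * (\<integral>x. q2 x \<partial>lborel)
      + t^3 * (\<integral>x. q3 x \<partial>lborel) + t^4 * (\<integral>x. q4 x \<partial>lborel)" for t
    using iq by simp
  have "2 * \<epsilon>\<^sup>2 * V + (\<integral>x. q1 x \<partial>lborel) = 0"
  proof (rule quartic_nonneg_imp_linear_zero)
    fix t
    show "0 \<le> t * (2 * \<epsilon>\<^sup>2 * V + (\<integral>x. q1 x \<partial>lborel)) + t\<^sup>2 * (\<epsilon>\<^sup>2 * E2 + (\<integral>x. q2 x \<partial>lborel))
       + t^3 * (\<integral>x. q3 x \<partial>lborel) + t^4 * (\<integral>x. q4 x \<partial>lborel)"
      using step[of t] unfolding DF by (simp add: algebra_simps)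
  qed
  moreover have "(\<integral>x. q1 x \<partial>lborel) = 2 * (\<integral>x. reaction \<gamma> F x * T x \<partial>lborel)"
  proof -
    \<comment> \<open>The part of \<open>q1\<close> that contains T(-x) is s(-x). After integration
      it equals the integral of s, so the two halves of the nonlocal term merge into the one in
      \<open>reaction\<close>.\<close>
    define s where "s x = \<gamma> * (F x * T x * (F (- x))\<^sup>2)" for x
    have ints: "integrable lborel s"
      by (rule integrable_continuous_support[of _ "-R" R])
        (unfold s_def[abs_def], intro continuous_intros F cT cr, simp add: out s_def)
    have ir: "integrable lborel (\<lambda>x. reaction \<gamma> F x * T x)"
      by (rule integrable_continuous_support[of _ "-R" R])
        (intro continuous_intros reaction_continuous F cT, simp add: out)
    have "(\<integral>x. q1 x \<partial>lborel) = (\<integral>x. 2 * (reaction \<gamma> F x * T x) + (s (- x) - s x) \<partial>lborel)"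
      by (rule Bochner_Integration.integral_cong)
        (simp_all add: q1_def reaction_def s_def algebra_simps power2_eq_square power3_eq_cube)
    also have "\<dots> = 2 * (\<integral>x. reaction \<gamma> F x * T x \<partial>lborel) + ((\<integral>x. s (- x) \<partial>lborel) - (\<integral>x. s x \<partial>lborel))"
      using ir ints integrable_reflect[OF ints] by simp
    finally show ?thesis unfolding integral_reflect by simp
  qed
  ultimately show ?thesis unfolding V_def T_def by simp
qed

lemma three_point_affine:
  fixes D :: "real \<Rightarrow> real"
  assumes "\<And>a b c. a < b \<Longrightarrow> b < c \<Longrightarrow> (c - a) * D b = (c - b) * D a + (b - a) * D c"
  shows "D x = D 0 + x * (D 1 - D 0)"
proof -
  consider "x < 0" | "x = 0" | "0 < x" "x < 1" | "x = 1" | "1 < x" by linarith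
  then show ?thesis
  proof cases
    case 1 then show ?thesis using assms[of x 0 1] by (simp add: algebra_simps)
  next
    case 3 then show ?thesis using assms[of 0 x 1] by (simp add: algebra_simps)
  next
    case 5 then show ?thesis using assms[of 0 1 x] by (simp add: algebra_simps)
  qed auto
qed

text \<open>Let P0 be a second antiderivative of N. Integrating by parts twice against tents shows
  that all second differences of \<epsilon>^2 F - P0 vanish, so this function is affine and F
  inherits two derivatives from P0.\<close>

lemma tent_weak_solution_regular:
  assumes \<epsilon>: "\<epsilon> \<noteq> 0" and N: "continuous_on UNIV N"
    and weak: "\<And>a b c. a < b \<Longrightarrow> b < c \<Longrightarrow> \<epsilon>\<^sup>2 * ((c - a) * F b - (c - b) * F a - (b - a) * F c)
      + (\<integral>x. N x * tent a b c x \<partial>lborel) = 0"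
  obtains F1 where "\<And>x. (F has_real_derivative F1 x) (at x)"
    "\<And>x. (F1 has_real_derivative N x / \<epsilon>\<^sup>2) (at x)"
proof -
  obtain P1 where P1: "\<And>x. (P1 has_real_derivative N x) (at x)"
    using continuous_antiderivative[OF N] by blast
  have cP1: "continuous_on UNIV P1"
    using P1 by (meson DERIV_continuous continuous_at_imp_continuous_on)
  obtain P0 where P0: "\<And>x. (P0 has_real_derivative P1 x) (at x)"
    using continuous_antiderivative[OF cP1] by blast
  have p1: "primitive P1 N" by (rule primitive_C1[OF P1 N])
  have p0: "primitive P0 P1" by (rule primitive_C1[OF P0 cP1])
  define D where "D x = \<epsilon>\<^sup>2 * F x - P0 x" for x
  have "(c - a) * D b = (c - b) * D a + (b - a) * D c" if abc: "a < b" "b < c" for a b c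
  proof -
    have cN: "continuous_on UNIV (\<lambda>x. N x * tent a b c x)"
      by (intro continuous_intros N primitive_continuous[OF primitive_tent])
    have "(\<integral>x. N x * tent a b c x \<partial>lborel) = integral {a..c} (\<lambda>x. N x * tent a b c x)"
      by (rule integral_eq_integral_Icc[OF integrable_continuous_support[OF cN, where a = a and b = c]])
        (simp_all add: tent_outside[OF abc])
    moreover have "((\<lambda>x. P1 x * tent_deriv a b c x + N x * tent a b c x) has_integral
        (P1 c * tent a b c c - P1 a * tent a b c a)) {a..c}"
      using abc by (intro primitive_has_integral primitive_mult[OF p1 primitive_tent]) auto
    then have "((\<lambda>x. (P1 x * tent_deriv a b c x + N x * tent a b c x) - P1 x * tent_deriv a b c x) has_integral
        ((P1 c * tent a b c c - P1 a * tent a b c a) - ((c - a) * P0 b - (c - b) * P0 a - (b - a) * P0 c))) {a..c}"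
      by (rule has_integral_diff) (use abc in \<open>auto intro: tent_deriv_has_integral[OF p0]\<close>)
    moreover have "tent a b c c = 0" "tent a b c a = 0"
      using abc by (auto simp: tent_def abs_if field_simps)
    ultimately have "(\<integral>x. N x * tent a b c x \<partial>lborel) = - ((c - a) * P0 b - (c - b) * P0 a - (b - a) * P0 c)"
      by (simp add: integral_unique)
    then show ?thesis
      using weak[OF abc] unfolding D_def by (simp add: algebra_simps)
  qed
  then have aff: "D x = D 0 + x * (D 1 - D 0)" for x
    by (rule three_point_affine)
  define F1 where "F1 x = (P1 x + (D 1 - D 0)) / \<epsilon>\<^sup>2" for x
  have F_eq: "F = (\<lambda>x. (P0 x + (D 0 + x * (D 1 - D 0))) / \<epsilon>\<^sup>2)"
  proof
    fix x show "F x = (P0 x + (D 0 + x * (D 1 - D 0))) / \<epsilon>\<^sup>2"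
      using aff[of x] \<epsilon> unfolding D_def[of x] by (simp add: field_simps)
  qed
  show thesis
  proof
    show "(F has_real_derivative F1 x) (at x)" for x
      unfolding F_eq F1_def by (rule DERIV_cdivide) (auto intro!: derivative_eq_intros P0)
    show "(F1 has_real_derivative N x / \<epsilon>\<^sup>2) (at x)" for x
      unfolding F1_def[abs_def] by (rule DERIV_cdivide) (auto intro!: derivative_eq_intros P1)
  qed
qed

section \<open>Lower semicontinuity and the direct method\<close>

lemma integrable_of_bounded_Icc:
  fixes k :: "real \<Rightarrow> real"
  assumes c: "continuous_on UNIV k" and k0: "\<And>x. 0 \<le> k x"
    and C: "\<And>n. (LINT x:{-real (Suc n)..real (Suc n)}|lborel. k x) \<le> C"
  shows "integrable lborel k"
proof -
  define h where "h n x = indicator {-real (Suc n)..real (Suc n)} x *\<^sub>R k x" for n x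
  have i: "integrable lborel (h n)" for n
    using borel_integrable_atLeastAtMost'[OF continuous_on_subset[OF c], of "-real (Suc n)" "real (Suc n)"]
    by (simp add: set_integrable_def h_def[abs_def])
  have mono: "h m x \<le> h n x" if "m \<le> n" for m n x
    using that k0[of x] by (auto simp: h_def indicator_def)
  have "incseq (\<lambda>n. integral\<^sup>L lborel (h n))"
    by (intro incseq_SucI integral_mono i mono) auto
  moreover have "integral\<^sup>L lborel (h n) \<le> C" for n
    using C[of n] by (simp add: set_lebesgue_integral_def h_def[abs_def])
  ultimately obtain L where L: "(\<lambda>n. integral\<^sup>L lborel (h n)) \<longlonglongrightarrow> L"
    using incseq_convergent by blast
  show ?thesis
  proof (rule integrable_monotone_convergence[OF i _ _ L])
    show "AE x in lborel. mono (\<lambda>n. h n x)" by (auto simp: mono_def mono)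
    show "AE x in lborel. (\<lambda>i. h i x) \<longlonglongrightarrow> k x"
    proof (rule AE_I2)
      fix x
      obtain N where "\<bar>x\<bar> \<le> real N" using real_arch_simple by blast
      then have "\<forall>\<^sub>F n in sequentially. h n x = k x"
        by (intro eventually_sequentiallyI[of N]) (auto simp: h_def indicator_def)
      then show "(\<lambda>i. h i x) \<longlonglongrightarrow> k x" by (rule tendsto_eventually)
    qed
    show "k \<in> borel_measurable lborel" using c borel_measurable_continuous_onI by auto
  qed
qed

lemma set_integral_Icc_tendsto:
  fixes k :: "real \<Rightarrow> real"
  assumes "integrable lborel k"
  shows "(\<lambda>n. LINT x:{-real (Suc n)..real (Suc n)}|lborel. k x) \<longlonglongrightarrow> (\<integral>x. k x \<partial>lborel)"
  unfolding set_lebesgue_integral_def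
proof (rule integral_dominated_convergence[where w = "\<lambda>x. \<bar>k x\<bar>"])
  note [measurable] = borel_measurable_integrable[OF assms]
  show "AE x in lborel. (\<lambda>n. indicator {-real (Suc n)..real (Suc n)} x *\<^sub>R k x) \<longlonglongrightarrow> k x"
  proof (rule AE_I2)
    fix x
    obtain N where "\<bar>x\<bar> \<le> real N" using real_arch_simple by blast
    then have "\<forall>\<^sub>F n in sequentially. indicator {-real (Suc n)..real (Suc n)} x *\<^sub>R k x = k x"
      by (intro eventually_sequentiallyI[of N]) (auto simp: indicator_def)
    then show "(\<lambda>n. indicator {-real (Suc n)..real (Suc n)} x *\<^sub>R k x) \<longlonglongrightarrow> k x" by (rule tendsto_eventually)
  qed
  show "integrable lborel (\<lambda>x. \<bar>k x\<bar>)" using assms by simp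
  show "k \<in> borel_measurable lborel" by simp
  show "(\<lambda>x. indicator {- real (Suc n)..real (Suc n)} x *\<^sub>R k x) \<in> borel_measurable lborel" for n by simp
qed (auto simp: indicator_def)

lemma set_integral_continuous_Icc:
  fixes k :: "real \<Rightarrow> real"
  assumes "continuous_on UNIV k" shows "set_integrable lborel {a..b} k"
  by (rule borel_integrable_atLeastAtMost') (rule continuous_on_subset[OF assms], simp)

text \<open>Lower semicontinuity: since the limit is already known to be \<open>C\<^sup>2\<close>, the bound
  \<open>g\<^sup>2 \<ge> 2 g F' - F'\<^sup>2\<close> and integration by parts replace weak convergence of derivatives.\<close>

lemma energy_lower_semicontinuous:
  fixes f g :: "nat \<Rightarrow> real \<Rightarrow> real"
  assumes \<epsilon>: "\<epsilon> > 0" and \<gamma>: "\<gamma> \<ge> 0"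
    and f: "\<And>n. f n \<in> weighted_H1" and p: "\<And>n. primitive (f n) (g n)"
    and M: "\<And>n x. \<bar>f n x\<bar> \<le> M" and lim: "\<And>x. (\<lambda>n. f n x) \<longlonglongrightarrow> F x"
    and m: "(\<lambda>n. sym_energy \<epsilon> \<gamma> (f n)) \<longlonglongrightarrow> m"
    and F1: "\<And>x. (F has_real_derivative F1 x) (at x)"
    and F2: "\<And>x. (F1 has_real_derivative F2 x) (at x)" and cF2: "continuous_on UNIV F2"
  shows "F \<in> weighted_H1" "sym_energy \<epsilon> \<gamma> F \<le> m"
proof -
  have cF1: "continuous_on UNIV F1" and cF: "continuous_on UNIV F"
    using F1 F2 by (meson DERIV_continuous continuous_at_imp_continuous_on)+
  have pF: "primitive F F1" by (rule primitive_C1[OF F1 cF1])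
  have pF1: "primitive F1 F2" by (rule primitive_C1[OF F2 cF2])
  have [measurable]: "f n \<in> borel_measurable borel" "g n \<in> borel_measurable borel"
    "F \<in> borel_measurable borel" "F1 \<in> borel_measurable borel" "F2 \<in> borel_measurable borel" for n
    using primitive_borel[OF p] primitive_measurable[OF p] borel_measurable_continuous_onI[OF cF]
      borel_measurable_continuous_onI[OF cF1] borel_measurable_continuous_onI[OF cF2] by auto
  have FM: "\<bar>F x\<bar> \<le> M" for x
    by (rule LIMSEQ_le_const2[OF tendsto_rabs[OF lim]]) (use M in auto)
  have cFr: "continuous_on UNIV (\<lambda>x. F (- x))"
    by (rule continuous_on_compose2[OF cF]) (auto intro: continuous_intros)
  have cd: "continuous_on UNIV (sym_density \<epsilon> \<gamma> F F1)"
    unfolding sym_density_def[abs_def] by (intro continuous_intros cF cF1 cFr)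
  define \<rho> where "\<rho> h x = (x\<^sup>2 - 1) * (h x)\<^sup>2 + 1/2 * (h x)^4 + \<gamma>/2 * (h x)\<^sup>2 * (h (- x))\<^sup>2" for h x
  have \<rho>_meas[measurable]: "\<rho> h \<in> borel_measurable borel" if [measurable]: "h \<in> borel_measurable borel" for h
    unfolding \<rho>_def[abs_def] by measurable
  \<comment> \<open>Restricting to R \<ge> 1 matters: outside [-R, R] the density is then
    nonnegative, so truncation only lowers the energy of f_n. On [-R, R] the potential terms are
    bounded and converge.\<close>
  have loc: "(LINT x:{-R..R}|lborel. sym_density \<epsilon> \<gamma> F F1 x) \<le> m" if R: "R \<ge> 1" for R
  proof -
    define K where "K = (R\<^sup>2 + 1) * M\<^sup>2 + 1/2 * M^4 + \<bar>\<gamma>/2\<bar> * M\<^sup>2 * M\<^sup>2"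
    have iw: "integrable lborel (\<lambda>x. K * indicator {-R..R} x)"
      by (intro integrable_mult_right integrable_real_indicator) (auto simp: emeasure_lborel_Icc_eq)
    have \<rho>b: "norm (indicator {-R..R} x *\<^sub>R \<rho> h x) \<le> K * indicator {-R..R} x" if h: "\<And>x. \<bar>h x\<bar> \<le> M" for h x
    proof (cases "x \<in> {-R..R}")
      case True
      have "\<bar>\<rho> h x\<bar> \<le> K" unfolding \<rho>_def K_def
        by (rule potential_bound) (use True h in auto)
      then show ?thesis using True by simp
    qed simp
    have \<rho>i: "set_integrable lborel {-R..R} (\<rho> h)" if [measurable]: "h \<in> borel_measurable borel" and h: "\<And>x. \<bar>h x\<bar> \<le> M" for h
      unfolding set_integrable_def
    proof (rule Bochner_Integration.integrable_bound[OF iw])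
      show "AE x in lborel. norm (indicator {-R..R} x *\<^sub>R \<rho> h x) \<le> norm (K * indicator {-R..R} x)"
        by (rule AE_I2) (rule order_trans[OF \<rho>b[OF h]], simp)
    qed measurable
    have \<rho>lim: "(\<lambda>n. LINT x:{-R..R}|lborel. \<rho> (f n) x) \<longlonglongrightarrow> (LINT x:{-R..R}|lborel. \<rho> F x)"
      unfolding set_lebesgue_integral_def
    proof (rule integral_dominated_convergence[OF _ _ iw])
      show "AE x in lborel. (\<lambda>n. indicator {-R..R} x *\<^sub>R \<rho> (f n) x) \<longlonglongrightarrow> indicator {-R..R} x *\<^sub>R \<rho> F x"
        unfolding \<rho>_def by (intro AE_I2 tendsto_intros lim)
      show "AE x in lborel. norm (indicator {-R..R} x *\<^sub>R \<rho> (f n) x) \<le> K * indicator {-R..R} x" for n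
        by (rule AE_I2) (rule \<rho>b[OF M])
    qed measurable
    have s1: "set_integrable lborel {-R..R} (\<lambda>x. f n x * F2 x)" for n
      by (rule set_integral_continuous_Icc) (intro continuous_intros primitive_continuous[OF p] cF2)
    have s2: "set_integrable lborel {-R..R} (\<lambda>x. F1 x * g n x)" for n
      by (rule set_integrable_continuous_mult[OF cF1 primitive_set_integrable[OF p] primitive_measurable[OF p]])
    have parts: "(LINT x:{-R..R}|lborel. F1 x * g n x) = f n R * F1 R - f n (-R) * F1 (-R) - (LINT x:{-R..R}|lborel. f n x * F2 x)" for n
    proof -
      have "integral {-R..R} (\<lambda>x. f n x * F2 x + g n x * F1 x) = f n R * F1 R - f n (-R) * F1 (-R)"
        using R by (intro primitive_integral[OF primitive_mult[OF p pF1]]) auto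
      moreover have "integral {-R..R} (\<lambda>x. f n x * F2 x + F1 x * g n x)
          = integral {-R..R} (\<lambda>x. f n x * F2 x) + integral {-R..R} (\<lambda>x. F1 x * g n x)"
        by (rule Henstock_Kurzweil_Integration.integral_add[OF integrable_on_of_set_integrable[OF s1] integrable_on_of_set_integrable[OF s2]])
      ultimately show ?thesis
        unfolding set_borel_integral_eq_integral(2)[OF s1] set_borel_integral_eq_integral(2)[OF s2]
        by (simp add: mult.commute[of _ "F1 _"])
    qed
    have partsF: "(LINT x:{-R..R}|lborel. (F1 x)\<^sup>2) = F R * F1 R - F (-R) * F1 (-R) - (LINT x:{-R..R}|lborel. F x * F2 x)"
    proof -
      have t1: "set_integrable lborel {-R..R} (\<lambda>x. F x * F2 x)" "set_integrable lborel {-R..R} (\<lambda>x. (F1 x)\<^sup>2)"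
        by (rule set_integral_continuous_Icc; intro continuous_intros cF cF1 cF2)+
      have "integral {-R..R} (\<lambda>x. F x * F2 x + F1 x * F1 x) = F R * F1 R - F (-R) * F1 (-R)"
        using R by (intro primitive_integral[OF primitive_mult[OF pF pF1]]) auto
      moreover have "integral {-R..R} (\<lambda>x. F x * F2 x + (F1 x)\<^sup>2)
          = integral {-R..R} (\<lambda>x. F x * F2 x) + integral {-R..R} (\<lambda>x. (F1 x)\<^sup>2)"
        by (rule Henstock_Kurzweil_Integration.integral_add[OF integrable_on_of_set_integrable[OF t1(1)] integrable_on_of_set_integrable[OF t1(2)]])
      ultimately show ?thesis
        unfolding set_borel_integral_eq_integral(2)[OF t1(1)] set_borel_integral_eq_integral(2)[OF t1(2)]
        by (simp add: power2_eq_square)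
    qed
    have "(\<lambda>n. LINT x:{-R..R}|lborel. f n x * F2 x) \<longlonglongrightarrow> (LINT x:{-R..R}|lborel. F x * F2 x)"
      unfolding set_lebesgue_integral_def
    proof (rule integral_dominated_convergence[where w = "\<lambda>x. M * \<bar>indicator {-R..R} x *\<^sub>R F2 x\<bar>"])
      show "integrable lborel (\<lambda>x. M * \<bar>indicator {-R..R} x *\<^sub>R F2 x\<bar>)"
        using set_integral_continuous_Icc[OF cF2, of "-R" R] by (simp add: set_integrable_def)
      show "AE x in lborel. (\<lambda>n. indicator {-R..R} x *\<^sub>R (f n x * F2 x)) \<longlonglongrightarrow> indicator {-R..R} x *\<^sub>R (F x * F2 x)"
        by (intro AE_I2 tendsto_intros lim)
      show "AE x in lborel. norm (indicator {-R..R} x *\<^sub>R (f n x * F2 x)) \<le> M * \<bar>indicator {-R..R} x *\<^sub>R F2 x\<bar>" for n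
        using M[of n] by (intro AE_I2) (auto simp: indicator_def abs_mult intro!: mult_right_mono)
    qed measurable
    then have "(\<lambda>n. \<epsilon>\<^sup>2 * (2 * (f n R * F1 R - f n (-R) * F1 (-R) - (LINT x:{-R..R}|lborel. f n x * F2 x))
        - (LINT x:{-R..R}|lborel. (F1 x)\<^sup>2)) + (LINT x:{-R..R}|lborel. \<rho> (f n) x))
      \<longlonglongrightarrow> \<epsilon>\<^sup>2 * (2 * (F R * F1 R - F (-R) * F1 (-R) - (LINT x:{-R..R}|lborel. F x * F2 x))
        - (LINT x:{-R..R}|lborel. (F1 x)\<^sup>2)) + (LINT x:{-R..R}|lborel. \<rho> F x)"
      by (intro tendsto_intros \<rho>lim lim)
    then have l1: "(\<lambda>n. \<epsilon>\<^sup>2 * (2 * (LINT x:{-R..R}|lborel. F1 x * g n x) - (LINT x:{-R..R}|lborel. (F1 x)\<^sup>2)) + (LINT x:{-R..R}|lborel. \<rho> (f n) x))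
      \<longlonglongrightarrow> \<epsilon>\<^sup>2 * (LINT x:{-R..R}|lborel. (F1 x)\<^sup>2) + (LINT x:{-R..R}|lborel. \<rho> F x)"
      unfolding parts partsF[symmetric] by simp
    have iF1: "set_integrable lborel {-R..R} (\<lambda>x. (F1 x)\<^sup>2)"
      by (rule set_integral_continuous_Icc) (intro continuous_intros cF1)
    have bound: "\<epsilon>\<^sup>2 * (2 * (LINT x:{-R..R}|lborel. F1 x * g n x) - (LINT x:{-R..R}|lborel. (F1 x)\<^sup>2)) + (LINT x:{-R..R}|lborel. \<rho> (f n) x)
      \<le> sym_energy \<epsilon> \<gamma> (f n)" for n
    proof -
      have id: "integrable lborel (sym_density \<epsilon> \<gamma> (f n) (g n))"
        by (rule sym_density_integrable[OF f weighted_H1_primitive_L2[OF f p]])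
      have e: "\<epsilon>\<^sup>2 * (2 * (LINT x:{-R..R}|lborel. F1 x * g n x) - (LINT x:{-R..R}|lborel. (F1 x)\<^sup>2)) + (LINT x:{-R..R}|lborel. \<rho> (f n) x)
        = (LINT x:{-R..R}|lborel. \<epsilon>\<^sup>2 * (2 * (F1 x * g n x) - (F1 x)\<^sup>2) + \<rho> (f n) x)"
        using s2[of n] iF1 \<rho>i[of "f n"] M[of n] by simp
      have i2: "set_integrable lborel {-R..R} (\<lambda>x. \<epsilon>\<^sup>2 * (2 * (F1 x * g n x) - (F1 x)\<^sup>2) + \<rho> (f n) x)"
        using s2[of n] iF1 \<rho>i[of "f n"] M[of n] by simp
      have "(LINT x:{-R..R}|lborel. \<epsilon>\<^sup>2 * (2 * (F1 x * g n x) - (F1 x)\<^sup>2) + \<rho> (f n) x)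
        \<le> (\<integral>x. sym_density \<epsilon> \<gamma> (f n) (g n) x \<partial>lborel)"
        unfolding set_lebesgue_integral_def
      proof (rule integral_mono)
        show "integrable lborel (\<lambda>x. indicator {-R..R} x *\<^sub>R (\<epsilon>\<^sup>2 * (2 * (F1 x * g n x) - (F1 x)\<^sup>2) + \<rho> (f n) x))"
          using i2 by (simp only: set_integrable_def)
        show "integrable lborel (sym_density \<epsilon> \<gamma> (f n) (g n))" by (rule id)
        fix x
        have "2 * (F1 x * g n x) - (F1 x)\<^sup>2 \<le> (g n x)\<^sup>2"
          using zero_le_power2[of "g n x - F1 x"] by (simp add: power2_diff algebra_simps)
        then have "\<epsilon>\<^sup>2 * (2 * (F1 x * g n x) - (F1 x)\<^sup>2) \<le> \<epsilon>\<^sup>2 * (g n x)\<^sup>2"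
          by (intro mult_left_mono) auto
        then have "\<epsilon>\<^sup>2 * (2 * (F1 x * g n x) - (F1 x)\<^sup>2) + \<rho> (f n) x \<le> sym_density \<epsilon> \<gamma> (f n) (g n) x"
          by (simp add: sym_density_def \<rho>_def)
        moreover have "0 \<le> sym_density \<epsilon> \<gamma> (f n) (g n) x" if "x \<notin> {-R..R}"
          using that R by (intro sym_density_nonneg[OF \<gamma>]) auto
        ultimately show "indicator {-R..R} x *\<^sub>R (\<epsilon>\<^sup>2 * (2 * (F1 x * g n x) - (F1 x)\<^sup>2) + \<rho> (f n) x) \<le> sym_density \<epsilon> \<gamma> (f n) (g n) x"
          by (cases "x \<in> {-R..R}") auto
      qed
      then show ?thesis unfolding e sym_energy_eq[OF f p] .
    qed
    have "\<epsilon>\<^sup>2 * (LINT x:{-R..R}|lborel. (F1 x)\<^sup>2) + (LINT x:{-R..R}|lborel. \<rho> F x) \<le> m"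
      by (rule LIMSEQ_le[OF l1 m]) (use bound in blast)
    moreover have "(LINT x:{-R..R}|lborel. sym_density \<epsilon> \<gamma> F F1 x)
        = (LINT x:{-R..R}|lborel. \<epsilon>\<^sup>2 * (F1 x)\<^sup>2 + \<rho> F x)"
      by (simp add: sym_density_def \<rho>_def add.assoc)
    moreover have "\<dots> = \<epsilon>\<^sup>2 * (LINT x:{-R..R}|lborel. (F1 x)\<^sup>2) + (LINT x:{-R..R}|lborel. \<rho> F x)"
      using iF1 \<rho>i[of F] FM by simp
    ultimately show ?thesis by simp
  qed
  \<comment> \<open>This is the coercive part of the density. Its integrals over all windows are
    bounded by m + 9/2, which shows that F belongs to the space before its energy is compared with
    m.\<close>
  define k where "k x = \<epsilon>\<^sup>2 * (F1 x)\<^sup>2 + 1/2 * (1 + x\<^sup>2) * (F x)\<^sup>2" for x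
  have ck: "continuous_on UNIV k" unfolding k_def[abs_def] by (intro continuous_intros cF cF1)
  have ik: "integrable lborel k"
  proof (rule integrable_of_bounded_Icc[OF ck])
    show "0 \<le> k x" for x by (simp add: k_def)
    fix n
    let ?S = "{-real (Suc n)..real (Suc n)}"
    have sd: "set_integrable lborel ?S (sym_density \<epsilon> \<gamma> F F1)" by (rule set_integral_continuous_Icc[OF cd])
    have j: "integrable lborel (\<lambda>x. 9/8 * indicator {-2..2::real} x :: real)"
      by (intro integrable_mult_right integrable_real_indicator) auto
    have "(LINT x:?S|lborel. k x) \<le> (\<integral>x. indicator ?S x *\<^sub>R sym_density \<epsilon> \<gamma> F F1 x + 9/8 * indicator {-2..2::real} x \<partial>lborel)"
      unfolding set_lebesgue_integral_def
    proof (rule integral_mono)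
      show "integrable lborel (\<lambda>x. indicator ?S x *\<^sub>R k x)"
        using set_integral_continuous_Icc[OF ck] by (simp only: set_integrable_def)
      show "integrable lborel (\<lambda>x. indicator ?S x *\<^sub>R sym_density \<epsilon> \<gamma> F F1 x + 9/8 * indicator {-2..2::real} x)"
        using sd j unfolding set_integrable_def by (rule Bochner_Integration.integrable_add)
      show "indicator ?S x *\<^sub>R k x \<le> indicator ?S x *\<^sub>R sym_density \<epsilon> \<gamma> F F1 x + 9/8 * indicator {-2..2::real} x" for x
        using sym_density_lower[OF \<gamma>, of \<epsilon> F1 x F] by (cases "x \<in> ?S") (auto simp: k_def)
    qed
    also have "\<dots> = (LINT x:?S|lborel. sym_density \<epsilon> \<gamma> F F1 x) + (\<integral>x. 9/8 * indicator {-2..2::real} x \<partial>lborel)"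
      using Bochner_Integration.integral_add[OF sd[unfolded set_integrable_def] j] by (simp only: set_lebesgue_integral_def)
    also have "\<dots> \<le> m + 9/2" using loc[of "real (Suc n)"] by simp
    finally show "(LINT x:?S|lborel. k x) \<le> m + 9/2" .
  qed
  have bd: "integrable lborel h" if "h \<in> borel_measurable borel" "\<And>x. 0 \<le> h x" "\<And>x. h x \<le> C * k x" for h C
  proof (rule Bochner_Integration.integrable_bound[of lborel "\<lambda>x. C * k x"])
    show "AE x in lborel. norm (h x) \<le> norm (C * k x)"
    proof (rule AE_I2)
      fix x show "norm (h x) \<le> norm (C * k x)"
        using that(2,3)[of x] by simp
    qed
  qed (use ik that in auto)
  have "F1 \<in> L2_space"
    unfolding L2_iff
  proof (intro conjI bd[of _ "1/\<epsilon>\<^sup>2"])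
    show "(F1 x)\<^sup>2 \<le> 1/\<epsilon>\<^sup>2 * k x" for x using \<epsilon> by (simp add: k_def field_simps)
  qed auto
  moreover have "F \<in> L2_space"
    unfolding L2_iff
  proof (intro conjI bd[of _ 2])
    show "(F x)\<^sup>2 \<le> 2 * k x" for x using zero_le_power2[of "\<epsilon> * F1 x"] zero_le_power2[of "x * F x"]
      by (simp add: k_def algebra_simps power_mult_distrib)
  qed auto
  moreover have "(\<lambda>x. x * F x) \<in> L2_space"
    unfolding L2_iff
  proof (intro conjI bd[of _ 2])
    show "(x * F x)\<^sup>2 \<le> 2 * k x" for x using zero_le_power2[of "\<epsilon> * F1 x"]
      by (simp add: k_def algebra_simps power_mult_distrib)
  qed auto
  ultimately show W: "F \<in> weighted_H1" by (intro weighted_H1I(1)[OF pF])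
  have le: "(LINT x:{-real (Suc n)..real (Suc n)}|lborel. sym_density \<epsilon> \<gamma> F F1 x) \<le> m" for n
    by (rule loc) simp
  show "sym_energy \<epsilon> \<gamma> F \<le> m"
    unfolding sym_energy_eq[OF W pF]
    by (rule LIMSEQ_le_const2[OF set_integral_Icc_tendsto[OF sym_density_integrable[OF W weighted_H1_primitive_L2[OF W pF]]]])
      (use le in blast)
qed

text \<open>Regularity comes before minimality here: the weak equation is derived for the pointwise
  limit of the sequence, and only the resulting C^2 regularity gives access to lower
  semicontinuity.\<close>

theorem sym_energy_minimizer:
  assumes \<epsilon>: "\<epsilon> > 0" and \<gamma>: "\<gamma> \<ge> 0"
  obtains F F1 where "F \<in> weighted_H1" "\<And>h. h \<in> weighted_H1 \<Longrightarrow> sym_energy \<epsilon> \<gamma> F \<le> sym_energy \<epsilon> \<gamma> h"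
    "\<And>x. 0 \<le> F x" "\<And>x. 0 \<le> x \<Longrightarrow> F (- x) \<le> F x"
    "\<And>x. (F has_real_derivative F1 x) (at x)" "\<And>x. (F1 has_real_derivative reaction \<gamma> F x / \<epsilon>\<^sup>2) (at x)"
proof -
  have lower: "- 9/2 \<le> sym_energy \<epsilon> \<gamma> h" if "h \<in> weighted_H1" for h
  proof -
    have "0 \<le> \<epsilon>\<^sup>2 * (\<integral>x. (weak_deriv h x)\<^sup>2 \<partial>lborel) + 1/2 * (\<integral>x. (h x)\<^sup>2 \<partial>lborel)"
      by (intro add_nonneg_nonneg mult_nonneg_nonneg Bochner_Integration.integral_nonneg) auto
    then show ?thesis using sym_energy_coercive[OF that weak_deriv(1)[OF that] \<gamma>, of \<epsilon>] by linarith
  qed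
  define m where "m = Inf (sym_energy \<epsilon> \<gamma> ` weighted_H1)"
  have ne: "weighted_H1 \<noteq> {}" using tent_weighted_H1[of 0 1 2] by auto
  have bdd: "bdd_below (sym_energy \<epsilon> \<gamma> ` weighted_H1)" using lower by (auto simp: bdd_below_def)
  have min: "m \<le> sym_energy \<epsilon> \<gamma> h" if "h \<in> weighted_H1" for h
    unfolding m_def using that by (intro cInf_lower bdd) auto
  \<comment> \<open>The sequence is reordered rather than its limit: nonnegativity and order are
    closed under pointwise convergence and pass to F for free.\<close>
  have "\<exists>f\<in>weighted_H1. (\<forall>x. 0 \<le> f x) \<and> (\<forall>x\<ge>0. f (- x) \<le> f x) \<and> sym_energy \<epsilon> \<gamma> f < m + 1 / real (Suc n)" for n
  proof -
    have "m < m + 1 / real (Suc n)" by simp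
    then obtain h where h: "h \<in> weighted_H1" "sym_energy \<epsilon> \<gamma> h < m + 1 / real (Suc n)"
      unfolding m_def using cInf_lessD[of "sym_energy \<epsilon> \<gamma> ` weighted_H1"] ne by blast
    then show ?thesis using reorder_states[OF h(1), of \<epsilon> \<gamma>] by (meson le_less_trans)
  qed
  then obtain f where f: "\<And>n. f n \<in> weighted_H1" "\<And>n x. 0 \<le> f n x" "\<And>n x. 0 \<le> x \<Longrightarrow> f n (- x) \<le> f n x"
    "\<And>n. sym_energy \<epsilon> \<gamma> (f n) < m + 1 / real (Suc n)"
    by metis
  define g where "g n = weak_deriv (f n)" for n
  have p: "primitive (f n) (g n)" for n unfolding g_def by (rule weak_deriv(1)[OF f(1)])
  have g2: "g n \<in> L2_space" for n unfolding g_def by (rule weak_deriv(2)[OF f(1)])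
  have f2: "f n \<in> L2_space" for n by (rule weighted_H1_L2(1)[OF f(1)])
  \<comment> \<open>All energies in the sequence are below m + 1, and 9/2 is the offset in the
    coercivity estimate.\<close>
  define C where "C = m + 1 + 9/2"
  have co: "\<epsilon>\<^sup>2 * (\<integral>x. (g n x)\<^sup>2 \<partial>lborel) + 1/2 * (\<integral>x. (f n x)\<^sup>2 \<partial>lborel) \<le> C" for n
  proof -
    have "1 / real (Suc n) \<le> 1" by simp
    then show ?thesis
      using sym_energy_coercive[OF f(1) p \<gamma>, of \<epsilon> n] f(4)[of n] unfolding C_def by linarith
  qed
  have nn: "0 \<le> (\<integral>x. (g n x)\<^sup>2 \<partial>lborel)" "0 \<le> (\<integral>x. (f n x)\<^sup>2 \<partial>lborel)" for n by simp_all
  have K: "(\<integral>x. (g n x)\<^sup>2 \<partial>lborel) \<le> C / \<epsilon>\<^sup>2" "(\<integral>x. (f n x)\<^sup>2 \<partial>lborel) \<le> 2 * C" for n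
  proof -
    have "\<epsilon>\<^sup>2 * (\<integral>x. (g n x)\<^sup>2 \<partial>lborel) \<le> C" using co[of n] nn(2)[of n] by linarith
    then show "(\<integral>x. (g n x)\<^sup>2 \<partial>lborel) \<le> C / \<epsilon>\<^sup>2" using \<epsilon> by (simp add: field_simps)
    have "0 \<le> \<epsilon>\<^sup>2 * (\<integral>x. (g n x)\<^sup>2 \<partial>lborel)" using nn(1)[of n] by simp
    then show "(\<integral>x. (f n x)\<^sup>2 \<partial>lborel) \<le> 2 * C" using co[of n] by linarith
  qed
  define M where "M = sqrt (2 * (2 * C) + C / \<epsilon>\<^sup>2)"
  have M: "\<bar>f n x\<bar> \<le> M" for n x
    using primitive_L2_bound[OF p f2 g2, of n x] K[of n] unfolding M_def by (intro real_le_rsqrt) simp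
  obtain r F where r: "strict_mono r" and lim: "\<And>x. (\<lambda>n. f (r n) x) \<longlonglongrightarrow> F x" and F: "continuous_on UNIV F"
    by (rule bounded_H1_pointwise_convergent_subseq[of f g "C / \<epsilon>\<^sup>2" M, OF p f2 g2 K(1) M]) (rule that)
  have "(\<lambda>n. sym_energy \<epsilon> \<gamma> (f n)) \<longlonglongrightarrow> m"
  proof (rule tendsto_sandwich[OF _ _ tendsto_const])
    show "\<forall>\<^sub>F n in sequentially. m \<le> sym_energy \<epsilon> \<gamma> (f n)" using min f(1) by auto
    show "\<forall>\<^sub>F n in sequentially. sym_energy \<epsilon> \<gamma> (f n) \<le> m + 1 / real (Suc n)" 
      by (rule always_eventually) (use f(4) less_imp_le in blast)
    have "(\<lambda>n. m + 1 / real (Suc n)) \<longlonglongrightarrow> m + 0"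
      by (intro tendsto_intros LIMSEQ_Suc lim_const_over_n)
    then show "(\<lambda>n. m + 1 / real (Suc n)) \<longlonglongrightarrow> m" by simp
  qed
  then have m: "(\<lambda>n. sym_energy \<epsilon> \<gamma> (f (r n))) \<longlonglongrightarrow> m"
    using LIMSEQ_subseq_LIMSEQ[OF _ r] by (force simp: o_def)
  have cN: "continuous_on UNIV (reaction \<gamma> F)" by (rule reaction_continuous[OF F])
  obtain F1 where F1: "\<And>x. (F has_real_derivative F1 x) (at x)" "\<And>x. (F1 has_real_derivative reaction \<gamma> F x / \<epsilon>\<^sup>2) (at x)"
  proof (rule tent_weak_solution_regular[OF _ cN, of \<epsilon> F])
    show "\<epsilon> \<noteq> 0" using \<epsilon> by simp
    show "\<epsilon>\<^sup>2 * ((c - a) * F b - (c - b) * F a - (b - a) * F c) + (\<integral>x. reaction \<gamma> F x * tent a b c x \<partial>lborel) = 0"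
      if "a < b" "b < c" for a b c
      by (rule minimizing_sequence_euler_lagrange[OF f(1) p M lim F m min that])
  qed blast
  have "continuous_on UNIV (\<lambda>x. reaction \<gamma> F x / \<epsilon>\<^sup>2)"
    using \<epsilon> by (intro continuous_intros cN) auto
  note lsc = energy_lower_semicontinuous[OF \<epsilon> \<gamma> f(1) p M lim m F1 this]
  show thesis
  proof (rule that[OF lsc(1) _ _ _ F1])
    show "sym_energy \<epsilon> \<gamma> F \<le> sym_energy \<epsilon> \<gamma> h" if "h \<in> weighted_H1" for h
      using lsc(2) min[OF that] by linarith
    show "0 \<le> F x" for x by (rule LIMSEQ_le_const[OF lim]) (use f(2) in auto)
    show "F (- x) \<le> F x" if "0 \<le> x" for x by (rule LIMSEQ_le[OF lim lim]) (use f(3)[OF that] in auto)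
  qed
qed

section \<open>The scalar ground state\<close>

text \<open>Gronwall's argument: (y^2 + y'^2) exp(-K t) is nonincreasing once K bounds \<bar>1 +
  c\<bar> on the interval, and it starts at 0.\<close>

lemma linear_ode_zero_right:
  fixes y y1 c :: "real \<Rightarrow> real"
  assumes y: "\<And>x. (y has_real_derivative y1 x) (at x)" and y1: "\<And>x. (y1 has_real_derivative c x * y x) (at x)"
    and c: "continuous_on UNIV c" and "y x0 = 0" "y1 x0 = 0" and x: "x0 \<le> x"
  shows "y x = 0"
proof -
  have "bounded (c ` {x0..x})"
    by (intro compact_imp_bounded compact_continuous_image continuous_on_subset[OF c]) auto
  then obtain C where C: "\<forall>t\<in>{x0..x}. \<bar>c t\<bar> \<le> C" by (auto simp: bounded_iff)
  define K where "K = 1 + C"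
  define E where "E t = ((y t)\<^sup>2 + (y1 t)\<^sup>2) * exp (- K * t)" for t
  have "E x \<le> E x0"
  proof (rule DERIV_nonpos_imp_nonincreasing[OF x])
    fix t assume t: "x0 \<le> t" "t \<le> x"
    define D where "D = (1 + c t) * (2 * (y t * y1 t)) - K * ((y t)\<^sup>2 + (y1 t)\<^sup>2)"
    have "(E has_real_derivative D * exp (- K * t)) (at t)"
      unfolding E_def[abs_def] D_def
      by (auto intro!: derivative_eq_intros y y1 simp: algebra_simps)
    moreover have "D \<le> 0"
    proof -
      have "2 * \<bar>y t * y1 t\<bar> \<le> (y t)\<^sup>2 + (y1 t)\<^sup>2"
        using zero_le_power2[of "\<bar>y t\<bar> - \<bar>y1 t\<bar>"] by (simp add: power2_diff abs_mult)
      moreover have "\<bar>1 + c t\<bar> \<le> K" using C t abs_triangle_ineq[of 1 "c t"] unfolding K_def by force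
      ultimately have "\<bar>1 + c t\<bar> * (2 * \<bar>y t * y1 t\<bar>) \<le> K * ((y t)\<^sup>2 + (y1 t)\<^sup>2)"
        by (intro mult_mono) auto
      moreover have "(1 + c t) * (2 * (y t * y1 t)) \<le> \<bar>1 + c t\<bar> * (2 * \<bar>y t * y1 t\<bar>)"
        by (rule order_trans[OF abs_ge_self]) (simp add: abs_mult)
      ultimately show ?thesis unfolding D_def by linarith
    qed
    ultimately show "\<exists>z. (E has_real_derivative z) (at t) \<and> z \<le> 0"
      by (meson exp_ge_zero mult_nonpos_nonneg)
  qed
  also have "E x0 = 0" by (simp add: E_def assms)
  finally have "(y x)\<^sup>2 + (y1 x)\<^sup>2 \<le> 0"
    unfolding E_def by (simp add: mult_le_0_iff)
  then have "(y x)\<^sup>2 \<le> 0" using zero_le_power2[of "y1 x"] by linarith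
  then show ?thesis by simp
qed

lemma linear_ode_zero:
  fixes y y1 c :: "real \<Rightarrow> real"
  assumes y: "\<And>x. (y has_real_derivative y1 x) (at x)" and y1: "\<And>x. (y1 has_real_derivative c x * y x) (at x)"
    and c: "continuous_on UNIV c" and 0: "y x0 = 0" "y1 x0 = 0"
  shows "y x = 0"
proof (cases "x0 \<le> x")
  case True
  then show ?thesis by (rule linear_ode_zero_right[OF y y1 c 0])
next
  case False
  have "(\<lambda>t. y (- t)) (- x) = 0"
  proof (rule linear_ode_zero_right[where y = "\<lambda>t. y (- t)" and ?y1.0 = "\<lambda>t. - y1 (- t)" and c = "\<lambda>t. c (- t)" and ?x0.0 = "- x0"])
    show "((\<lambda>t. y (- t)) has_real_derivative - y1 (- x)) (at x)" for x
      by (rule DERIV_cong[OF DERIV_chain2[OF y]]) (auto intro!: derivative_eq_intros)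
    show "((\<lambda>t. - y1 (- t)) has_real_derivative c (- x) * y (- x)) (at x)" for x
      by (rule DERIV_cong[OF DERIV_minus[OF DERIV_chain2[OF y1]]]) (auto intro!: derivative_eq_intros)
    show "continuous_on UNIV (\<lambda>t. c (- t))"
      by (rule continuous_on_compose2[OF c]) (auto intro: continuous_intros)
  qed (use 0 False in auto)
  then show ?thesis by simp
qed

text \<open>An interior zero of a nonnegative function is a minimum, so the derivative vanishes too
  and uniqueness applies. It takes the place of a strong maximum principle; nonlinear equations are
  covered by treating the factor of y as a known coefficient.\<close>

lemma nonneg_solution_touching_zero:
  fixes y y1 c :: "real \<Rightarrow> real"
  assumes y: "\<And>x. (y has_real_derivative y1 x) (at x)" and y1: "\<And>x. (y1 has_real_derivative c x * y x) (at x)"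
    and c: "continuous_on UNIV c" and S: "open S" "x0 \<in> S" "\<And>x. x \<in> S \<Longrightarrow> 0 \<le> y x" and 0: "y x0 = 0"
  shows "y x = 0"
proof -
  obtain d where d: "d > 0" "ball x0 d \<subseteq> S" using S open_contains_ball by blast
  have "y1 x0 = 0"
    by (rule DERIV_local_min[OF y d(1)]) (use d(2) S(3) 0 in \<open>auto simp: subset_eq dist_real_def\<close>)
  then show ?thesis by (rule linear_ode_zero[OF y y1 c 0])
qed

section \<open>Existence of the positive scalar solution\<close>

text \<open>The trial function is 1 - \<bar>x\<bar> on [-1, 1], and each half contributes
  \<epsilon>^2 - 1/5. For \<epsilon> \<le> 1/4 the total is negative, which excludes the zero
  minimizer and later bounds the integral of \<eta>^4 from below.\<close>

lemma tent_trial_energy: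
  "sym_energy \<epsilon> 0 (tent (-1) 0 1) = 2 * \<epsilon>\<^sup>2 - 2/5"
proof -
  let ?T = "tent (-1) 0 1" and ?dT = "tent_deriv (-1) 0 1"
  have T: "?T \<in> weighted_H1" and p: "primitive ?T ?dT"
    by (rule tent_weighted_H1) (simp_all add: primitive_tent)
  let ?d = "sym_density \<epsilon> 0 ?T ?dT"
  have tent_eq: "?T x = 1 - \<bar>x\<bar>" if "x \<in> {-1..1}" for x
    using that by (auto simp: tent_def abs_if field_simps)
  have tent_deriv_sq: "(?dT x)\<^sup>2 = 1" if "x \<in> {-1<..<1}" "x \<noteq> 0" for x
    using that by (auto simp: tent_deriv_def sgn_if)
  have "((\<lambda>x. \<epsilon>\<^sup>2 + (x\<^sup>2 - 1) * (1 - x)\<^sup>2 + 1/2 * (1 - x)^4) has_integral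
     ((\<epsilon>\<^sup>2 * 1 + (1 - 1)^4/2 - 3/10 * (1 - 1)^5) - (\<epsilon>\<^sup>2 * 0 + (1 - 0)^4/2 - 3/10 * (1 - 0)^5))) {0..1::real}"
  proof (rule fundamental_theorem_of_calculus[where f = "\<lambda>x. \<epsilon>\<^sup>2 * x + (1 - x)^4/2 - 3/10 * (1 - x)^5"])
    fix x :: real
    have "((\<lambda>x. \<epsilon>\<^sup>2 * x + (1 - x)^4/2 - 3/10 * (1 - x)^5) has_real_derivative (\<epsilon>\<^sup>2 - 2 * (1 - x)^3 + 3/2 * (1 - x)^4)) (at x within {0..1})"
      by (auto intro!: derivative_eq_intros)
    also have "\<epsilon>\<^sup>2 - 2 * (1 - x)^3 + 3/2 * (1 - x)^4 = \<epsilon>\<^sup>2 + (x\<^sup>2 - 1) * (1 - x)\<^sup>2 + 1/2 * (1 - x)^4"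
      by (simp add: power2_eq_square power3_eq_cube power4_eq_xxxx field_simps)
    finally show "((\<lambda>x. \<epsilon>\<^sup>2 * x + (1 - x)^4/2 - 3/10 * (1 - x)^5) has_vector_derivative \<epsilon>\<^sup>2 + (x\<^sup>2 - 1) * (1 - x)\<^sup>2 + 1/2 * (1 - x)^4) (at x within {0..1})"
      by (simp add: has_real_derivative_iff_has_vector_derivative)
  qed simp
  then have "(?d has_integral (\<epsilon>\<^sup>2 - 1/5)) {0..1}"
    by (intro has_integral_spike_finite[of "{0,1}" _ ?d "\<lambda>x. \<epsilon>\<^sup>2 + (x\<^sup>2 - 1) * (1 - x)\<^sup>2 + 1/2 * (1 - x)^4"])
      (auto simp: sym_density_def tent_eq tent_deriv_sq)
  moreover have "((\<lambda>x. \<epsilon>\<^sup>2 + (x\<^sup>2 - 1) * (1 + x)\<^sup>2 + 1/2 * (1 + x)^4) has_integral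
     ((\<epsilon>\<^sup>2 * 0 - (1 + 0)^4/2 + 3/10 * (1 + 0)^5) - (\<epsilon>\<^sup>2 * (-1) - (1 + (-1))^4/2 + 3/10 * (1 + (-1))^5))) {-1..0::real}"
  proof (rule fundamental_theorem_of_calculus[where f = "\<lambda>x. \<epsilon>\<^sup>2 * x - (1 + x)^4/2 + 3/10 * (1 + x)^5"])
    fix x :: real
    have "((\<lambda>x. \<epsilon>\<^sup>2 * x - (1 + x)^4/2 + 3/10 * (1 + x)^5) has_real_derivative (\<epsilon>\<^sup>2 - 2 * (1 + x)^3 + 3/2 * (1 + x)^4)) (at x within {-1..0})"
      by (auto intro!: derivative_eq_intros)
    also have "\<epsilon>\<^sup>2 - 2 * (1 + x)^3 + 3/2 * (1 + x)^4 = \<epsilon>\<^sup>2 + (x\<^sup>2 - 1) * (1 + x)\<^sup>2 + 1/2 * (1 + x)^4"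
      by (simp add: power2_eq_square power3_eq_cube power4_eq_xxxx field_simps)
    finally show "((\<lambda>x. \<epsilon>\<^sup>2 * x - (1 + x)^4/2 + 3/10 * (1 + x)^5) has_vector_derivative \<epsilon>\<^sup>2 + (x\<^sup>2 - 1) * (1 + x)\<^sup>2 + 1/2 * (1 + x)^4) (at x within {-1..0})"
      by (simp add: has_real_derivative_iff_has_vector_derivative)
  qed simp
  then have "(?d has_integral (\<epsilon>\<^sup>2 - 1/5)) {-1..0}"
    by (intro has_integral_spike_finite[of "{-1,0}" _ ?d "\<lambda>x. \<epsilon>\<^sup>2 + (x\<^sup>2 - 1) * (1 + x)\<^sup>2 + 1/2 * (1 + x)^4"])
      (auto simp: sym_density_def tent_eq tent_deriv_sq)
  ultimately have "(?d has_integral ((\<epsilon>\<^sup>2 - 1/5) + (\<epsilon>\<^sup>2 - 1/5))) {-1..1}"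
    by (intro has_integral_combine[of "-1" 0 1]) auto
  moreover have "sym_energy \<epsilon> 0 ?T = integral {-1..1} ?d"
    unfolding sym_energy_eq[OF T p]
    by (rule integral_eq_integral_Icc[OF sym_density_integrable[OF T weighted_H1_primitive_L2[OF T p]]])
      (simp add: sym_density_def tent_outside)
  ultimately show ?thesis by (simp add: integral_unique)
qed

lemma continuous_integral_zero:
  fixes k :: "real \<Rightarrow> real"
  assumes c: "continuous_on UNIV k" and k0: "\<And>x. 0 \<le> k x" and i: "integrable lborel k" "(\<integral>x. k x \<partial>lborel) \<le> 0"
  shows "k x = 0"
proof -
  have "integral {x-1..x+1} k \<le> 0" using integral_Icc_le(2)[OF i(1) k0, of "x-1" "x+1"] i(2) by linarith
  moreover have "0 \<le> integral {x-1..x+1} k" by (rule integral_nonneg[OF integral_Icc_le(1)[OF i(1) k0] k0])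
  ultimately have "(k has_integral 0) (cbox (x-1) (x+1))"
    using integral_Icc_le(1)[OF i(1) k0, of "x-1" "x+1"] by (simp add: has_integral_iff cbox_interval)
  then show ?thesis
    by (intro has_integral_0_cbox_imp_0[of "x-1" "x+1" k]) (auto intro: continuous_on_subset[OF c] k0)
qed

text \<open>A minimizer at \<gamma> = 0 is nonnegative and has negative energy. If it touched zero
  anywhere it would vanish identically and have energy 0.\<close>

lemma positive_scalar_state_exists:
  assumes \<epsilon>: "0 < \<epsilon>" "\<epsilon> \<le> 1/4" shows "\<exists>\<eta>. positive_scalar_state \<epsilon> \<eta>"
proof -
  obtain F F1 where F: "F \<in> weighted_H1" "\<And>h. h \<in> weighted_H1 \<Longrightarrow> sym_energy \<epsilon> 0 F \<le> sym_energy \<epsilon> 0 h"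
    "\<And>x. 0 \<le> F x" and F1: "\<And>x. (F has_real_derivative F1 x) (at x)"
    "\<And>x. (F1 has_real_derivative reaction 0 F x / \<epsilon>\<^sup>2) (at x)"
    by (rule sym_energy_minimizer[OF \<epsilon>(1) order_refl]) (rule that)
  have cF: "continuous_on UNIV F" by (rule weighted_H1_continuous[OF F(1)])
  have "sym_energy \<epsilon> 0 F \<le> 2 * \<epsilon>\<^sup>2 - 2/5"
    using F(2)[OF tent_weighted_H1[of "-1" 0 1]] by (simp add: tent_trial_energy)
  also have "\<epsilon>\<^sup>2 \<le> (1/4)\<^sup>2" using \<epsilon> by (intro power_mono) auto
  finally have neg: "sym_energy \<epsilon> 0 F < 0" by (simp add: power2_eq_square)
  have "F x > 0" for x
  proof (rule ccontr)
    assume "\<not> F x > 0"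
    then have 0: "F x = 0" using F(3)[of x] by simp
    have "F z = 0" for z
    proof (rule nonneg_solution_touching_zero[OF F1(1), of "\<lambda>x. ((x\<^sup>2 - 1) + (F x)\<^sup>2) / \<epsilon>\<^sup>2" UNIV x])
      show "(F1 has_real_derivative (x\<^sup>2 - 1 + (F x)\<^sup>2) / \<epsilon>\<^sup>2 * F x) (at x)" for x
        using F1(2)[of x] by (simp add: reaction_def algebra_simps power2_eq_square power3_eq_cube)
      show "continuous_on UNIV (\<lambda>x. (x\<^sup>2 - 1 + (F x)\<^sup>2) / \<epsilon>\<^sup>2)"
        using \<epsilon> by (intro continuous_intros cF) auto
    qed (use F(3) 0 in auto)
    then have "F = (\<lambda>x. 0)" by auto
    moreover have "primitive (\<lambda>x. 0) (\<lambda>x. 0)" by (rule primitive_C1) auto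
    ultimately have "sym_energy \<epsilon> 0 F = 0"
      using sym_energy_eq[OF F(1), of "\<lambda>x. 0" \<epsilon> 0] by (simp add: sym_density_def)
    then show False using neg by simp
  qed
  moreover have "\<epsilon>\<^sup>2 * (reaction 0 F x / \<epsilon>\<^sup>2) + (1 - x\<^sup>2 - (F x)\<^sup>2) * F x = 0" for x
  proof -
    have e: "\<epsilon>\<^sup>2 * (reaction 0 F x / \<epsilon>\<^sup>2) = reaction 0 F x" using \<epsilon> by simp
    show ?thesis unfolding e by (simp add: reaction_def algebra_simps power2_eq_square power3_eq_cube)
  qed
  moreover have "has_second_derivative F (\<lambda>x. reaction 0 F x / \<epsilon>\<^sup>2)"
    unfolding has_second_derivative_def using F1 by blast
  ultimately have "positive_scalar_state \<epsilon> F"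
    unfolding positive_scalar_state_def using F(1) unfolding weighted_H1_def by blast
  then show ?thesis by blast
qed

section \<open>The quadratic form attached to the scalar solution\<close>

definition linear_form :: "real \<Rightarrow> (real \<Rightarrow> real) \<Rightarrow> (real \<Rightarrow> real) \<Rightarrow> real" where
  "linear_form \<epsilon> \<eta> a = (\<integral>x. \<epsilon>\<^sup>2 * (weak_deriv a x)\<^sup>2 + (x\<^sup>2 - 1 + (\<eta> x)\<^sup>2) * (a x)\<^sup>2 \<partial>lborel)"

lemma linear_form_integrable:
  assumes \<eta>: "\<eta> \<in> weighted_H1" and a: "a \<in> weighted_H1" and g: "g \<in> L2_space"
  shows "integrable lborel (\<lambda>x. \<epsilon>\<^sup>2 * (g x)\<^sup>2 + (x\<^sup>2 - 1 + (\<eta> x)\<^sup>2) * (a x)\<^sup>2)"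
proof -
  have "integrable lborel (\<lambda>x. \<epsilon>\<^sup>2 * (g x)\<^sup>2 + (x\<^sup>2 * (a x)\<^sup>2 - (a x)\<^sup>2 + (\<eta> x)\<^sup>2 * (a x)\<^sup>2))"
    using weighted_H1_integrable[OF a a] weighted_H1_integrable(5)[OF \<eta> a] L2_integrable_square[OF g] by simp
  then show ?thesis by (rule back_subst[of "integrable lborel"]) (auto simp: algebra_simps)
qed

lemma linear_form_eq:
  assumes \<eta>: "\<eta> \<in> weighted_H1" and a: "a \<in> weighted_H1" and p: "primitive a g"
  shows "linear_form \<epsilon> \<eta> a = (\<integral>x. \<epsilon>\<^sup>2 * (g x)\<^sup>2 + (x\<^sup>2 - 1 + (\<eta> x)\<^sup>2) * (a x)\<^sup>2 \<partial>lborel)"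
  unfolding linear_form_def
proof (rule integral_cong_AE)
  note [measurable] = weighted_H1_measurable[OF \<eta>] weighted_H1_measurable[OF a] primitive_measurable[OF p] weak_deriv_measurable[OF a]
  show "(\<lambda>x. \<epsilon>\<^sup>2 * (weak_deriv a x)\<^sup>2 + (x\<^sup>2 - 1 + (\<eta> x)\<^sup>2) * (a x)\<^sup>2) \<in> borel_measurable lborel"
    "(\<lambda>x. \<epsilon>\<^sup>2 * (g x)\<^sup>2 + (x\<^sup>2 - 1 + (\<eta> x)\<^sup>2) * (a x)\<^sup>2) \<in> borel_measurable lborel" by measurable
  show "AE x in lborel. \<epsilon>\<^sup>2 * (weak_deriv a x)\<^sup>2 + (x\<^sup>2 - 1 + (\<eta> x)\<^sup>2) * (a x)\<^sup>2 = \<epsilon>\<^sup>2 * (g x)\<^sup>2 + (x\<^sup>2 - 1 + (\<eta> x)\<^sup>2) * (a x)\<^sup>2"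
    using primitive_AE_unique[OF weak_deriv(1)[OF a] p] by (rule eventually_mono) simp
qed

text \<open>Completing the square: a^4/2 = (\<eta>^2 - a^2)^2/2 + \<eta>^2 a^2 - \<eta>^4/2, where
  \<eta>^2 a^2 is absorbed into the potential of the form.\<close>

lemma sym_energy_0_eq:
  assumes \<eta>: "\<eta> \<in> weighted_H1" and a: "a \<in> weighted_H1"
  shows "sym_energy \<epsilon> 0 a = linear_form \<epsilon> \<eta> a + 1/2 * (\<integral>x. ((\<eta> x)\<^sup>2 - (a x)\<^sup>2)\<^sup>2 \<partial>lborel) - 1/2 * (\<integral>x. (\<eta> x)^4 \<partial>lborel)"
proof -
  have i: "integrable lborel (\<lambda>x. (\<eta> x)^4)" "integrable lborel (\<lambda>x. ((\<eta> x)\<^sup>2 - (a x)\<^sup>2)\<^sup>2)"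
  proof -
    show "integrable lborel (\<lambda>x. (\<eta> x)^4)" by (rule weighted_H1_integrable[OF \<eta> \<eta>])
    have "integrable lborel (\<lambda>x. (\<eta> x * \<eta> x - a x * a x)\<^sup>2)"
      by (intro L2_integrable_square L2_diff weighted_H1_mult_L2 \<eta> a)
    then show "integrable lborel (\<lambda>x. ((\<eta> x)\<^sup>2 - (a x)\<^sup>2)\<^sup>2)" by (simp add: power2_eq_square)
  qed
  note l = linear_form_integrable[OF \<eta> a weak_deriv(2)[OF a], of \<epsilon>]
  have "sym_energy \<epsilon> 0 a = (\<integral>x. (\<epsilon>\<^sup>2 * (weak_deriv a x)\<^sup>2 + (x\<^sup>2 - 1 + (\<eta> x)\<^sup>2) * (a x)\<^sup>2)
     + (1/2 * ((\<eta> x)\<^sup>2 - (a x)\<^sup>2)\<^sup>2 - 1/2 * (\<eta> x)^4) \<partial>lborel)"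
    unfolding sym_energy_def
    by (rule Bochner_Integration.integral_cong)
      (simp_all add: sym_density_def power2_diff algebra_simps)
  also have "\<dots> = linear_form \<epsilon> \<eta> a + (1/2 * (\<integral>x. ((\<eta> x)\<^sup>2 - (a x)\<^sup>2)\<^sup>2 \<partial>lborel) - 1/2 * (\<integral>x. (\<eta> x)^4 \<partial>lborel))"
    using l i unfolding linear_form_def by simp
  finally show ?thesis by simp
qed

locale scalar_state =
  fixes \<epsilon> :: real and \<eta> \<eta>' \<eta>'' :: "real \<Rightarrow> real"
  assumes \<epsilon>: "0 < \<epsilon>" and weighted: "\<eta> \<in> weighted_H1" and pos: "0 < \<eta> x"
    and deriv1: "(\<eta> has_real_derivative \<eta>' x) (at x)" and deriv2: "(\<eta>' has_real_derivative \<eta>'' x) (at x)"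
    and equation: "\<epsilon>\<^sup>2 * \<eta>'' x = (x\<^sup>2 - 1 + (\<eta> x)\<^sup>2) * \<eta> x"

lemma positive_scalar_state_locale:
  assumes "0 < \<epsilon>" "positive_scalar_state \<epsilon> \<eta>"
  obtains \<eta>' \<eta>'' where "scalar_state \<epsilon> \<eta> \<eta>' \<eta>''"
proof -
  obtain \<eta>'' where e: "has_second_derivative \<eta> \<eta>''" "\<forall>x. \<epsilon>\<^sup>2 * \<eta>'' x + (1 - x\<^sup>2 - (\<eta> x)\<^sup>2) * \<eta> x = 0"
    and w: "\<eta> \<in> weighted_H1" "\<forall>x. 0 < \<eta> x"
    using assms(2) unfolding positive_scalar_state_def weighted_H1_def by blast
  obtain \<eta>' where d: "\<forall>x. (\<eta> has_real_derivative \<eta>' x) (at x)" "\<forall>x. (\<eta>' has_real_derivative \<eta>'' x) (at x)"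
    using e(1) unfolding has_second_derivative_def by blast
  have "scalar_state \<epsilon> \<eta> \<eta>' \<eta>''"
  proof
    show "\<epsilon>\<^sup>2 * \<eta>'' x = (x\<^sup>2 - 1 + (\<eta> x)\<^sup>2) * \<eta> x" for x
      using e(2)[rule_format, of x] by (simp add: algebra_simps)
  qed (use assms w d in auto)
  then show thesis by (rule that)
qed

context scalar_state
begin

lemma continuous [continuous_intros]: "continuous_on S \<eta>" "continuous_on S \<eta>'"
  using deriv1 deriv2 by (meson DERIV_continuous continuous_at_imp_continuous_on)+

lemma second_derivative_eq: "\<eta>'' = (\<lambda>x. (x\<^sup>2 - 1 + (\<eta> x)\<^sup>2) * \<eta> x / \<epsilon>\<^sup>2)"
proof
  fix x show "\<eta>'' x = (x\<^sup>2 - 1 + (\<eta> x)\<^sup>2) * \<eta> x / \<epsilon>\<^sup>2"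
    using equation[of x] \<epsilon> by (simp add: field_simps)
qed

lemma continuous2: "continuous_on S \<eta>''"
  unfolding second_derivative_eq using \<epsilon> by (intro continuous_intros) auto

lemma primitive: "primitive \<eta> \<eta>'" "primitive \<eta>' \<eta>''"
  by (rule primitive_C1[OF deriv1 continuous(2)], rule primitive_C1[OF deriv2 continuous2])

lemma reflected: "scalar_state \<epsilon> (\<lambda>x. \<eta> (- x)) (\<lambda>x. - \<eta>' (- x)) (\<lambda>x. \<eta>'' (- x))"
proof
  show "(\<lambda>x. \<eta> (- x)) \<in> weighted_H1" by (rule weighted_H1_reflect(1)[OF weighted])
  show "((\<lambda>x. \<eta> (- x)) has_real_derivative - \<eta>' (- x)) (at x)" for x
    by (rule DERIV_cong[OF DERIV_chain2[OF deriv1]]) (auto intro!: derivative_eq_intros)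
  show "((\<lambda>x. - \<eta>' (- x)) has_real_derivative \<eta>'' (- x)) (at x)" for x
    by (rule DERIV_cong[OF DERIV_minus[OF DERIV_chain2[OF deriv2]]]) (auto intro!: derivative_eq_intros)
  show "\<epsilon>\<^sup>2 * \<eta>'' (- x) = (x\<^sup>2 - 1 + (\<eta> (- x))\<^sup>2) * \<eta> (- x)" for x
    using equation[of "- x"] by simp
qed (use \<epsilon> pos in auto)

text \<open>On \<open>x \<ge> 1\<close> the solution is convex, so a positive slope would persist and contradict
  square integrability.\<close>

lemma derivative_nonpos:
  assumes "1 \<le> x" shows "\<eta>' x \<le> 0"
proof (rule ccontr)
  assume "\<not> \<eta>' x \<le> 0"
  have nn: "0 \<le> \<eta>'' y" if "1 \<le> y" for y
    unfolding second_derivative_eq using that pos[of y] by (intro divide_nonneg_nonneg mult_nonneg_nonneg) auto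
  have d: "0 \<le> \<eta>' y" if "x \<le> y" for y
  proof -
    have "\<eta>' x \<le> \<eta>' y"
      by (rule DERIV_nonneg_imp_nondecreasing[OF that]) (use deriv2 nn assms in \<open>meson order_trans\<close>)
    then show ?thesis using \<open>\<not> \<eta>' x \<le> 0\<close> by linarith
  qed
  have mono: "\<eta> x \<le> \<eta> y" if "x \<le> y" for y
    by (rule DERIV_nonneg_imp_nondecreasing[OF that]) (use deriv1 d in blast)
  define I where "I = (\<integral>y. (\<eta> y)\<^sup>2 \<partial>lborel)"
  have i: "integrable lborel (\<lambda>y. (\<eta> y)\<^sup>2)" by (rule weighted_H1_integrable[OF weighted weighted])
  have "N * (\<eta> x)\<^sup>2 \<le> I" if "N > 0" for N
  proof -
    have "integral {x..x+N} (\<lambda>y. (\<eta> x)\<^sup>2) \<le> integral {x..x+N} (\<lambda>y. (\<eta> y)\<^sup>2)"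
    proof (rule integral_le)
      show "(\<eta> x)\<^sup>2 \<le> (\<eta> y)\<^sup>2" if "y \<in> {x..x+N}" for y
        using mono[of y] that pos[of x] by (intro power_mono) auto
    qed (auto intro!: integral_Icc_le(1)[OF i])
    also have "\<dots> \<le> I" unfolding I_def by (rule integral_Icc_le(2)[OF i]) simp
    finally show ?thesis using that by simp
  qed
  \<comment> \<open>This length makes the left side \<bar>I\<bar> + 1, which exceeds I.\<close>
  from this[of "(\<bar>I\<bar> + 1) / (\<eta> x)\<^sup>2"] show False using pos[of x] by (simp add: divide_pos_pos)
qed

lemma derivative_nonneg: "x \<le> -1 \<Longrightarrow> 0 \<le> \<eta>' x"
  using scalar_state.derivative_nonpos[OF reflected, of "- x"] by simp

lemma linear_form_multiple:
  assumes q: "\<And>x. (q has_real_derivative q' x) (at x)" "continuous_on UNIV q'"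
    and b: "\<And>x. \<bar>q x\<bar> \<le> M" "\<And>x. \<bar>q' x\<bar> \<le> M"
  shows "(\<lambda>x. \<eta> x * q x) \<in> weighted_H1"
    "linear_form \<epsilon> \<eta> (\<lambda>x. \<eta> x * q x) \<le> \<epsilon>\<^sup>2 * (\<integral>x. (\<eta> x)\<^sup>2 * (q' x)\<^sup>2 \<partial>lborel)"
proof -
  have pq: "primitive q q'" by (rule primitive_C1[OF q])
  have cq: "continuous_on S q" for S by (rule primitive_continuous[OF pq])
  show W: "(\<lambda>x. \<eta> x * q x) \<in> weighted_H1" by (rule weighted_H1_mult_C1(1)[OF weighted q b])
  let ?g = "\<lambda>x. \<eta> x * q' x + \<eta>' x * q x"
  let ?d = "\<lambda>x. \<epsilon>\<^sup>2 * (?g x)\<^sup>2 + (x\<^sup>2 - 1 + (\<eta> x)\<^sup>2) * (\<eta> x * q x)\<^sup>2"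
  let ?k = "\<lambda>x. (\<eta> x)\<^sup>2 * (q' x)\<^sup>2"
  have p: "primitive (\<lambda>x. \<eta> x * q x) ?g" by (rule primitive_mult[OF primitive(1) pq])
  have id: "integrable lborel ?d"
    by (rule linear_form_integrable[OF weighted W weighted_H1_primitive_L2[OF W p]])
  have cd: "continuous_on UNIV ?d" by (intro continuous_intros cq q(2))
  have ck: "continuous_on UNIV ?k" by (intro continuous_intros q(2))
  have "(\<lambda>x. q' x * \<eta> x) \<in> L2_space"
    by (rule L2_bounded_mult[OF weighted_H1_L2(1)[OF weighted] borel_measurable_continuous_onI[OF q(2)] b(2)])
  then have ik: "integrable lborel ?k" by (simp add: L2_iff power_mult_distrib mult.commute)
  have "(LINT x:{-real (Suc n)..real (Suc n)}|lborel. ?d x) \<le> \<epsilon>\<^sup>2 * (\<integral>x. ?k x \<partial>lborel)" for n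
  proof -
    define R where "R = real (Suc n)"
    have R: "1 \<le> R" by (simp add: R_def)
    have "((\<lambda>x. \<epsilon>\<^sup>2 * (\<eta> x * \<eta>' x * (q x)\<^sup>2)) has_real_derivative ?d x - \<epsilon>\<^sup>2 * ?k x) (at x)" for x
    proof -
      have "((\<lambda>x. \<epsilon>\<^sup>2 * (\<eta> x * \<eta>' x * (q x)\<^sup>2)) has_real_derivative
        \<epsilon>\<^sup>2 * ((\<eta> x * \<eta>'' x + \<eta>' x * \<eta>' x) * (q x)\<^sup>2 + 2 * q x * q' x * (\<eta> x * \<eta>' x))) (at x)"
        by (auto intro!: derivative_eq_intros deriv1 deriv2 q(1) simp: algebra_simps)
      moreover have "\<epsilon>\<^sup>2 * ((\<eta> x * \<eta>'' x + \<eta>' x * \<eta>' x) * (q x)\<^sup>2 + 2 * q x * q' x * (\<eta> x * \<eta>' x))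
        = \<eta> x * (q x)\<^sup>2 * (\<epsilon>\<^sup>2 * \<eta>'' x) + \<epsilon>\<^sup>2 * ((\<eta>' x)\<^sup>2 * (q x)\<^sup>2 + 2 * q x * q' x * \<eta> x * \<eta>' x)"
        by (simp add: algebra_simps power2_eq_square)
      moreover have "\<dots> = ?d x - \<epsilon>\<^sup>2 * ?k x"
        unfolding equation by (simp add: algebra_simps power2_eq_square)
      ultimately show ?thesis by simp
    qed
    then have "primitive (\<lambda>x. \<epsilon>\<^sup>2 * (\<eta> x * \<eta>' x * (q x)\<^sup>2)) (\<lambda>x. ?d x - \<epsilon>\<^sup>2 * ?k x)"
      by (rule primitive_C1) (intro continuous_intros cd ck)
    from primitive_integral[OF this, of "-R" R] R
    have "integral {-R..R} (\<lambda>x. ?d x - \<epsilon>\<^sup>2 * ?k x) = \<epsilon>\<^sup>2 * (\<eta> R * \<eta>' R * (q R)\<^sup>2) - \<epsilon>\<^sup>2 * (\<eta> (-R) * \<eta>' (-R) * (q (-R))\<^sup>2)"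
      by simp
    also have "\<dots> \<le> 0"
    proof -
      have "\<eta> R * \<eta>' R * (q R)\<^sup>2 \<le> 0" "0 \<le> \<eta> (-R) * \<eta>' (-R) * (q (-R))\<^sup>2"
        using derivative_nonpos[OF R] derivative_nonneg[of "-R"] R pos[of R] pos[of "-R"]
        by (simp_all add: mult_nonneg_nonpos mult_nonpos_nonneg)
      then have "\<epsilon>\<^sup>2 * (\<eta> R * \<eta>' R * (q R)\<^sup>2) \<le> 0" "0 \<le> \<epsilon>\<^sup>2 * (\<eta> (-R) * \<eta>' (-R) * (q (-R))\<^sup>2)"
        by (simp_all add: mult_nonneg_nonpos)
      then show ?thesis by linarith
    qed
    also have "integral {-R..R} (\<lambda>x. ?d x - \<epsilon>\<^sup>2 * ?k x) = integral {-R..R} ?d - integral {-R..R} (\<lambda>x. \<epsilon>\<^sup>2 * ?k x)"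
      by (intro Henstock_Kurzweil_Integration.integral_diff integrable_continuous_interval continuous_intros
          continuous_on_subset[OF cd] continuous_on_subset[OF ck]) auto
    finally have "integral {-R..R} ?d \<le> integral {-R..R} (\<lambda>x. \<epsilon>\<^sup>2 * ?k x)" by simp
    also have "\<dots> \<le> (\<integral>x. \<epsilon>\<^sup>2 * ?k x \<partial>lborel)"
      by (rule integral_Icc_le(2)) (use ik in auto)
    also have "\<dots> = \<epsilon>\<^sup>2 * (\<integral>x. ?k x \<partial>lborel)" by simp
    finally show ?thesis
      using set_borel_integral_eq_integral(2)[OF set_integral_continuous_Icc[OF cd], of "-R" R]
      unfolding R_def by simp
  qed
  then show "linear_form \<epsilon> \<eta> (\<lambda>x. \<eta> x * q x) \<le> \<epsilon>\<^sup>2 * (\<integral>x. (\<eta> x)\<^sup>2 * (q' x)\<^sup>2 \<partial>lborel)"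
    unfolding linear_form_eq[OF weighted W p]
    using LIMSEQ_le_const2[OF set_integral_Icc_tendsto[OF id]] by blast
qed

text \<open>Jacobi's factorisation: with \<open>w = \<eta>'/\<eta>\<close> one has \<open>\<epsilon>\<^sup>2(w' + w\<^sup>2) = x\<^sup>2 - 1 + \<eta>\<^sup>2\<close>, which turns the form
  into \<open>\<integral> \<epsilon>\<^sup>2(a' - w a)\<^sup>2\<close> up to a boundary term; the cutoff \<open>1 - x\<^sup>2/N\<^sup>2\<close> on \<open>[-N,N]\<close> removes the
  latter without any information on the decay of \<open>\<eta>\<close>.\<close>

lemma linear_form_lower:
  assumes a: "a \<in> weighted_H1" and p: "primitive a g"
  shows "(LINT x:{-1..1}|lborel. \<epsilon>\<^sup>2 * (g x - \<eta>' x / \<eta> x * a x)\<^sup>2) \<le> linear_form \<epsilon> \<eta> a"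
proof -
  note g = weighted_H1_primitive_L2[OF a p]
  have ne: "\<eta> x \<noteq> 0" for x using pos[of x] by simp
  define w where "w x = \<eta>' x / \<eta> x" for x
  define V where "V x = x\<^sup>2 - 1 + (\<eta> x)\<^sup>2" for x
  define w' where "w' x = V x / \<epsilon>\<^sup>2 - (w x)\<^sup>2" for x
  have dw: "(w has_real_derivative w' x) (at x)" for x
  proof -
    have "(w has_real_derivative (\<eta>'' x * \<eta> x - \<eta>' x * \<eta>' x) / (\<eta> x * \<eta> x)) (at x)"
      unfolding w_def[abs_def] by (rule DERIV_divide[OF deriv2 deriv1 ne])
    moreover have "(\<eta>'' x * \<eta> x - \<eta>' x * \<eta>' x) / (\<eta> x * \<eta> x) = w' x"
      unfolding w'_def w_def V_def second_derivative_eq using ne[of x] \<epsilon>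
      by (simp add: field_simps power2_eq_square)
    ultimately show ?thesis by simp
  qed
  have cw: "continuous_on UNIV w" unfolding w_def[abs_def] using ne by (intro continuous_intros) auto
  have cV: "continuous_on UNIV V" unfolding V_def[abs_def] by (intro continuous_intros)
  have cw': "continuous_on UNIV w'" unfolding w'_def[abs_def] using \<epsilon> by (intro continuous_intros cw cV) auto
  have pw: "primitive w w'" by (rule primitive_C1[OF dw cw'])
  have [measurable]: "a \<in> borel_measurable borel" "g \<in> borel_measurable borel" "w \<in> borel_measurable borel"
    "w' \<in> borel_measurable borel" "V \<in> borel_measurable borel"
    using primitive_borel[OF p] primitive_measurable[OF p] cw cV cw' borel_measurable_continuous_onI by auto
  define c where "c n x = 1 - x\<^sup>2 / (real (Suc n))\<^sup>2" for n x
  define c' where "c' n x = - 2 * x / (real (Suc n))\<^sup>2" for n x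
  have pc: "primitive (c n) (c' n)" for n
  proof (rule primitive_C1)
    show "(c n has_real_derivative c' n x) (at x)" for x
      unfolding c_def[abs_def] c'_def
      by (rule DERIV_cong[OF DERIV_diff[OF DERIV_const DERIV_cdivide[OF DERIV_power[OF DERIV_ident]]]]) simp
    show "continuous_on UNIV (c' n)" unfolding c'_def[abs_def] by (intro continuous_intros) simp
  qed
  have [measurable]: "c n \<in> borel_measurable borel" "c' n \<in> borel_measurable borel" for n
    using primitive_borel[OF pc] primitive_measurable[OF pc] by auto
  define A where "A n x = a x * c n x" for n x
  define G where "G n x = a x * c' n x + g x * c n x" for n x
  have [measurable]: "A n \<in> borel_measurable borel" "G n \<in> borel_measurable borel" for n
    unfolding A_def[abs_def] G_def[abs_def] by measurable
  have pA: "primitive (A n) (G n)" for n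
    unfolding A_def[abs_def] G_def[abs_def] by (rule primitive_mult[OF p pc])
  have cb: "\<bar>c n x\<bar> \<le> 1" "\<bar>c' n x\<bar> \<le> 2" if "x \<in> {-real (Suc n)..real (Suc n)}" for n x
  proof -
    have ax: "\<bar>x\<bar> \<le> real (Suc n)" using that by auto
    then have "\<bar>x\<bar>\<^sup>2 \<le> (real (Suc n))\<^sup>2" by (intro power_mono) auto
    then have "x\<^sup>2 / (real (Suc n))\<^sup>2 \<le> 1" by (subst divide_le_eq_1) auto
    moreover have "0 \<le> x\<^sup>2 / (real (Suc n))\<^sup>2" by simp
    ultimately show "\<bar>c n x\<bar> \<le> 1" unfolding c_def by linarith
    have "\<bar>x\<bar> * 1 \<le> real (Suc n) * real (Suc n)" using ax by (intro mult_mono) auto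
    then have "\<bar>x\<bar> \<le> (real (Suc n))\<^sup>2" by (simp add: power2_eq_square)
    then have "\<bar>x\<bar> / (real (Suc n))\<^sup>2 \<le> 1" by (subst divide_le_eq_1) auto
    moreover have "\<bar>c' n x\<bar> = 2 * (\<bar>x\<bar> / (real (Suc n))\<^sup>2)" unfolding c'_def by (simp add: abs_mult abs_divide)
    ultimately show "\<bar>c' n x\<bar> \<le> 2" by linarith
  qed
  have Ab: "\<bar>A n x\<bar> \<le> \<bar>a x\<bar>" and Gb: "\<bar>G n x\<bar> \<le> \<bar>g x\<bar> + 2 * \<bar>a x\<bar>" if "x \<in> {-real (Suc n)..real (Suc n)}" for n x
  proof -
    show "\<bar>A n x\<bar> \<le> \<bar>a x\<bar>" unfolding A_def abs_mult using cb(1)[OF that] by (simp add: mult_left_le)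
    have "\<bar>a x * c' n x\<bar> \<le> \<bar>a x\<bar> * 2" unfolding abs_mult using cb(2)[OF that] by (intro mult_left_mono) auto
    moreover have "\<bar>g x * c n x\<bar> \<le> \<bar>g x\<bar> * 1" unfolding abs_mult using cb(1)[OF that] by (intro mult_left_mono) auto
    ultimately show "\<bar>G n x\<bar> \<le> \<bar>g x\<bar> + 2 * \<bar>a x\<bar>" unfolding G_def by linarith
  qed
  have inv: "(\<lambda>n. t / (real (Suc n))\<^sup>2) \<longlonglongrightarrow> 0" for t
  proof -
    have "(\<lambda>n. t * (inverse (real (Suc n)))\<^sup>2) \<longlonglongrightarrow> t * 0\<^sup>2"
      by (intro tendsto_intros LIMSEQ_inverse_real_of_nat)
    then show ?thesis by (simp add: divide_inverse power_inverse)
  qed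
  have limc: "(\<lambda>n. c n x) \<longlonglongrightarrow> 1" "(\<lambda>n. c' n x) \<longlonglongrightarrow> 0" for x
    using tendsto_diff[OF tendsto_const[of 1] inv[of "x\<^sup>2"]] inv[of "- 2 * x"] unfolding c_def c'_def by simp_all
  have limA: "(\<lambda>n. A n x) \<longlonglongrightarrow> a x" for x
    unfolding A_def using tendsto_mult[OF tendsto_const[of "a x"] limc(1)[of x]] by simp
  have limG: "(\<lambda>n. G n x) \<longlonglongrightarrow> g x" for x
    unfolding G_def using tendsto_add[OF tendsto_mult[OF tendsto_const[of "a x"] limc(2)[of x]] tendsto_mult[OF tendsto_const[of "g x"] limc(1)[of x]]] by simp
  have i2: "integrable lborel (\<lambda>x. (\<bar>g x\<bar> + 2 * \<bar>a x\<bar>)\<^sup>2)"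
  proof -
    have abs: "(\<lambda>x. \<bar>h x\<bar>) \<in> L2_space" if "h \<in> L2_space" for h
      using that L2_measurable[OF that] by (simp add: L2_iff)
    show ?thesis
      by (intro L2_integrable_square L2_add L2_cmult abs g weighted_H1_L2[OF a])
  qed
  define W1 where "W1 x = \<epsilon>\<^sup>2 * (\<bar>g x\<bar> + 2 * \<bar>a x\<bar>)\<^sup>2 + (x\<^sup>2 + 1 + (\<eta> x)\<^sup>2) * (a x)\<^sup>2" for x
  have iW1: "integrable lborel W1"
  proof -
    have "integrable lborel (\<lambda>x. \<epsilon>\<^sup>2 * (\<bar>g x\<bar> + 2 * \<bar>a x\<bar>)\<^sup>2 + (x\<^sup>2 * (a x)\<^sup>2 + (a x)\<^sup>2 + (\<eta> x)\<^sup>2 * (a x)\<^sup>2))"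
      using i2 weighted_H1_integrable[OF a a] weighted_H1_integrable(5)[OF weighted a] by simp
    then show ?thesis by (rule back_subst[of "integrable lborel"]) (auto simp: W1_def algebra_simps)
  qed
  define d where "d n x = \<epsilon>\<^sup>2 * (G n x)\<^sup>2 + V x * (A n x)\<^sup>2" for n x
  have [measurable]: "d n \<in> borel_measurable borel" for n unfolding d_def[abs_def] by measurable
  have db: "\<bar>d n x\<bar> \<le> W1 x" if x: "x \<in> {-real (Suc n)..real (Suc n)}" for n x
  proof -
    have "\<bar>G n x\<bar>\<^sup>2 \<le> (\<bar>g x\<bar> + 2 * \<bar>a x\<bar>)\<^sup>2" "\<bar>A n x\<bar>\<^sup>2 \<le> \<bar>a x\<bar>\<^sup>2"
      by (intro power_mono Gb[OF x] Ab[OF x] abs_ge_zero)+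
    then have G2: "(G n x)\<^sup>2 \<le> (\<bar>g x\<bar> + 2 * \<bar>a x\<bar>)\<^sup>2" and A2: "(A n x)\<^sup>2 \<le> (a x)\<^sup>2" by simp_all
    have V: "\<bar>V x\<bar> \<le> x\<^sup>2 + 1 + (\<eta> x)\<^sup>2"
      unfolding V_def using zero_le_power2[of x] zero_le_power2[of "\<eta> x"] by linarith
    have "\<bar>d n x\<bar> \<le> \<bar>\<epsilon>\<^sup>2 * (G n x)\<^sup>2\<bar> + \<bar>V x * (A n x)\<^sup>2\<bar>" unfolding d_def by (rule abs_triangle_ineq)
    also have "\<dots> = \<epsilon>\<^sup>2 * (G n x)\<^sup>2 + \<bar>V x\<bar> * (A n x)\<^sup>2" by (simp add: abs_mult)
    also have "\<dots> \<le> W1 x" unfolding W1_def by (intro add_mono mult_mono G2 A2 V) auto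
    finally show ?thesis .
  qed
  have l1: "(\<lambda>n. \<integral>x. indicator {-real (Suc n)..real (Suc n)} x * d n x \<partial>lborel) \<longlonglongrightarrow> (\<integral>x. \<epsilon>\<^sup>2 * (g x)\<^sup>2 + V x * (a x)\<^sup>2 \<partial>lborel)"
  proof (rule integral_dominated_convergence[OF _ _ iW1])
    show "AE x in lborel. (\<lambda>n. indicator {-real (Suc n)..real (Suc n)} x * d n x) \<longlonglongrightarrow> \<epsilon>\<^sup>2 * (g x)\<^sup>2 + V x * (a x)\<^sup>2"
    proof (rule AE_I2)
      fix x
      obtain N where "\<bar>x\<bar> \<le> real N" using real_arch_simple by blast
      then have ev: "\<forall>\<^sub>F n in sequentially. d n x = indicator {-real (Suc n)..real (Suc n)} x * d n x"
        by (intro eventually_sequentiallyI[of N]) (auto simp: indicator_def)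
      have "(\<lambda>n. d n x) \<longlonglongrightarrow> \<epsilon>\<^sup>2 * (g x)\<^sup>2 + V x * (a x)\<^sup>2"
        unfolding d_def by (intro tendsto_intros limA limG)
      then show "(\<lambda>n. indicator {-real (Suc n)..real (Suc n)} x * d n x) \<longlonglongrightarrow> \<epsilon>\<^sup>2 * (g x)\<^sup>2 + V x * (a x)\<^sup>2"
        by (rule Lim_transform_eventually[OF _ ev])
    qed
    show "AE x in lborel. norm (indicator {-real (Suc n)..real (Suc n)} x * d n x) \<le> W1 x" for n
    proof (rule AE_I2)
      fix x
      have "0 \<le> W1 x" unfolding W1_def by simp
      then show "norm (indicator {-real (Suc n)..real (Suc n)} x * d n x) \<le> W1 x"
        using db[of x n] by (cases "x \<in> {-real (Suc n)..real (Suc n)}") auto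
    qed
  qed measurable
  define r where "r n x = \<epsilon>\<^sup>2 * (G n x - w x * A n x)\<^sup>2" for n x
  have [measurable]: "r n \<in> borel_measurable borel" for n unfolding r_def[abs_def] by measurable
  \<comment> \<open>No global bound on w is available. The square is nonnegative, so it suffices to
    keep its integral over [-1, 1], where w is bounded by compactness.\<close>
  have bw: "bounded (w ` {-1..1})"
    by (intro compact_imp_bounded compact_continuous_image continuous_on_subset[OF cw]) auto
  obtain C where C: "\<forall>x\<in>{-1..1}. \<bar>w x\<bar> \<le> C"
    using bw by (auto simp: bounded_iff)
  define W2 where "W2 x = \<epsilon>\<^sup>2 * (2 * (\<bar>g x\<bar> + 2 * \<bar>a x\<bar>)\<^sup>2 + 2 * (C\<^sup>2 * (a x)\<^sup>2))" for x
  have iW2: "integrable lborel W2"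
    unfolding W2_def[abs_def] using i2 weighted_H1_integrable(1)[OF a a] by simp
  have l2: "(\<lambda>n. \<integral>x. indicator {-1..1} x *\<^sub>R r n x \<partial>lborel) \<longlonglongrightarrow> (\<integral>x. indicator {-1..1} x *\<^sub>R (\<epsilon>\<^sup>2 * (g x - w x * a x)\<^sup>2) \<partial>lborel)"
  proof (rule integral_dominated_convergence[OF _ _ iW2])
    show "AE x in lborel. (\<lambda>n. indicator {-1..1} x *\<^sub>R r n x) \<longlonglongrightarrow> indicator {-1..1} x *\<^sub>R (\<epsilon>\<^sup>2 * (g x - w x * a x)\<^sup>2)"
      unfolding r_def by (intro AE_I2 tendsto_intros limA limG)
    show "AE x in lborel. norm (indicator {-1..1} x *\<^sub>R r n x) \<le> W2 x" for n
    proof (rule AE_I2)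
      fix x
      show "norm (indicator {-1..1} x *\<^sub>R r n x) \<le> W2 x"
      proof (cases "x \<in> {-1..1::real}")
        case True
        then have x: "x \<in> {-real (Suc n)..real (Suc n)}" by auto
        have "\<bar>G n x\<bar>\<^sup>2 \<le> (\<bar>g x\<bar> + 2 * \<bar>a x\<bar>)\<^sup>2" "\<bar>A n x\<bar>\<^sup>2 \<le> \<bar>a x\<bar>\<^sup>2" "\<bar>w x\<bar>\<^sup>2 \<le> C\<^sup>2"
          using C True by (intro power_mono Gb[OF x] Ab[OF x] abs_ge_zero; simp)+
        then have G2: "(G n x)\<^sup>2 \<le> (\<bar>g x\<bar> + 2 * \<bar>a x\<bar>)\<^sup>2" and wA: "(w x * A n x)\<^sup>2 \<le> C\<^sup>2 * (a x)\<^sup>2"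
          by (simp_all add: power_mult_distrib mult_mono)
        have "(G n x - w x * A n x)\<^sup>2 \<le> 2 * (G n x)\<^sup>2 + 2 * (w x * A n x)\<^sup>2"
          using zero_le_power2[of "G n x + w x * A n x"] by (simp add: power2_diff power2_sum)
        also have "\<dots> \<le> 2 * (\<bar>g x\<bar> + 2 * \<bar>a x\<bar>)\<^sup>2 + 2 * (C\<^sup>2 * (a x)\<^sup>2)" using G2 wA by linarith
        finally have "r n x \<le> W2 x" unfolding r_def W2_def by (intro mult_left_mono) auto
        then show ?thesis using True by (simp add: r_def)
      qed (simp add: W2_def)
    qed
  qed measurable
  have le: "(\<integral>x. indicator {-1..1} x *\<^sub>R r n x \<partial>lborel) \<le> (\<integral>x. indicator {-real (Suc n)..real (Suc n)} x * d n x \<partial>lborel)" for n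
  proof -
    define S where "S = {-real (Suc n)..real (Suc n)}"
    have m: "indicator S x *\<^sub>R d n x = indicator S x * d n x" for x by simp
    have sd: "set_integrable lborel S (d n)"
      unfolding set_integrable_def
    proof (rule Bochner_Integration.integrable_bound[OF iW1])
      show "AE x in lborel. norm (indicator S x *\<^sub>R d n x) \<le> norm (W1 x)"
      proof (rule AE_I2)
        fix x
        show "norm (indicator S x *\<^sub>R d n x) \<le> norm (W1 x)"
          using db[of x n] unfolding S_def by (cases "x \<in> {-real (Suc n)..real (Suc n)}") auto
      qed
    qed (simp add: S_def)
    \<comment> \<open>The square \<open>r n\<close> and the density \<open>d n\<close> differ by the
      exact derivative of \<epsilon>^2 A^2 w, whose integral vanishes because the cutoff is 0 at
      both ends of the window.\<close>
    have pB: "primitive (\<lambda>x. \<epsilon>\<^sup>2 * (A n x * A n x * w x)) (\<lambda>x. \<epsilon>\<^sup>2 * (A n x * A n x * w' x + (A n x * G n x + G n x * A n x) * w x))"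
      by (intro primitive_cmult primitive_mult pA pw)
    have sB: "set_integrable lborel S (\<lambda>x. \<epsilon>\<^sup>2 * (A n x * A n x * w' x + (A n x * G n x + G n x * A n x) * w x))"
      unfolding S_def by (rule primitive_set_integrable[OF pB])
    have "(LINT x:S|lborel. \<epsilon>\<^sup>2 * (A n x * A n x * w' x + (A n x * G n x + G n x * A n x) * w x)) = 0"
    proof -
      have "c n (real (Suc n)) = 0" "c n (- real (Suc n)) = 0" unfolding c_def power2_minus by simp_all
      then show ?thesis
        using primitive_integral[OF pB, of "-real (Suc n)" "real (Suc n)"]
        unfolding set_borel_integral_eq_integral(2)[OF sB] S_def[symmetric] by (simp add: A_def)
    qed
    moreover have rd: "r n x = d n x - \<epsilon>\<^sup>2 * (A n x * A n x * w' x + (A n x * G n x + G n x * A n x) * w x)" for x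
      unfolding r_def d_def w'_def using \<epsilon> by (simp add: field_simps power2_eq_square)
    moreover have sr: "set_integrable lborel S (r n)"
      unfolding rd using sd sB by (rule set_integral_diff(1))
    ultimately have "(LINT x:S|lborel. r n x) = (LINT x:S|lborel. d n x)"
      unfolding rd using set_integral_diff(2)[OF sd sB] by simp
    moreover have "(\<integral>x. indicator {-1..1} x *\<^sub>R r n x \<partial>lborel) \<le> (LINT x:S|lborel. r n x)"
      unfolding set_lebesgue_integral_def
    proof (rule integral_mono)
      show "integrable lborel (\<lambda>x. indicator S x *\<^sub>R r n x)" using sr by (simp only: set_integrable_def)
      show "integrable lborel (\<lambda>x. indicator {-1..1} x *\<^sub>R r n x)"
        using set_integrable_subset[OF sr, of "{-1..1}"] by (simp add: set_integrable_def S_def)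
      show "indicator {-1..1} x *\<^sub>R r n x \<le> indicator S x *\<^sub>R r n x" for x
        by (auto simp: indicator_def S_def r_def)
    qed
    ultimately show ?thesis by (simp add: set_lebesgue_integral_def S_def)
  qed
  have "(\<integral>x. indicator {-1..1} x *\<^sub>R (\<epsilon>\<^sup>2 * (g x - w x * a x)\<^sup>2) \<partial>lborel) \<le> (\<integral>x. \<epsilon>\<^sup>2 * (g x)\<^sup>2 + V x * (a x)\<^sup>2 \<partial>lborel)"
    by (rule LIMSEQ_le[OF l2 l1]) (use le in blast)
  then show ?thesis
    unfolding linear_form_eq[OF weighted a p] set_lebesgue_integral_def w_def V_def .
qed

lemma linear_form_nonneg:
  assumes a: "a \<in> weighted_H1" shows "0 \<le> linear_form \<epsilon> \<eta> a"
proof -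
  have "0 \<le> (LINT x:{-1..1}|lborel. \<epsilon>\<^sup>2 * (weak_deriv a x - \<eta>' x / \<eta> x * a x)\<^sup>2)"
    unfolding set_lebesgue_integral_def by (intro Bochner_Integration.integral_nonneg) simp
  then show ?thesis using linear_form_lower[OF a weak_deriv(1)[OF a]] by linarith
qed

text \<open>The constant q = 1 in the ground state substitution gives the upper bound 0, which meets
  nonnegativity.\<close>

lemma linear_form_self: "linear_form \<epsilon> \<eta> \<eta> = 0"
proof -
  have "linear_form \<epsilon> \<eta> (\<lambda>x. \<eta> x * 1) \<le> \<epsilon>\<^sup>2 * (\<integral>x. (\<eta> x)\<^sup>2 * 0\<^sup>2 \<partial>lborel)"
    by (rule linear_form_multiple(2)[where M = 1]) auto
  then show ?thesis using linear_form_nonneg[OF weighted] by simp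
qed

text \<open>By the sign of \<eta>' outside [-1, 1] the maximum over that interval is global. There
  \<eta>'' \<le> 0, and the equation gives \<eta>^2 \<le> 1 - z^2 at the maximum point z.\<close>

lemma le_one: "\<eta> x \<le> 1"
proof -
  have "\<exists>x\<in>{-1..1}. \<forall>y\<in>{-1..1}. \<eta> y \<le> \<eta> x"
    by (rule continuous_attains_sup) (auto intro: continuous)
  then obtain z where z: "z \<in> {-1..1}" "\<And>y. y \<in> {-1..1} \<Longrightarrow> \<eta> y \<le> \<eta> z" by blast
  have max: "\<eta> y \<le> \<eta> z" for y
  proof -
    consider "y < -1" | "y \<in> {-1..1}" | "1 < y" by fastforce
    then show ?thesis
    proof cases
      case 1
      have "\<eta> y \<le> \<eta> (-1)"
      proof (rule DERIV_nonneg_imp_nondecreasing[where f = \<eta> and a = y and b = "-1"])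
        show "y \<le> -1" using 1 by simp
        show "\<exists>D. (\<eta> has_real_derivative D) (at t) \<and> 0 \<le> D" if "t \<le> -1" for t
          using deriv1[of t] derivative_nonneg[OF that] by blast
      qed
      then show ?thesis using z(2)[of "-1"] by simp
    next
      case 3
      have "\<eta> y \<le> \<eta> 1"
      proof (rule DERIV_nonpos_imp_nonincreasing[where f = \<eta> and a = 1 and b = y])
        show "1 \<le> y" using 3 by simp
        show "\<exists>D. (\<eta> has_real_derivative D) (at t) \<and> D \<le> 0" if "1 \<le> t" for t
          using deriv1[of t] derivative_nonpos[OF that] by blast
      qed
      then show ?thesis using z(2)[of 1] by simp
    qed (use z in auto)
  qed
  have d0: "\<eta>' z = 0"
    by (rule DERIV_local_max[OF deriv1, of 1]) (use max in auto)
  have "\<eta>'' z \<le> 0"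
  proof (rule ccontr)
    assume "\<not> \<eta>'' z \<le> 0"
    then obtain d where d: "d > 0" "\<And>h. 0 < h \<Longrightarrow> h < d \<Longrightarrow> \<eta>' z < \<eta>' (z + h)"
      using DERIV_pos_inc_right[OF deriv2, of z] by auto
    have "\<eta> z < \<eta> (z + d/2)"
    proof (rule DERIV_pos_imp_increasing_open[where f = \<eta> and a = z and b = "z + d/2"])
      show "z < z + d/2" using d(1) by simp
      show "\<exists>y. (\<eta> has_real_derivative y) (at x) \<and> 0 < y" if "z < x" "x < z + d/2" for x
        using d(2)[of "x - z"] that d(1) d0 deriv1[of x] by auto
    qed (rule continuous)
    then show False using max[of "z + d/2"] by simp
  qed
  then have "(z\<^sup>2 - 1 + (\<eta> z)\<^sup>2) * \<eta> z \<le> 0"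
    using equation[of z] \<epsilon> by (metis mult_nonneg_nonpos zero_le_power2)
  then have "z\<^sup>2 - 1 + (\<eta> z)\<^sup>2 \<le> 0" using pos[of z] by (simp add: mult_le_0_iff)
  then have "(\<eta> z)\<^sup>2 \<le> 1" using zero_le_power2[of z] by linarith
  then have "\<eta> z \<le> 1" by (intro power2_le_imp_le[of "\<eta> z" 1]) simp_all
  then show ?thesis using max[of x] by simp
qed

lemma sym_energy_0_self: "sym_energy \<epsilon> 0 \<eta> = - 1/2 * (\<integral>x. (\<eta> x)^4 \<partial>lborel)"
  using sym_energy_0_eq[OF weighted weighted, of \<epsilon>] linear_form_self by simp

text \<open>Since the form vanishes at \<eta>, the integral of x^2 \<eta>^2 is at most that of
  \<eta>^2, called I. Using \<eta> \<le> 1 on [-2, 2] and \<eta>^2 \<le> x^2 \<eta>^2 / 4 outside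
  gives I \<le> 4 + I/4.\<close>

lemma integral_square_le: "(\<integral>x. (\<eta> x)\<^sup>2 \<partial>lborel) \<le> 16/3"
proof -
  note i = weighted_H1_integrable[OF weighted weighted]
  define I where "I = (\<integral>x. (\<eta> x)\<^sup>2 \<partial>lborel)"
  have "(\<integral>x. x\<^sup>2 * (\<eta> x)\<^sup>2 \<partial>lborel) - I
      = (\<integral>x. x\<^sup>2 * (\<eta> x)\<^sup>2 - (\<eta> x)\<^sup>2 \<partial>lborel)"
    unfolding I_def using i by simp
  also have "\<dots> \<le> linear_form \<epsilon> \<eta> \<eta>"
    unfolding linear_form_def
  proof (rule integral_mono)
    show "integrable lborel (\<lambda>x. x\<^sup>2 * (\<eta> x)\<^sup>2 - (\<eta> x)\<^sup>2)" using i by simp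
    show "integrable lborel (\<lambda>x. \<epsilon>\<^sup>2 * (weak_deriv \<eta> x)\<^sup>2 + (x\<^sup>2 - 1 + (\<eta> x)\<^sup>2) * (\<eta> x)\<^sup>2)"
      by (rule linear_form_integrable[OF weighted weighted weak_deriv(2)[OF weighted]])
    show "x\<^sup>2 * (\<eta> x)\<^sup>2 - (\<eta> x)\<^sup>2 \<le> \<epsilon>\<^sup>2 * (weak_deriv \<eta> x)\<^sup>2 + (x\<^sup>2 - 1 + (\<eta> x)\<^sup>2) * (\<eta> x)\<^sup>2" for x
      by (simp add: algebra_simps)
  qed
  finally have 1: "(\<integral>x. x\<^sup>2 * (\<eta> x)\<^sup>2 \<partial>lborel) \<le> I" by (simp add: linear_form_self)
  have j: "integrable lborel (indicator {-2..2::real} :: real \<Rightarrow> real)"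
    by (rule integrable_real_indicator) auto
  have "I \<le> (\<integral>x. indicator {-2..2} x + 1/4 * (x\<^sup>2 * (\<eta> x)\<^sup>2) \<partial>lborel)"
    unfolding I_def
  proof (rule integral_mono)
    show "integrable lborel (\<lambda>x. indicator {-2..2} x + 1/4 * (x\<^sup>2 * (\<eta> x)\<^sup>2))" using i j by simp
    fix x :: real
    show "(\<eta> x)\<^sup>2 \<le> indicator {-2..2} x + 1/4 * (x\<^sup>2 * (\<eta> x)\<^sup>2)"
    proof (cases "x \<in> {-2..2}")
      case True
      have "(\<eta> x)\<^sup>2 \<le> 1" using le_one[of x] pos[of x] by (simp add: power_le_one)
      then show ?thesis using True by (simp add: add_increasing2)
    next
      case False
      then have "2 \<le> \<bar>x\<bar>" by auto
      then have "2\<^sup>2 \<le> \<bar>x\<bar>\<^sup>2" by (intro power_mono) auto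
      then have "4 * (\<eta> x)\<^sup>2 \<le> x\<^sup>2 * (\<eta> x)\<^sup>2" by (intro mult_right_mono) auto
      then show ?thesis using False by simp
    qed
  qed (use i in auto)
  also have "\<dots> = 4 + 1/4 * (\<integral>x. x\<^sup>2 * (\<eta> x)\<^sup>2 \<partial>lborel)" using i j by simp
  finally show ?thesis using 1 unfolding I_def by linarith
qed

text \<open>The tent cannot have less energy than \<eta>, whose energy is minus half of this
  integral. At \<epsilon> \<le> 1/4 the tent has energy at most 1/8 - 2/5 < -1/4.\<close>

lemma integral_fourth_power_ge:
  assumes "\<epsilon> \<le> 1/4" shows "1/2 \<le> (\<integral>x. (\<eta> x)^4 \<partial>lborel)"
proof -
  have T: "tent (-1) 0 1 \<in> weighted_H1" by (rule tent_weighted_H1) auto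
  have "0 \<le> (\<integral>x. ((\<eta> x)\<^sup>2 - (tent (-1) 0 1 x)\<^sup>2)\<^sup>2 \<partial>lborel)" by simp
  then have "- 1/2 * (\<integral>x. (\<eta> x)^4 \<partial>lborel) \<le> sym_energy \<epsilon> 0 (tent (-1) 0 1)"
    using sym_energy_0_eq[OF weighted T, of \<epsilon>] linear_form_nonneg[OF T] by linarith
  also have "\<dots> = 2 * \<epsilon>\<^sup>2 - 2/5" by (rule tent_trial_energy)
  also have "\<epsilon>\<^sup>2 \<le> (1/4)\<^sup>2" using \<epsilon> assms by (intro power_mono) auto
  finally show ?thesis by (simp add: power2_eq_square)
qed

end

text \<open>Each positive solution minimises the scalar energy, with a quantitative remainder; comparing
  two solutions in both directions forces equality.\<close>

lemma scalar_state_unique: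
  assumes "scalar_state \<epsilon> \<eta> \<eta>' \<eta>''" "scalar_state \<epsilon> \<zeta> \<zeta>' \<zeta>''"
  shows "\<eta> = \<zeta>"
proof -
  interpret a: scalar_state \<epsilon> \<eta> \<eta>' \<eta>'' by fact
  interpret b: scalar_state \<epsilon> \<zeta> \<zeta>' \<zeta>'' by fact
  define I where "I = (\<integral>x. ((\<eta> x)\<^sup>2 - (\<zeta> x)\<^sup>2)\<^sup>2 \<partial>lborel)"
  have "(\<integral>x. ((\<zeta> x)\<^sup>2 - (\<eta> x)\<^sup>2)\<^sup>2 \<partial>lborel) = I"
    unfolding I_def by (simp add: power2_commute)
  \<comment> \<open>Adding the two energy identities cancels both energies against the fourth-power
    integrals. What remains is I plus two nonnegative forms, with sum 0.\<close>
  then have I: "I \<le> 0"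
    using sym_energy_0_eq[OF a.weighted b.weighted, of \<epsilon>] sym_energy_0_eq[OF b.weighted a.weighted, of \<epsilon>]
      a.linear_form_nonneg[OF b.weighted] b.linear_form_nonneg[OF a.weighted]
      a.sym_energy_0_self b.sym_energy_0_self unfolding I_def by linarith
  have "integrable lborel (\<lambda>x. (\<eta> x * \<eta> x - \<zeta> x * \<zeta> x)\<^sup>2)"
    by (intro L2_integrable_square L2_diff weighted_H1_mult_L2 a.weighted b.weighted)
  then have i: "integrable lborel (\<lambda>x. ((\<eta> x)\<^sup>2 - (\<zeta> x)\<^sup>2)\<^sup>2)" by (simp add: power2_eq_square)
  have "((\<eta> x)\<^sup>2 - (\<zeta> x)\<^sup>2)\<^sup>2 = 0" for x
    by (rule continuous_integral_zero[OF _ _ i]) (use I in \<open>auto simp: I_def intro!: continuous_intros a.continuous b.continuous\<close>)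
  then have "(\<eta> x)\<^sup>2 = (\<zeta> x)\<^sup>2" for x by simp
  then show ?thesis
    using a.pos b.pos by (intro ext) (metis less_imp_le power2_eq_imp_eq)
qed

lemma (in scalar_state) even: "\<eta> (- x) = \<eta> x"
  using scalar_state_unique[OF reflected scalar_state_axioms] by metis

section \<open>The bifurcation threshold\<close>

definition odd_functions :: "(real \<Rightarrow> real) set" where
  "odd_functions = {b \<in> weighted_H1. \<forall>x. b (- x) = - b x}"

definition weighted_norm2 :: "(real \<Rightarrow> real) \<Rightarrow> (real \<Rightarrow> real) \<Rightarrow> real" where
  "weighted_norm2 \<eta> b = (\<integral>x. (\<eta> x)\<^sup>2 * (b x)\<^sup>2 \<partial>lborel)"

text \<open>The condition on the norm keeps out b = 0, which would contribute the value 0 by the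
  convention on division by zero.\<close>

definition rayleigh_infimum :: "real \<Rightarrow> (real \<Rightarrow> real) \<Rightarrow> real" where
  "rayleigh_infimum \<epsilon> \<eta> = Inf {linear_form \<epsilon> \<eta> b / weighted_norm2 \<eta> b |b. b \<in> odd_functions \<and> 0 < weighted_norm2 \<eta> b}"

text \<open>Expand the nonnegative integral of (\<bar>h\<bar> - A/2)^2, where A/2 is the mean of
  \<bar>h\<bar> over an interval of length 2.\<close>

lemma interval_cauchy_schwarz:
  fixes h :: "real \<Rightarrow> real"
  assumes h: "set_integrable lborel {-1..1} (\<lambda>x. \<bar>h x\<bar>)" and h2: "set_integrable lborel {-1..1} (\<lambda>x. (h x)\<^sup>2)"
  shows "(LINT x:{-1..1}|lborel. \<bar>h x\<bar>)\<^sup>2 \<le> 2 * (LINT x:{-1..1}|lborel. (h x)\<^sup>2)"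
proof -
  define A where "A = (LINT x:{-1..1}|lborel. \<bar>h x\<bar>)"
  have c: "set_integrable lborel {-1..1::real} (\<lambda>x. (A/2)\<^sup>2)" by (rule set_integral_continuous_Icc) simp
  have m: "set_integrable lborel {-1..1} (\<lambda>x. A * \<bar>h x\<bar>)" using h by simp
  have "0 \<le> (LINT x:{-1..1}|lborel. (\<bar>h x\<bar> - A/2)\<^sup>2)"
    unfolding set_lebesgue_integral_def by (intro Bochner_Integration.integral_nonneg) simp
  also have "\<dots> = (LINT x:{-1..1}|lborel. ((h x)\<^sup>2 - A * \<bar>h x\<bar>) + (A/2)\<^sup>2)"
    by (simp add: power2_diff algebra_simps)
  also have "\<dots> = (LINT x:{-1..1}|lborel. (h x)\<^sup>2) - A * A + 2 * (A/2)\<^sup>2"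
  proof -
    have "(LINT x:{-1..1::real}|lborel. (A/2)\<^sup>2) = 2 * (A/2)\<^sup>2"
      using set_borel_integral_eq_integral(2)[OF c] by simp
    then show ?thesis
      using set_integral_add(2)[OF set_integral_diff(1)[OF h2 m] c] set_integral_diff(2)[OF h2 m]
      by (simp add: A_def)
  qed
  finally show ?thesis unfolding A_def[symmetric] by (simp add: power2_eq_square field_simps)
qed

context scalar_state
begin

lemma norm2_integrable: "b \<in> weighted_H1 \<Longrightarrow> integrable lborel (\<lambda>x. (\<eta> x)\<^sup>2 * (b x)\<^sup>2)"
  by (rule weighted_H1_integrable(5)[OF weighted])

lemma norm2_nonneg: "0 \<le> weighted_norm2 \<eta> b"
  unfolding weighted_norm2_def by simp

text \<open>A function vanishing at the origin is controlled on \<open>[-1,1]\<close> by the factorised form,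
  and outside the potential dominates \<open>\<eta>\<^sup>2\<close>.\<close>

lemma linear_form_coercive:
  "\<exists>c>0. \<forall>b\<in>weighted_H1. b 0 = 0 \<longrightarrow> c * weighted_norm2 \<eta> b \<le> linear_form \<epsilon> \<eta> b"
proof -
  have "\<exists>z\<in>{-1..1}. \<forall>y\<in>{-1..1}. \<eta> z \<le> \<eta> y"
    by (rule continuous_attains_inf) (auto intro: continuous)
  then obtain z where z: "\<And>y. y \<in> {-1..1} \<Longrightarrow> \<eta> z \<le> \<eta> y" by blast
  define m where "m = \<eta> z"
  have m: "0 < m" "\<And>y. y \<in> {-1..1} \<Longrightarrow> m \<le> \<eta> y" unfolding m_def using pos z by auto
  \<comment> \<open>On [-1, 1] the negative part of the potential is compensated by the constant
    4J/m^2, where J is the integral of h^2. Over length 2 this costs 8J/m^2, and \<epsilon>^2 J is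
    bounded by the form.\<close>
  define K where "K = 1 + 8 / (m\<^sup>2 * \<epsilon>\<^sup>2)"
  have K: "0 < K" unfolding K_def using m(1) \<epsilon> by (intro add_pos_pos) auto
  have main: "weighted_norm2 \<eta> b \<le> K * linear_form \<epsilon> \<eta> b" if b: "b \<in> weighted_H1" and b0: "b 0 = 0" for b
  proof -
    define g where "g = weak_deriv b"
    have p: "primitive b g" unfolding g_def by (rule weak_deriv(1)[OF b])
    note g = weighted_H1_primitive_L2[OF b p]
    have ne: "\<eta> x \<noteq> 0" for x using pos[of x] by simp
    \<comment> \<open>The factor in the lower bound for the form is h = \<eta> (b/\<eta>)'.
      Integrating h/\<eta> from the zero at the origin therefore bounds b/\<eta> on [-1, 1].\<close>
    define h where "h x = g x - \<eta>' x / \<eta> x * b x" for x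
    define J where "J = (LINT x:{-1..1}|lborel. (h x)\<^sup>2)"
    have JQ: "\<epsilon>\<^sup>2 * J \<le> linear_form \<epsilon> \<eta> b"
      using linear_form_lower[OF b p] unfolding J_def h_def by simp
    have pr: "primitive (\<lambda>x. 1 / \<eta> x) (\<lambda>x. - \<eta>' x / (\<eta> x)\<^sup>2)"
    proof (rule primitive_C1)
      show "((\<lambda>x. 1 / \<eta> x) has_real_derivative - \<eta>' x / (\<eta> x)\<^sup>2) (at x)" for x
        using ne[of x] by (auto intro!: derivative_eq_intros deriv1 simp: power2_eq_square)
      show "continuous_on UNIV (\<lambda>x. - \<eta>' x / (\<eta> x)\<^sup>2)" using ne by (intro continuous_intros) auto
    qed
    have "primitive (\<lambda>x. b x * (1 / \<eta> x)) (\<lambda>x. b x * (- \<eta>' x / (\<eta> x)\<^sup>2) + g x * (1 / \<eta> x))"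
      by (rule primitive_mult[OF p pr])
    moreover have "b x * (- \<eta>' x / (\<eta> x)\<^sup>2) + g x * (1 / \<eta> x) = h x / \<eta> x" for x
      unfolding h_def using ne[of x] by (simp add: field_simps power2_eq_square)
    ultimately have pq: "primitive (\<lambda>x. b x / \<eta> x) (\<lambda>x. h x / \<eta> x)" by simp
    have cw: "continuous_on UNIV (\<lambda>x. \<eta>' x / \<eta> x)" using ne by (intro continuous_intros) auto
    have [measurable]: "b \<in> borel_measurable borel" "g \<in> borel_measurable borel" "(\<lambda>x. \<eta>' x / \<eta> x) \<in> borel_measurable borel"
      using primitive_borel[OF p] primitive_measurable[OF p] borel_measurable_continuous_onI[OF cw] by auto
    have [measurable]: "h \<in> borel_measurable borel" unfolding h_def[abs_def] by measurable
    have hi: "set_integrable lborel {-1..1} h"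
      unfolding h_def[abs_def]
      by (intro set_integral_diff(1) primitive_set_integrable[OF p] set_integral_continuous_Icc continuous_on_mult cw primitive_continuous[OF p])
    have ha: "set_integrable lborel {-1..1} (\<lambda>x. \<bar>h x\<bar>)" by (rule set_integrable_abs_real[OF hi])
    have h2: "set_integrable lborel {-1..1} (\<lambda>x. (h x)\<^sup>2)"
    proof -
      have "bounded ((\<lambda>x. \<eta>' x / \<eta> x) ` {-1..1})"
        by (intro compact_imp_bounded compact_continuous_image continuous_on_subset[OF cw]) auto
      then obtain C where C: "\<forall>x\<in>{-1..1}. \<bar>\<eta>' x / \<eta> x\<bar> \<le> C" by (auto simp: bounded_iff)
      have "integrable lborel (\<lambda>x. 2 * (g x)\<^sup>2 + 2 * (C\<^sup>2 * (b x)\<^sup>2))"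
        using L2_integrable_square[OF g] weighted_H1_integrable(1)[OF b b] by simp
      then show ?thesis
        unfolding set_integrable_def
      proof (rule Bochner_Integration.integrable_bound)
        show "AE x in lborel. norm (indicator {-1..1} x *\<^sub>R (h x)\<^sup>2) \<le> norm (2 * (g x)\<^sup>2 + 2 * (C\<^sup>2 * (b x)\<^sup>2))"
        proof (rule AE_I2)
          fix x
          show "norm (indicator {-1..1} x *\<^sub>R (h x)\<^sup>2) \<le> norm (2 * (g x)\<^sup>2 + 2 * (C\<^sup>2 * (b x)\<^sup>2))"
          proof (cases "x \<in> {-1..1}")
            case True
            have "\<bar>\<eta>' x / \<eta> x\<bar>\<^sup>2 \<le> C\<^sup>2" using C True by (intro power_mono) auto
            then have "(\<eta>' x / \<eta> x)\<^sup>2 * (b x)\<^sup>2 \<le> C\<^sup>2 * (b x)\<^sup>2" unfolding power2_abs by (rule mult_right_mono) simp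
            then have w: "(\<eta>' x / \<eta> x * b x)\<^sup>2 \<le> C\<^sup>2 * (b x)\<^sup>2" by (simp only: power_mult_distrib)
            have "(h x)\<^sup>2 \<le> 2 * (g x)\<^sup>2 + 2 * (\<eta>' x / \<eta> x * b x)\<^sup>2"
              unfolding h_def using zero_le_power2[of "g x + \<eta>' x / \<eta> x * b x"] by (simp only: power2_diff power2_sum)
            then show ?thesis using w True by simp
          qed simp
        qed
      qed measurable
    qed
    define A where "A = (LINT x:{-1..1}|lborel. \<bar>h x\<bar>)"
    have A2: "A\<^sup>2 \<le> 2 * J" unfolding A_def J_def by (rule interval_cauchy_schwarz[OF ha h2])
    have qb: "\<bar>b x / \<eta> x\<bar> \<le> A / m" if x: "x \<in> {-1..1}" for x
    proof -
      have nb: "\<bar>integral {l..r} (\<lambda>x. h x / \<eta> x)\<bar> \<le> A / m" if lr: "-1 \<le> l" "r \<le> 1" for l r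
      proof -
        have sub: "(\<lambda>x. \<bar>h x\<bar> / m) integrable_on {l..r}" "(\<lambda>x. \<bar>h x\<bar> / m) integrable_on {-1..1}"
          using integrable_on_of_set_integrable[OF set_integrable_subset[OF ha, of "{l..r}"]] lr
            integrable_on_of_set_integrable[OF ha] by (auto intro!: integrable_on_divide)
        have "norm (integral {l..r} (\<lambda>x. h x / \<eta> x)) \<le> integral {l..r} (\<lambda>x. \<bar>h x\<bar> / m)"
        proof (rule integral_norm_bound_integral[OF primitive_integrable_on[OF pq] sub(1)])
          fix y assume "y \<in> {l..r}"
          then have "m \<le> \<eta> y" using lr by (intro m(2)) auto
          then show "norm (h y / \<eta> y) \<le> \<bar>h y\<bar> / m"
            using m(1) pos[of y] by (simp add: abs_divide frac_le)
        qed
        also have "\<dots> \<le> integral {-1..1} (\<lambda>x. \<bar>h x\<bar> / m)"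
          by (rule integral_subset_le) (use lr sub m(1) in auto)
        also have "\<dots> = A / m"
          unfolding A_def set_borel_integral_eq_integral(2)[OF ha] by simp
        finally show ?thesis by simp
      qed
      show ?thesis
      proof (cases "0 \<le> x")
        case True
        then show ?thesis using primitive_integral[OF pq, of 0 x] nb[of 0 x] x b0 by simp
      next
        case False
        then show ?thesis using primitive_integral[OF pq, of x 0] nb[of x 0] x b0 by simp
      qed
    qed
    have b2: "(b x)\<^sup>2 \<le> 2 * J / m\<^sup>2" if x: "x \<in> {-1..1}" for x
    proof -
      have "\<bar>b x\<bar> = \<bar>b x / \<eta> x\<bar> * \<eta> x" using pos[of x] by (simp add: abs_divide)
      also have "\<dots> \<le> \<bar>b x / \<eta> x\<bar> * 1" using le_one[of x] by (intro mult_left_mono) auto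
      also have "\<dots> \<le> A / m" using qb[OF x] by simp
      finally have "\<bar>b x\<bar>\<^sup>2 \<le> (A / m)\<^sup>2" by (intro power_mono) auto
      also have "\<dots> \<le> 2 * J / m\<^sup>2" unfolding power_divide using A2 by (intro divide_right_mono) auto
      finally show ?thesis by simp
    qed
    define d where "d x = \<epsilon>\<^sup>2 * (g x)\<^sup>2 + (x\<^sup>2 - 1 + (\<eta> x)\<^sup>2) * (b x)\<^sup>2" for x
    have id: "integrable lborel d" unfolding d_def[abs_def] by (rule linear_form_integrable[OF weighted b g])
    have iI: "integrable lborel (\<lambda>x. 4 * J / m\<^sup>2 * indicator {-1..1::real} x)"
      by (intro integrable_mult_right integrable_real_indicator) auto
    have "weighted_norm2 \<eta> b \<le> (\<integral>x. d x + 4 * J / m\<^sup>2 * indicator {-1..1} x \<partial>lborel)"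
      unfolding weighted_norm2_def
    proof (rule integral_mono[OF norm2_integrable[OF b]])
      show "integrable lborel (\<lambda>x. d x + 4 * J / m\<^sup>2 * indicator {-1..1} x)"
        using id iI by (rule Bochner_Integration.integrable_add)
      fix x
      show "(\<eta> x)\<^sup>2 * (b x)\<^sup>2 \<le> d x + 4 * J / m\<^sup>2 * indicator {-1..1} x"
      proof (cases "x \<in> {-1..1}")
        case True
        have "0 \<le> \<epsilon>\<^sup>2 * (g x)\<^sup>2" "0 \<le> x\<^sup>2 * (b x)\<^sup>2" by simp_all
        moreover have "d x = \<epsilon>\<^sup>2 * (g x)\<^sup>2 + x\<^sup>2 * (b x)\<^sup>2 - (b x)\<^sup>2 + (\<eta> x)\<^sup>2 * (b x)\<^sup>2"
          unfolding d_def by (simp add: algebra_simps)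
        ultimately have "(\<eta> x)\<^sup>2 * (b x)\<^sup>2 \<le> d x + 2 * (2 * J / m\<^sup>2)"
          using b2[OF True] zero_le_power2[of "b x"] by linarith
        then show ?thesis using True by simp
      next
        case False
        then have "1 \<le> \<bar>x\<bar>" by auto
        then have "1 \<le> x\<^sup>2" by (metis one_le_power power2_abs)
        then have "0 \<le> (x\<^sup>2 - 1) * (b x)\<^sup>2" by simp
        moreover have "0 \<le> \<epsilon>\<^sup>2 * (g x)\<^sup>2" by simp
        moreover have "d x = \<epsilon>\<^sup>2 * (g x)\<^sup>2 + (x\<^sup>2 - 1) * (b x)\<^sup>2 + (\<eta> x)\<^sup>2 * (b x)\<^sup>2"
          unfolding d_def by (simp add: algebra_simps)
        ultimately have "(\<eta> x)\<^sup>2 * (b x)\<^sup>2 \<le> d x" by linarith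
        then show ?thesis using False by simp
      qed
    qed
    also have "\<dots> = linear_form \<epsilon> \<eta> b + (\<integral>x. 4 * J / m\<^sup>2 * indicator {-1..1::real} x \<partial>lborel)"
      using Bochner_Integration.integral_add[OF id iI] linear_form_eq[OF weighted b p, of \<epsilon>] unfolding d_def by simp
    also have "(\<integral>x. 4 * J / m\<^sup>2 * indicator {-1..1::real} x \<partial>lborel) = 8 * J / m\<^sup>2" by simp
    also have "\<dots> \<le> 8 / (m\<^sup>2 * \<epsilon>\<^sup>2) * linear_form \<epsilon> \<eta> b"
    proof -
      have "8 * J / m\<^sup>2 = 8 / (m\<^sup>2 * \<epsilon>\<^sup>2) * (\<epsilon>\<^sup>2 * J)" using \<epsilon> by simp
      also have "\<dots> \<le> 8 / (m\<^sup>2 * \<epsilon>\<^sup>2) * linear_form \<epsilon> \<eta> b" using JQ by (intro mult_left_mono) auto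
      finally show ?thesis .
    qed
    finally show ?thesis unfolding K_def by (simp add: distrib_right)
  qed
  show ?thesis
  proof (intro exI[of _ "1/K"] conjI ballI impI)
    show "0 < 1 / K" using K by simp
    show "1 / K * weighted_norm2 \<eta> b \<le> linear_form \<epsilon> \<eta> b" if "b \<in> weighted_H1" "b 0 = 0" for b
      using main[OF that] K by (simp add: field_simps)
  qed
qed

definition "odd_trial = (\<lambda>x. \<eta> x * arctan x)"

text \<open>The arctangent is odd, bounded, and has a bounded derivative, so multiplying \<eta> by
  it stays in the space and costs only \<epsilon>^2 times an integral of \<eta>^2, whose bound is
  16/3.\<close>

lemma odd_trial:
  assumes "\<epsilon> \<le> 1/4"
  shows "odd_trial \<in> odd_functions" "linear_form \<epsilon> \<eta> odd_trial \<le> 16/3 * \<epsilon>\<^sup>2"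
    "(arctan (1/8))\<^sup>2 / 4 \<le> weighted_norm2 \<eta> odd_trial"
proof -
  have le2: "\<bar>arctan x\<bar> \<le> 2" for x
    using arctan_bounded[of x] pi_less_4 by linarith
  have "1 \<le> 1 + x\<^sup>2" for x :: real by simp
  then have inv: "inverse (1 + x\<^sup>2) \<le> 1" "0 \<le> inverse (1 + x\<^sup>2)" for x :: real
    by (simp_all add: inverse_le_1_iff)
  have pos1: "1 + x\<^sup>2 \<noteq> 0" for x :: real using zero_le_power2[of x] by linarith
  have le2': "\<bar>inverse (1 + x\<^sup>2)\<bar> \<le> 2" for x :: real using inv[of x] by linarith
  have q: "(arctan has_real_derivative inverse (1 + x\<^sup>2)) (at x)" for x by (rule DERIV_arctan)
  have cq: "continuous_on UNIV (\<lambda>x::real. inverse (1 + x\<^sup>2))" using pos1 by (intro continuous_intros) auto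
  note T = linear_form_multiple[OF q cq le2 le2', folded odd_trial_def]
  show odd: "odd_trial \<in> odd_functions"
    using T(1) by (auto simp: odd_functions_def odd_trial_def even arctan_minus)
  have i: "integrable lborel (\<lambda>x. (\<eta> x)\<^sup>2)" "integrable lborel (\<lambda>x. (\<eta> x)^4)"
    by (rule weighted_H1_integrable[OF weighted weighted])+
  have "(\<integral>x. (\<eta> x)\<^sup>2 * (inverse (1 + x\<^sup>2))\<^sup>2 \<partial>lborel) \<le> (\<integral>x. (\<eta> x)\<^sup>2 \<partial>lborel)"
  proof (rule integral_mono[OF _ i(1)])
    have "(\<lambda>x. inverse (1 + x\<^sup>2) * \<eta> x) \<in> L2_space"
      by (rule L2_bounded_mult[OF weighted_H1_L2(1)[OF weighted] borel_measurable_continuous_onI[OF cq] le2'])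
    then show "integrable lborel (\<lambda>x. (\<eta> x)\<^sup>2 * (inverse (1 + x\<^sup>2))\<^sup>2)"
      by (simp add: L2_iff power_mult_distrib mult.commute)
    show "(\<eta> x)\<^sup>2 * (inverse (1 + x\<^sup>2))\<^sup>2 \<le> (\<eta> x)\<^sup>2" for x
      using inv[of x] by (intro mult_left_le power_le_one) auto
  qed
  then have "\<epsilon>\<^sup>2 * (\<integral>x. (\<eta> x)\<^sup>2 * (inverse (1 + x\<^sup>2))\<^sup>2 \<partial>lborel) \<le> \<epsilon>\<^sup>2 * (16/3)"
    using integral_square_le by (intro mult_left_mono) auto
  then show "linear_form \<epsilon> \<eta> odd_trial \<le> 16/3 * \<epsilon>\<^sup>2" using T(2) by linarith
  \<comment> \<open>Removing [-1/8, 1/8], where \<eta>^4 \<le> 1, takes at most 1/4 from an integral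
    that is at least 1/2. On the rest arctan^2 is at least this k, which explains the factor 1/4 in
    the bound.\<close>
  define k where "k = (arctan (1/8))\<^sup>2"
  have k: "0 < k" unfolding k_def by (simp add: zero_less_arctan_iff)
  have W: "odd_trial \<in> weighted_H1" using odd by (simp add: odd_functions_def)
  have j: "integrable lborel (indicator {-(1/8)..1/8::real} :: real \<Rightarrow> real)"
    by (rule integrable_real_indicator) auto
  have "1/2 \<le> (\<integral>x. (\<eta> x)^4 \<partial>lborel)" by (rule integral_fourth_power_ge[OF assms])
  also have "\<dots> \<le> (\<integral>x. indicator {-(1/8)..1/8} x + 1/k * ((\<eta> x)\<^sup>2 * (odd_trial x)\<^sup>2) \<partial>lborel)"
  proof (rule integral_mono[OF i(2)])
    show "integrable lborel (\<lambda>x. indicator {-(1/8)..1/8} x + 1/k * ((\<eta> x)\<^sup>2 * (odd_trial x)\<^sup>2))"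
      using j norm2_integrable[OF W] by simp
    fix x :: real
    have e: "(\<eta> x)\<^sup>2 * (odd_trial x)\<^sup>2 = (\<eta> x)^4 * (arctan x)\<^sup>2"
      by (simp add: odd_trial_def power_mult_distrib power4_eq_xxxx power2_eq_square)
    show "(\<eta> x)^4 \<le> indicator {-(1/8)..1/8} x + 1/k * ((\<eta> x)\<^sup>2 * (odd_trial x)\<^sup>2)"
    proof (cases "x \<in> {-(1/8)..1/8}")
      case True
      have "(\<eta> x)^4 \<le> 1" using le_one[of x] pos[of x] by (simp add: power_le_one)
      then show ?thesis using True k by (simp add: e add_increasing2)
    next
      case False
      have "arctan (1/8) \<le> \<bar>arctan x\<bar>"
      proof (cases "0 \<le> x")
        case True
        then have "arctan (1/8) \<le> arctan x" using False by (auto simp: arctan_le_iff)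
        then show ?thesis by simp
      next
        case neg: False
        then have "arctan (1/8) \<le> arctan (- x)" using False by (auto simp: arctan_le_iff)
        then show ?thesis by (simp add: arctan_minus)
      qed
      then have "k \<le> \<bar>arctan x\<bar>\<^sup>2" unfolding k_def by (intro power_mono) (auto simp: zero_le_arctan_iff)
      then have "(\<eta> x)^4 * k \<le> (\<eta> x)^4 * (arctan x)\<^sup>2" by (intro mult_left_mono) auto
      then show ?thesis using False k by (simp add: e field_simps)
    qed
  qed
  also have "\<dots> = 1/4 + 1/k * weighted_norm2 \<eta> odd_trial"
    using j norm2_integrable[OF W] unfolding weighted_norm2_def by simp
  finally show "(arctan (1/8))\<^sup>2 / 4 \<le> weighted_norm2 \<eta> odd_trial"
    using k unfolding k_def[symmetric] by (simp add: field_simps)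
qed

abbreviation "\<Lambda> \<equiv> rayleigh_infimum \<epsilon> \<eta>"

lemma rayleigh_bdd_below:
  "bdd_below {linear_form \<epsilon> \<eta> b / weighted_norm2 \<eta> b |b. b \<in> odd_functions \<and> 0 < weighted_norm2 \<eta> b}"
  using linear_form_nonneg by (auto simp: bdd_below_def odd_functions_def intro!: exI[of _ 0])

lemma rayleigh_le:
  assumes b: "b \<in> odd_functions" shows "\<Lambda> * weighted_norm2 \<eta> b \<le> linear_form \<epsilon> \<eta> b"
proof (cases "0 < weighted_norm2 \<eta> b")
  case True
  have "\<Lambda> \<le> linear_form \<epsilon> \<eta> b / weighted_norm2 \<eta> b"
    unfolding rayleigh_infimum_def using b True by (intro cInf_lower rayleigh_bdd_below) auto
  then show ?thesis using True by (simp add: field_simps)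
next
  case False
  then have "weighted_norm2 \<eta> b = 0" using norm2_nonneg[of b] by simp
  then show ?thesis using linear_form_nonneg b by (simp add: odd_functions_def)
qed

text \<open>It supplies the odd direction of descent above the threshold. The trial function is
  needed to know that the infimum ranges over a nonempty set.\<close>

lemma rayleigh_less:
  assumes "\<epsilon> \<le> 1/4" "\<Lambda> < \<mu>"
  obtains b where "b \<in> odd_functions" "linear_form \<epsilon> \<eta> b < \<mu> * weighted_norm2 \<eta> b"
proof -
  have "0 < (arctan (1/8::real))\<^sup>2 / 4" by (simp add: zero_less_arctan_iff)
  then have "0 < weighted_norm2 \<eta> odd_trial" using odd_trial(3)[OF assms(1)] by linarith
  then have ne: "{linear_form \<epsilon> \<eta> b / weighted_norm2 \<eta> b |b. b \<in> odd_functions \<and> 0 < weighted_norm2 \<eta> b} \<noteq> {}"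
    using odd_trial(1)[OF assms(1)] by blast
  obtain b where "b \<in> odd_functions" "0 < weighted_norm2 \<eta> b" "linear_form \<epsilon> \<eta> b / weighted_norm2 \<eta> b < \<mu>"
    using cInf_lessD[OF ne assms(2)[unfolded rayleigh_infimum_def]] by blast
  then show thesis by (intro that[of b]) (simp_all add: field_simps)
qed

text \<open>The upper bound divides 16/3 \<epsilon>^2 by a quarter of arctan(1/8)^2. Positivity uses
  the coercivity constant, a uniform lower bound for all quotients because odd functions vanish at
  0.\<close>

lemma rayleigh_bounds:
  assumes "\<epsilon> \<le> 1/4"
  shows "0 < \<Lambda>" "\<Lambda> \<le> 64/3 / (arctan (1/8))\<^sup>2 * \<epsilon>\<^sup>2"
proof -
  define k :: real where "k = (arctan (1/8))\<^sup>2"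
  have k: "0 < k" unfolding k_def by (simp add: zero_less_arctan_iff)
  note t = odd_trial[OF assms, folded k_def]
  have N: "0 < weighted_norm2 \<eta> odd_trial" using t(3) k by linarith
  have "\<Lambda> * weighted_norm2 \<eta> odd_trial \<le> 16/3 * \<epsilon>\<^sup>2" using rayleigh_le[OF t(1)] t(2) by linarith
  then have "\<Lambda> \<le> 16/3 * \<epsilon>\<^sup>2 / weighted_norm2 \<eta> odd_trial" using N by (simp add: field_simps)
  also have "\<dots> \<le> 16/3 * \<epsilon>\<^sup>2 / (k/4)" using t(3) k by (intro divide_left_mono) auto
  finally show "\<Lambda> \<le> 64/3 / (arctan (1/8))\<^sup>2 * \<epsilon>\<^sup>2" unfolding k_def[symmetric] by simp
  obtain c where c: "c > 0" "\<And>b. b \<in> weighted_H1 \<Longrightarrow> b 0 = 0 \<Longrightarrow> c * weighted_norm2 \<eta> b \<le> linear_form \<epsilon> \<eta> b"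
    using linear_form_coercive by blast
  have "c \<le> \<Lambda>"
    unfolding rayleigh_infimum_def
  proof (rule cInf_greatest)
    show "{linear_form \<epsilon> \<eta> b / weighted_norm2 \<eta> b |b. b \<in> odd_functions \<and> 0 < weighted_norm2 \<eta> b} \<noteq> {}"
      using t(1) N by blast
    fix r assume "r \<in> {linear_form \<epsilon> \<eta> b / weighted_norm2 \<eta> b |b. b \<in> odd_functions \<and> 0 < weighted_norm2 \<eta> b}"
    then obtain b where b: "b \<in> odd_functions" "0 < weighted_norm2 \<eta> b" and r: "r = linear_form \<epsilon> \<eta> b / weighted_norm2 \<eta> b"
      by blast
    have "b (- 0) = - b 0" using b(1) unfolding odd_functions_def by blast
    then have "c * weighted_norm2 \<eta> b \<le> linear_form \<epsilon> \<eta> b"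
      using b(1) by (intro c(2)) (auto simp: odd_functions_def)
    then show "c \<le> r" using b(2) by (simp add: r field_simps)
  qed
  then show "0 < \<Lambda>" using c(1) by linarith
qed

end

text \<open>In the even and odd parts \<open>a\<close>, \<open>b\<close> of a rescaled symmetric state the energy is, up to a
  constant and a factor, the following functional, with \<open>\<mu> = 2(\<gamma> - 1)/(\<gamma> + 1)\<close>.\<close>

definition excess_energy :: "real \<Rightarrow> (real \<Rightarrow> real) \<Rightarrow> real \<Rightarrow> (real \<Rightarrow> real) \<Rightarrow> (real \<Rightarrow> real) \<Rightarrow> real" where
  "excess_energy \<epsilon> \<eta> \<mu> a b = linear_form \<epsilon> \<eta> a + linear_form \<epsilon> \<eta> b
     + (\<integral>x. 1/2 * ((\<eta> x)\<^sup>2 - (a x)\<^sup>2 - (b x)\<^sup>2)\<^sup>2 - \<mu> * (a x)\<^sup>2 * (b x)\<^sup>2 \<partial>lborel)"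

definition coupling :: "real \<Rightarrow> real" where
  "coupling \<gamma> = 2 * (\<gamma> - 1) / (\<gamma> + 1)"

text \<open>The scaling makes the symmetric state correspond to (\<eta>, 0) for every \<gamma>.
  Writing the difference as \<open>a x + (-1) * b x\<close> lets the closure rules for sums and
  multiples apply syntactically.\<close>

definition state_of :: "real \<Rightarrow> (real \<Rightarrow> real) \<Rightarrow> (real \<Rightarrow> real) \<Rightarrow> state" where
  "state_of \<gamma> a b = (\<lambda>x. (1 + \<gamma>) powr (- 1/2) * (a x + b x), \<lambda>x. (1 + \<gamma>) powr (- 1/2) * (a x + (-1) * b x))"

text \<open>Put s = 1 + \<gamma> and K = k^2, so s K = 1. Quadratic terms carry one factor K and
  quartic terms two; multiplying by s leaves K only in the quartic part, where
  \<open>coupling \<gamma>\<close> = 2 (1 - 2K). The terms in h come from completing the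
  square.\<close>

lemma pair_integrand_identity:
  fixes \<gamma> k p q a b x \<epsilon> h :: real
  assumes \<gamma>: "0 < \<gamma>" and k: "k\<^sup>2 = 1 / (1 + \<gamma>)"
  shows "1/2 * (\<epsilon>\<^sup>2 * (k * (p + q))\<^sup>2 + \<epsilon>\<^sup>2 * (k * (p + (-1) * q))\<^sup>2
     + (x\<^sup>2 - 1) * ((k * (a + b))\<^sup>2 + (k * (a + (-1) * b))\<^sup>2)
     + 1/2 * ((k * (a + b))\<^sup>2 + (k * (a + (-1) * b))\<^sup>2)\<^sup>2
     + (\<gamma> - 1) * (k * (a + b))\<^sup>2 * (k * (a + (-1) * b))\<^sup>2)
   = ((\<epsilon>\<^sup>2 * p\<^sup>2 + (x\<^sup>2 - 1 + h\<^sup>2) * a\<^sup>2) + (\<epsilon>\<^sup>2 * q\<^sup>2 + (x\<^sup>2 - 1 + h\<^sup>2) * b\<^sup>2)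
     + (1/2 * (h\<^sup>2 - a\<^sup>2 - b\<^sup>2)\<^sup>2 - coupling \<gamma> * a\<^sup>2 * b\<^sup>2) - 1/2 * h^4) / (1 + \<gamma>)"
proof -
  define s where "s = 1 + \<gamma>"
  have s: "s \<noteq> 0" "\<gamma> = s - 1" using \<gamma> by (auto simp: s_def)
  define K where "K = k\<^sup>2"
  have sK: "s * K = 1" unfolding K_def k s_def using \<gamma> by simp
  have c: "coupling \<gamma> * (a\<^sup>2 * b\<^sup>2) = 2 * (1 - 2 * K) * (a\<^sup>2 * b\<^sup>2)"
    unfolding coupling_def K_def k using \<gamma> by (simp add: field_simps)
  have e1: "(k * (u + v))\<^sup>2 = K * (u + v)\<^sup>2" for u v by (simp add: K_def power_mult_distrib)
  have "s * (1/2 * (\<epsilon>\<^sup>2 * (K * (p + q)\<^sup>2) + \<epsilon>\<^sup>2 * (K * (p + (-1) * q)\<^sup>2)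
     + (x\<^sup>2 - 1) * (K * (a + b)\<^sup>2 + K * (a + (-1) * b)\<^sup>2)
     + 1/2 * (K * (a + b)\<^sup>2 + K * (a + (-1) * b)\<^sup>2)\<^sup>2
     + (\<gamma> - 1) * (K * (a + b)\<^sup>2) * (K * (a + (-1) * b)\<^sup>2)))
    = (s * K) * (\<epsilon>\<^sup>2 * (p\<^sup>2 + q\<^sup>2) + (x\<^sup>2 - 1) * (a\<^sup>2 + b\<^sup>2)) + (s * K) * K * (a\<^sup>2 + b\<^sup>2)\<^sup>2
      + 1/2 * ((s * K) * (s * K) - 2 * (s * K) * K) * (a\<^sup>2 - b\<^sup>2)\<^sup>2"
    unfolding s(2) by (simp add: power2_eq_square algebra_simps)
  also have "\<dots> = \<epsilon>\<^sup>2 * (p\<^sup>2 + q\<^sup>2) + (x\<^sup>2 - 1) * (a\<^sup>2 + b\<^sup>2) + K * (a\<^sup>2 + b\<^sup>2)\<^sup>2 + 1/2 * (1 - 2 * K) * (a\<^sup>2 - b\<^sup>2)\<^sup>2"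
    unfolding sK by simp
  also have "\<dots> = (\<epsilon>\<^sup>2 * p\<^sup>2 + (x\<^sup>2 - 1 + h\<^sup>2) * a\<^sup>2) + (\<epsilon>\<^sup>2 * q\<^sup>2 + (x\<^sup>2 - 1 + h\<^sup>2) * b\<^sup>2)
     + (1/2 * (h\<^sup>2 - a\<^sup>2 - b\<^sup>2)\<^sup>2 - 2 * (1 - 2 * K) * (a\<^sup>2 * b\<^sup>2)) - 1/2 * h^4"
    by (simp add: power2_eq_square power4_eq_xxxx field_simps)
  also have "\<dots> = (\<epsilon>\<^sup>2 * p\<^sup>2 + (x\<^sup>2 - 1 + h\<^sup>2) * a\<^sup>2) + (\<epsilon>\<^sup>2 * q\<^sup>2 + (x\<^sup>2 - 1 + h\<^sup>2) * b\<^sup>2)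
     + (1/2 * (h\<^sup>2 - a\<^sup>2 - b\<^sup>2)\<^sup>2 - coupling \<gamma> * a\<^sup>2 * b\<^sup>2) - 1/2 * h^4"
    unfolding c[symmetric] by (simp add: mult.assoc)
  finally show ?thesis
    unfolding e1 s_def[symmetric] using s(1) by (simp only: eq_divide_eq mult.commute[of _ s]) simp
qed

lemma sym_energy_reflect:
  assumes f: "f \<in> weighted_H1"
  shows "sym_energy \<epsilon> \<gamma> (\<lambda>x. f (- x)) = sym_energy \<epsilon> \<gamma> f"
proof -
  note p = weak_deriv(1)[OF f]
  have "sym_energy \<epsilon> \<gamma> (\<lambda>x. f (- x)) = (\<integral>x. sym_density \<epsilon> \<gamma> (\<lambda>x. f (- x)) (\<lambda>x. - weak_deriv f (- x)) x \<partial>lborel)"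
    by (rule sym_energy_eq[OF weighted_H1_reflect(1)[OF f] primitive_reflect[OF p]])
  also have "\<dots> = (\<integral>x. sym_density \<epsilon> \<gamma> f (weak_deriv f) (- x) \<partial>lborel)"
    by (simp add: sym_density_def algebra_simps)
  also have "\<dots> = sym_energy \<epsilon> \<gamma> f" unfolding integral_reflect sym_energy_def ..
  finally show ?thesis .
qed

lemma polynomial_deriv_at_0:
  fixes c0 c2 c3 c4 d :: real
  defines "f \<equiv> \<lambda>t. (t\<^sup>2 * c2 + t^3 * c3 + t^4 * c4 + c0) / d"
  shows "(f has_real_derivative 0) (at 0)" "(deriv ^^ 2) f 0 = 2 * c2 / d"
proof -
  have 1: "(f has_real_derivative (2 * t * c2 + 3 * t\<^sup>2 * c3 + 4 * t^3 * c4) / d) (at t)" for t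
    unfolding f_def by (rule DERIV_cdivide) (auto intro!: derivative_eq_intros)
  then have "deriv f = (\<lambda>t. (2 * t * c2 + 3 * t\<^sup>2 * c3 + 4 * t^3 * c4) / d)"
    by (intro ext DERIV_imp_deriv)
  moreover have "((\<lambda>t. (2 * t * c2 + 3 * t\<^sup>2 * c3 + 4 * t^3 * c4) / d) has_real_derivative 2 * c2 / d) (at 0)"
    by (rule DERIV_cdivide) (auto intro!: derivative_eq_intros)
  ultimately show "(deriv ^^ 2) f 0 = 2 * c2 / d"
    by (simp add: numeral_2_eq_2 DERIV_imp_deriv)
  show "(f has_real_derivative 0) (at 0)" using 1[of 0] by simp
qed

section \<open>Minimality and instability of the symmetric state\<close>

context scalar_state
begin

lemma remainder_integrable:
  assumes "a \<in> weighted_H1" "b \<in> weighted_H1"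
  shows "integrable lborel (\<lambda>x. 1/2 * ((\<eta> x)\<^sup>2 - (a x)\<^sup>2 - (b x)\<^sup>2)\<^sup>2 - \<mu> * (a x)\<^sup>2 * (b x)\<^sup>2)"
proof -
  have "integrable lborel (\<lambda>x. (\<eta> x * \<eta> x - a x * a x - b x * b x)\<^sup>2)"
    by (intro L2_integrable_square L2_diff weighted_H1_mult_L2 weighted assms)
  moreover have "integrable lborel (\<lambda>x. \<mu> * ((a x)\<^sup>2 * (b x)\<^sup>2))"
    using weighted_H1_integrable(5)[OF assms] by simp
  ultimately show ?thesis by (simp add: power2_eq_square mult.assoc)
qed

lemma energy_state_of:
  assumes \<gamma>: "0 < \<gamma>" and a: "a \<in> weighted_H1" and b: "b \<in> weighted_H1"
  shows "energy \<epsilon> \<gamma> (state_of \<gamma> a b)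
    = (excess_energy \<epsilon> \<eta> (coupling \<gamma>) a b - 1/2 * (\<integral>x. (\<eta> x)^4 \<partial>lborel)) / (1 + \<gamma>)"
proof -
  define k where "k = (1 + \<gamma>) powr (- 1/2)"
  have k: "k\<^sup>2 = 1 / (1 + \<gamma>)"
  proof -
    have "k\<^sup>2 = (1 + \<gamma>) powr (- 1/2 + - 1/2)" unfolding k_def by (simp only: power2_eq_square powr_add)
    then show ?thesis using \<gamma> by (simp add: powr_minus_divide)
  qed
  define u v where "u x = k * (a x + b x)" and "v x = k * (a x + (-1) * b x)" for x
  have st: "state_of \<gamma> a b = (u, v)" unfolding state_of_def u_def v_def k_def ..
  define p q where "p = weak_deriv a" and "q = weak_deriv b"
  have pa: "primitive a p" "primitive b q" unfolding p_def q_def by (rule weak_deriv a b)+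
  have uv: "u \<in> weighted_H1" "v \<in> weighted_H1"
    unfolding u_def[abs_def] v_def[abs_def] by (intro weighted_H1_cmult weighted_H1_add a b)+
  have puv: "primitive u (\<lambda>x. k * (p x + q x))" "primitive v (\<lambda>x. k * (p x + (-1) * q x))"
    unfolding u_def[abs_def] v_def[abs_def] by (intro primitive_cmult primitive_add pa)+
  have ae: "AE x in lborel. weak_deriv u x = k * (p x + q x)" "AE x in lborel. weak_deriv v x = k * (p x + (-1) * q x)"
    by (rule primitive_AE_unique[OF weak_deriv(1)[OF uv(1)] puv(1)])
      (rule primitive_AE_unique[OF weak_deriv(1)[OF uv(2)] puv(2)])
  note [measurable] = weighted_H1_measurable[OF uv(1)] weighted_H1_measurable[OF uv(2)] weighted_H1_measurable[OF weighted]
    weighted_H1_measurable[OF a] weighted_H1_measurable[OF b] weak_deriv_measurable[OF uv(1)] weak_deriv_measurable[OF uv(2)]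
    primitive_measurable[OF pa(1)] primitive_measurable[OF pa(2)]
  let ?A = "\<lambda>x. \<epsilon>\<^sup>2 * (p x)\<^sup>2 + (x\<^sup>2 - 1 + (\<eta> x)\<^sup>2) * (a x)\<^sup>2"
  let ?B = "\<lambda>x. \<epsilon>\<^sup>2 * (q x)\<^sup>2 + (x\<^sup>2 - 1 + (\<eta> x)\<^sup>2) * (b x)\<^sup>2"
  let ?C = "\<lambda>x. 1/2 * ((\<eta> x)\<^sup>2 - (a x)\<^sup>2 - (b x)\<^sup>2)\<^sup>2 - coupling \<gamma> * (a x)\<^sup>2 * (b x)\<^sup>2"
  have "energy \<epsilon> \<gamma> (u, v) = (\<integral>x. 1/2 * (\<epsilon>\<^sup>2 * (weak_deriv u x)\<^sup>2 + \<epsilon>\<^sup>2 * (weak_deriv v x)\<^sup>2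
     + (x\<^sup>2 - 1) * ((u x)\<^sup>2 + (v x)\<^sup>2) + 1 / 2 * ((u x)\<^sup>2 + (v x)\<^sup>2)\<^sup>2
     + (\<gamma> - 1) * (u x)\<^sup>2 * (v x)\<^sup>2) \<partial>lborel)"
    by simp
  also have "\<dots> = (\<integral>x. (?A x + ?B x + ?C x - 1/2 * (\<eta> x)^4) / (1 + \<gamma>) \<partial>lborel)"
  proof (rule integral_cong_AE)
    show "AE x in lborel. 1/2 * (\<epsilon>\<^sup>2 * (weak_deriv u x)\<^sup>2 + \<epsilon>\<^sup>2 * (weak_deriv v x)\<^sup>2
       + (x\<^sup>2 - 1) * ((u x)\<^sup>2 + (v x)\<^sup>2) + 1 / 2 * ((u x)\<^sup>2 + (v x)\<^sup>2)\<^sup>2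
       + (\<gamma> - 1) * (u x)\<^sup>2 * (v x)\<^sup>2) = (?A x + ?B x + ?C x - 1/2 * (\<eta> x)^4) / (1 + \<gamma>)"
      using ae
    proof eventually_elim
      case (elim x)
      show ?case unfolding elim u_def v_def by (rule pair_integrand_identity[OF \<gamma> k])
    qed
  qed measurable
  also have "\<dots> = (\<integral>x. ?A x + ?B x + ?C x - 1/2 * (\<eta> x)^4 \<partial>lborel) / (1 + \<gamma>)" by simp
  also have "(\<integral>x. ?A x + ?B x + ?C x - 1/2 * (\<eta> x)^4 \<partial>lborel)
      = (\<integral>x. ?A x \<partial>lborel) + (\<integral>x. ?B x \<partial>lborel) + (\<integral>x. ?C x \<partial>lborel) - 1/2 * (\<integral>x. (\<eta> x)^4 \<partial>lborel)"
  proof -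
    have iA: "integrable lborel ?A" unfolding p_def by (rule linear_form_integrable[OF weighted a weak_deriv(2)[OF a]])
    have iB: "integrable lborel ?B" unfolding q_def by (rule linear_form_integrable[OF weighted b weak_deriv(2)[OF b]])
    have iC: "integrable lborel ?C" by (rule remainder_integrable[OF a b])
    have i4: "integrable lborel (\<lambda>x. 1/2 * (\<eta> x)^4)" using weighted_H1_integrable(4)[OF weighted weighted] by simp
    have "(\<integral>x. ?A x + ?B x + ?C x - 1/2 * (\<eta> x)^4 \<partial>lborel)
        = (\<integral>x. ?A x + ?B x + ?C x \<partial>lborel) - (\<integral>x. 1/2 * (\<eta> x)^4 \<partial>lborel)"
      by (rule Bochner_Integration.integral_diff[OF Bochner_Integration.integrable_add[OF Bochner_Integration.integrable_add[OF iA iB] iC] i4])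
    also have "(\<integral>x. ?A x + ?B x + ?C x \<partial>lborel) = (\<integral>x. ?A x + ?B x \<partial>lborel) + (\<integral>x. ?C x \<partial>lborel)"
      by (rule Bochner_Integration.integral_add[OF Bochner_Integration.integrable_add[OF iA iB] iC])
    also have "(\<integral>x. ?A x + ?B x \<partial>lborel) = (\<integral>x. ?A x \<partial>lborel) + (\<integral>x. ?B x \<partial>lborel)"
      by (rule Bochner_Integration.integral_add[OF iA iB])
    finally show ?thesis by simp
  qed
  finally show ?thesis
    unfolding st excess_energy_def linear_form_def p_def q_def .
qed

lemma excess_energy_nonneg:
  assumes a: "a \<in> weighted_H1" and b: "b \<in> odd_functions" and \<mu>: "\<mu> \<le> \<Lambda>" and \<Lambda>: "0 \<le> \<Lambda>" "\<Lambda> \<le> 2"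
  shows "0 \<le> excess_energy \<epsilon> \<eta> \<mu> a b"
proof -
  have bW: "b \<in> weighted_H1" using b by (simp add: odd_functions_def)
  let ?C = "\<lambda>x. 1/2 * ((\<eta> x)\<^sup>2 - (a x)\<^sup>2 - (b x)\<^sup>2)\<^sup>2 - \<mu> * (a x)\<^sup>2 * (b x)\<^sup>2"
  \<comment> \<open>Here E, P, S stand for \<eta>^2, a^2, b^2. Only P > E is critical: then (E - P -
    S)^2 = (P - E - S)^2 + 4 (P - E) S, and half of it absorbs \<Lambda> (P - E) S precisely because
    \<Lambda> \<le> 2.\<close>
  have alg: "0 \<le> \<Lambda> * (E * S) + (1/2 * (E - P - S)\<^sup>2 - \<mu> * P * S)" if "0 \<le> E" "0 \<le> P" "0 \<le> S" for E P S :: real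
  proof -
    have m: "\<mu> * (P * S) \<le> \<Lambda> * (P * S)" using that \<mu> by (intro mult_right_mono) auto
    have "0 \<le> 1/2 * (E - P - S)\<^sup>2 + \<Lambda> * ((E - P) * S)"
    proof (cases "P \<le> E")
      case True
      then have "0 \<le> \<Lambda> * ((E - P) * S)" using that \<Lambda> by (intro mult_nonneg_nonneg) auto
      then show ?thesis by simp
    next
      case False
      then have "\<Lambda> * ((P - E) * S) \<le> 2 * ((P - E) * S)" using that \<Lambda> by (intro mult_right_mono) auto
      moreover have "0 \<le> 1/2 * (P - E - S)\<^sup>2" by simp
      moreover have "1/2 * (P - E - S)\<^sup>2 = 1/2 * (E - P - S)\<^sup>2 - 2 * ((P - E) * S)"
        by (simp add: power2_eq_square field_simps)
      moreover have "\<Lambda> * ((E - P) * S) = - (\<Lambda> * ((P - E) * S))" by (simp add: algebra_simps)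
      ultimately show ?thesis by linarith
    qed
    also have "\<dots> = \<Lambda> * (E * S) + (1/2 * (E - P - S)\<^sup>2 - \<Lambda> * (P * S))"
      by (simp only: left_diff_distrib right_diff_distrib)
    finally show ?thesis using m by (simp add: mult.assoc)
  qed
  have i: "integrable lborel (\<lambda>x. \<Lambda> * ((\<eta> x)\<^sup>2 * (b x)\<^sup>2))" using norm2_integrable[OF bW] by simp
  have "0 \<le> (\<integral>x. \<Lambda> * ((\<eta> x)\<^sup>2 * (b x)\<^sup>2) + ?C x \<partial>lborel)"
    by (rule Bochner_Integration.integral_nonneg) (rule alg, simp_all)
  also have "\<dots> = \<Lambda> * weighted_norm2 \<eta> b + (\<integral>x. ?C x \<partial>lborel)"
    using Bochner_Integration.integral_add[OF i remainder_integrable[OF a bW]] by (simp add: weighted_norm2_def)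
  finally show ?thesis
    unfolding excess_energy_def using rayleigh_le[OF b] linear_form_nonneg[OF a] by linarith
qed

text \<open>The cross term between \<eta> and \<alpha> vanishes because the form is nonnegative and
  zero at \<eta>. This replaces an integration by parts over the whole line, with its boundary terms
  at infinity.\<close>

lemma linear_form_perturb:
  assumes \<alpha>: "\<alpha> \<in> weighted_H1"
  shows "linear_form \<epsilon> \<eta> (\<lambda>x. \<eta> x + t * \<alpha> x) = t\<^sup>2 * linear_form \<epsilon> \<eta> \<alpha>"
    "linear_form \<epsilon> \<eta> (\<lambda>x. t * \<alpha> x) = t\<^sup>2 * linear_form \<epsilon> \<eta> \<alpha>"
proof -
  define p where "p = weak_deriv \<alpha>"
  have pp: "primitive \<alpha> p" unfolding p_def by (rule weak_deriv(1)[OF \<alpha>])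
  have pL: "p \<in> L2_space" unfolding p_def by (rule weak_deriv(2)[OF \<alpha>])
  have eL: "\<eta>' \<in> L2_space" by (rule weighted_H1_primitive_L2[OF weighted primitive(1)])
  let ?V = "\<lambda>x. x\<^sup>2 - 1 + (\<eta> x)\<^sup>2"
  define B where "B = (\<integral>x. \<epsilon>\<^sup>2 * (\<eta>' x * p x) + ?V x * (\<eta> x * \<alpha> x) \<partial>lborel)"
  have iB: "integrable lborel (\<lambda>x. \<epsilon>\<^sup>2 * (\<eta>' x * p x) + ?V x * (\<eta> x * \<alpha> x))"
  proof -
    have "integrable lborel (\<lambda>x. \<epsilon>\<^sup>2 * (\<eta>' x * p x) + ((x * \<eta> x) * (x * \<alpha> x) - \<eta> x * \<alpha> x + (\<eta> x * \<eta> x) * (\<eta> x * \<alpha> x)))"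
      by (intro Bochner_Integration.integrable_add Bochner_Integration.integrable_diff integrable_mult_right
          L2_integrable_mult eL pL weighted_H1_L2 weighted_H1_mult_L2 weighted \<alpha>)
    then show ?thesis by (rule back_subst[of "integrable lborel"]) (auto simp: algebra_simps power2_eq_square)
  qed
  have i0: "integrable lborel (\<lambda>x. \<epsilon>\<^sup>2 * (\<eta>' x)\<^sup>2 + ?V x * (\<eta> x)\<^sup>2)" by (rule linear_form_integrable[OF weighted weighted eL])
  have i1: "integrable lborel (\<lambda>x. \<epsilon>\<^sup>2 * (p x)\<^sup>2 + ?V x * (\<alpha> x)\<^sup>2)" by (rule linear_form_integrable[OF weighted \<alpha> pL])
  have Q0: "(\<integral>x. \<epsilon>\<^sup>2 * (\<eta>' x)\<^sup>2 + ?V x * (\<eta> x)\<^sup>2 \<partial>lborel) = 0"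
    using linear_form_eq[OF weighted weighted primitive(1), of \<epsilon>] linear_form_self by simp
  have Q1: "(\<integral>x. \<epsilon>\<^sup>2 * (p x)\<^sup>2 + ?V x * (\<alpha> x)\<^sup>2 \<partial>lborel) = linear_form \<epsilon> \<eta> \<alpha>"
    using linear_form_eq[OF weighted \<alpha> pp, of \<epsilon>] by simp
  have W: "(\<lambda>x. \<eta> x + t * \<alpha> x) \<in> weighted_H1" for t by (intro weighted_H1_add weighted_H1_cmult weighted \<alpha>)
  have ex: "linear_form \<epsilon> \<eta> (\<lambda>x. \<eta> x + t * \<alpha> x) = 2 * t * B + t\<^sup>2 * linear_form \<epsilon> \<eta> \<alpha>" for t
  proof -
    have "linear_form \<epsilon> \<eta> (\<lambda>x. \<eta> x + t * \<alpha> x)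
      = (\<integral>x. \<epsilon>\<^sup>2 * (\<eta>' x + t * p x)\<^sup>2 + ?V x * (\<eta> x + t * \<alpha> x)\<^sup>2 \<partial>lborel)"
      by (rule linear_form_eq[OF weighted W primitive_add[OF primitive(1) primitive_cmult[OF pp]]])
    also have "\<dots> = (\<integral>x. (\<epsilon>\<^sup>2 * (\<eta>' x)\<^sup>2 + ?V x * (\<eta> x)\<^sup>2) + 2 * t * (\<epsilon>\<^sup>2 * (\<eta>' x * p x) + ?V x * (\<eta> x * \<alpha> x))
        + t\<^sup>2 * (\<epsilon>\<^sup>2 * (p x)\<^sup>2 + ?V x * (\<alpha> x)\<^sup>2) \<partial>lborel)"
      by (rule Bochner_Integration.integral_cong) (simp_all add: power2_eq_square algebra_simps)
    also have "\<dots> = (\<integral>x. \<epsilon>\<^sup>2 * (\<eta>' x)\<^sup>2 + ?V x * (\<eta> x)\<^sup>2 \<partial>lborel) + 2 * t * B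
        + t\<^sup>2 * (\<integral>x. \<epsilon>\<^sup>2 * (p x)\<^sup>2 + ?V x * (\<alpha> x)\<^sup>2 \<partial>lborel)"
      unfolding B_def
      by (simp only: Bochner_Integration.integral_add[OF Bochner_Integration.integrable_add[OF i0 integrable_mult_right[OF iB]] integrable_mult_right[OF i1]]
          Bochner_Integration.integral_add[OF i0 integrable_mult_right[OF iB]] integral_mult_right_zero)
    finally show ?thesis unfolding Q0 Q1 by simp
  qed
  have "2 * B = 0"
  proof (rule quartic_nonneg_imp_linear_zero[of _ "linear_form \<epsilon> \<eta> \<alpha>" 0 0])
    show "0 \<le> t * (2 * B) + t\<^sup>2 * linear_form \<epsilon> \<eta> \<alpha> + t ^ 3 * 0 + t ^ 4 * 0" for t
      using linear_form_nonneg[OF W[of t]] unfolding ex by (simp add: mult_ac)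
  qed
  then show "linear_form \<epsilon> \<eta> (\<lambda>x. \<eta> x + t * \<alpha> x) = t\<^sup>2 * linear_form \<epsilon> \<eta> \<alpha>" unfolding ex by simp
  have "linear_form \<epsilon> \<eta> (\<lambda>x. t * \<alpha> x) = (\<integral>x. \<epsilon>\<^sup>2 * (t * p x)\<^sup>2 + ?V x * (t * \<alpha> x)\<^sup>2 \<partial>lborel)"
    by (rule linear_form_eq[OF weighted weighted_H1_cmult(1)[OF \<alpha>] primitive_cmult[OF pp]])
  also have "\<dots> = (\<integral>x. t\<^sup>2 * (\<epsilon>\<^sup>2 * (p x)\<^sup>2 + ?V x * (\<alpha> x)\<^sup>2) \<partial>lborel)"
    by (rule Bochner_Integration.integral_cong) (simp_all add: power_mult_distrib algebra_simps)
  finally show "linear_form \<epsilon> \<eta> (\<lambda>x. t * \<alpha> x) = t\<^sup>2 * linear_form \<epsilon> \<eta> \<alpha>"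
    unfolding integral_mult_right_zero Q1 .
qed

text \<open>There is no linear term, so the symmetric state is critical, and to second order
  \<alpha> and \<beta> decouple. When \<alpha> = 0 the cubic term drops out as well, which makes the
  excess a polynomial in t^2 along odd directions.\<close>

lemma excess_energy_perturb:
  assumes \<alpha>: "\<alpha> \<in> weighted_H1" and \<beta>: "\<beta> \<in> weighted_H1"
  obtains c3 c4 where
    "\<And>t. excess_energy \<epsilon> \<eta> \<mu> (\<lambda>x. \<eta> x + t * \<alpha> x) (\<lambda>x. t * \<beta> x)
      = t\<^sup>2 * (linear_form \<epsilon> \<eta> \<alpha> + linear_form \<epsilon> \<eta> \<beta> + 2 * weighted_norm2 \<eta> \<alpha> - \<mu> * weighted_norm2 \<eta> \<beta>)
        + t^3 * c3 + t^4 * c4"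
    "(\<forall>x. \<alpha> x = 0) \<longrightarrow> c3 = 0"
proof -
  define q3 where "q3 x = 2 * ((\<eta> x * \<alpha> x) * (\<alpha> x * \<alpha> x)) + (2 - 2 * \<mu>) * ((\<eta> x * \<alpha> x) * (\<beta> x * \<beta> x))" for x
  define q4 where "q4 x = 1/2 * (\<alpha> x * \<alpha> x + \<beta> x * \<beta> x)\<^sup>2 - \<mu> * ((\<alpha> x * \<alpha> x) * (\<beta> x * \<beta> x))" for x
  have i3: "integrable lborel q3" unfolding q3_def[abs_def]
    by (intro Bochner_Integration.integrable_add integrable_mult_right L2_integrable_mult weighted_H1_mult_L2 weighted \<alpha> \<beta>)
  have i4: "integrable lborel q4" unfolding q4_def[abs_def]
    by (intro Bochner_Integration.integrable_diff integrable_mult_right L2_integrable_mult L2_integrable_square L2_add weighted_H1_mult_L2 weighted \<alpha> \<beta>)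
  define q2 where "q2 x = 2 * ((\<eta> x)\<^sup>2 * (\<alpha> x)\<^sup>2) - \<mu> * ((\<eta> x)\<^sup>2 * (\<beta> x)\<^sup>2)" for x
  have i2: "integrable lborel q2" unfolding q2_def[abs_def]
    by (intro Bochner_Integration.integrable_diff integrable_mult_right norm2_integrable \<alpha> \<beta>)
  have I2: "(\<integral>x. q2 x \<partial>lborel) = 2 * weighted_norm2 \<eta> \<alpha> - \<mu> * weighted_norm2 \<eta> \<beta>"
    unfolding q2_def weighted_norm2_def using norm2_integrable[OF \<alpha>] norm2_integrable[OF \<beta>] by simp
  have "excess_energy \<epsilon> \<eta> \<mu> (\<lambda>x. \<eta> x + t * \<alpha> x) (\<lambda>x. t * \<beta> x)
      = t\<^sup>2 * (linear_form \<epsilon> \<eta> \<alpha> + linear_form \<epsilon> \<eta> \<beta> + 2 * weighted_norm2 \<eta> \<alpha> - \<mu> * weighted_norm2 \<eta> \<beta>)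
        + t^3 * (\<integral>x. q3 x \<partial>lborel) + t^4 * (\<integral>x. q4 x \<partial>lborel)" for t
  proof -
    have "(\<integral>x. 1/2 * ((\<eta> x)\<^sup>2 - (\<eta> x + t * \<alpha> x)\<^sup>2 - (t * \<beta> x)\<^sup>2)\<^sup>2 - \<mu> * (\<eta> x + t * \<alpha> x)\<^sup>2 * (t * \<beta> x)\<^sup>2 \<partial>lborel)
      = (\<integral>x. t\<^sup>2 * q2 x + t^3 * q3 x + t^4 * q4 x \<partial>lborel)"
      by (rule Bochner_Integration.integral_cong)
        (simp_all add: q2_def q3_def q4_def power2_eq_square power3_eq_cube power4_eq_xxxx field_simps)
    also have "\<dots> = t\<^sup>2 * (\<integral>x. q2 x \<partial>lborel) + t^3 * (\<integral>x. q3 x \<partial>lborel) + t^4 * (\<integral>x. q4 x \<partial>lborel)"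
      using i2 i3 i4 by simp
    finally show ?thesis
      unfolding excess_energy_def linear_form_perturb[OF \<alpha>] linear_form_perturb(2)[OF \<beta>] I2
      by (simp add: algebra_simps)
  qed
  moreover have "(\<forall>x. \<alpha> x = 0) \<longrightarrow> (\<integral>x. q3 x \<partial>lborel) = 0" unfolding q3_def by simp
  ultimately show thesis by (rule that)
qed

lemma excess_energy_self: "excess_energy \<epsilon> \<eta> \<mu> \<eta> (\<lambda>x. 0) = 0"
proof -
  have z: "(\<lambda>x. 0) \<in> weighted_H1" using weighted_H1_cmult(1)[OF weighted, of 0] by simp
  obtain c3 c4 where "\<And>t. excess_energy \<epsilon> \<eta> \<mu> (\<lambda>x. \<eta> x + t * 0) (\<lambda>x. t * 0)
      = t\<^sup>2 * (linear_form \<epsilon> \<eta> (\<lambda>x. 0) + linear_form \<epsilon> \<eta> (\<lambda>x. 0) + 2 * weighted_norm2 \<eta> (\<lambda>x. 0) - \<mu> * weighted_norm2 \<eta> (\<lambda>x. 0))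
        + t^3 * c3 + t^4 * c4" by (rule excess_energy_perturb[OF z z, of \<mu>]) (rule that)
  from this[of 0] show ?thesis by simp
qed

text \<open>The symmetry of a state says that its half sum is even and its half difference odd; the
  factor c = 1/(2k) undoes the scaling in \<open>state_of\<close>.\<close>

lemma sym_energy_space_state_of:
  assumes \<gamma>: "0 < \<gamma>"
  shows "\<Psi> \<in> sym_energy_space \<longleftrightarrow>
    (\<exists>a\<in>weighted_H1. \<exists>b\<in>odd_functions. (\<forall>x. a (- x) = a x) \<and> \<Psi> = state_of \<gamma> a b)"
proof
  define k where "k = (1 + \<gamma>) powr (- 1/2)"
  have k: "k \<noteq> 0" unfolding k_def using \<gamma> by simp
  {
    assume "\<Psi> \<in> sym_energy_space"
    then obtain f where f: "f \<in> weighted_H1" and \<Psi>: "\<Psi> = (f, \<lambda>x. f (- x))"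
      using sym_energy_space_iff by blast
    define c where "c = 1/(2 * k)"
    define a b where "a x = c * (f x + f (- x))" and "b x = c * (f x + (-1) * f (- x))" for x
    have ab: "a \<in> weighted_H1" "b \<in> weighted_H1"
      unfolding a_def[abs_def] b_def[abs_def] by (intro weighted_H1_cmult weighted_H1_add weighted_H1_reflect f)+
    have "a (- x) = a x" "b (- x) = - b x" for x by (simp_all add: a_def b_def algebra_simps)
    moreover have "\<Psi> = state_of \<gamma> a b"
      unfolding \<Psi> state_of_def k_def[symmetric] a_def b_def c_def using k by (auto simp: fun_eq_iff field_simps)
    ultimately show "\<exists>a\<in>weighted_H1. \<exists>b\<in>odd_functions. (\<forall>x. a (- x) = a x) \<and> \<Psi> = state_of \<gamma> a b"
      using ab by (auto simp: odd_functions_def)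
  }
  assume "\<exists>a\<in>weighted_H1. \<exists>b\<in>odd_functions. (\<forall>x. a (- x) = a x) \<and> \<Psi> = state_of \<gamma> a b"
  then obtain a b where ab: "a \<in> weighted_H1" "b \<in> weighted_H1" "\<And>x. a (- x) = a x" "\<And>x. b (- x) = - b x"
    and \<Psi>: "\<Psi> = state_of \<gamma> a b" by (auto simp: odd_functions_def)
  have "(\<lambda>x. k * (a x + b x)) \<in> weighted_H1" by (intro weighted_H1_cmult weighted_H1_add ab)
  moreover have "\<Psi> = (\<lambda>x. k * (a x + b x), \<lambda>x. k * (a (- x) + b (- x)))"
    unfolding \<Psi> state_of_def k_def[symmetric] by (simp add: ab(3,4))
  ultimately show "\<Psi> \<in> sym_energy_space" unfolding sym_energy_space_iff by blast
qed

lemma zero_odd: "(\<lambda>x. 0) \<in> odd_functions"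
  using weighted_H1_cmult(1)[OF weighted, of 0] by (simp add: odd_functions_def)

lemma symmetric_state_space: "0 < \<gamma> \<Longrightarrow> state_of \<gamma> \<eta> (\<lambda>x. 0) \<in> sym_energy_space"
  using sym_energy_space_state_of weighted zero_odd even by blast

lemma symmetric_state_minimizer:
  assumes \<gamma>: "0 < \<gamma>" and "coupling \<gamma> \<le> \<Lambda>" "0 \<le> \<Lambda>" "\<Lambda> \<le> 2"
  shows "global_minimizer (energy \<epsilon> \<gamma>) sym_energy_space (state_of \<gamma> \<eta> (\<lambda>x. 0))"
  unfolding global_minimizer_def
proof (intro conjI ballI)
  show "state_of \<gamma> \<eta> (\<lambda>x. 0) \<in> sym_energy_space" by (rule symmetric_state_space[OF \<gamma>])
  fix \<Phi> assume "\<Phi> \<in> sym_energy_space"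
  then obtain a b where ab: "a \<in> weighted_H1" "b \<in> odd_functions" and \<Phi>: "\<Phi> = state_of \<gamma> a b"
    using sym_energy_space_state_of[OF \<gamma>] by blast
  have b: "b \<in> weighted_H1" using ab(2) by (simp add: odd_functions_def)
  have z: "(\<lambda>x. 0) \<in> weighted_H1" using zero_odd by (simp add: odd_functions_def)
  have "0 \<le> excess_energy \<epsilon> \<eta> (coupling \<gamma>) a b" by (rule excess_energy_nonneg[OF ab assms(2-)])
  then show "energy \<epsilon> \<gamma> (state_of \<gamma> \<eta> (\<lambda>x. 0)) \<le> energy \<epsilon> \<gamma> \<Phi>"
    unfolding \<Phi> energy_state_of[OF \<gamma> weighted z] energy_state_of[OF \<gamma> ab(1) b] excess_energy_self
    using \<gamma> by (intro divide_right_mono) auto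
qed

lemma energy_perturb:
  assumes \<gamma>: "0 < \<gamma>" and \<alpha>: "\<alpha> \<in> weighted_H1" and \<beta>: "\<beta> \<in> weighted_H1"
  obtains c3 c4 where
    "(\<lambda>t. energy \<epsilon> \<gamma> (perturb (state_of \<gamma> \<eta> (\<lambda>x. 0)) (state_of \<gamma> \<alpha> \<beta>) t))
      = (\<lambda>t. (t\<^sup>2 * (linear_form \<epsilon> \<eta> \<alpha> + linear_form \<epsilon> \<eta> \<beta> + 2 * weighted_norm2 \<eta> \<alpha> - coupling \<gamma> * weighted_norm2 \<eta> \<beta>)
        + t^3 * c3 + t^4 * c4 + - (1/2 * (\<integral>x. (\<eta> x)^4 \<partial>lborel))) / (1 + \<gamma>))"
    "(\<forall>x. \<alpha> x = 0) \<longrightarrow> c3 = 0"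
proof -
  obtain c3 c4 where c: "\<And>t. excess_energy \<epsilon> \<eta> (coupling \<gamma>) (\<lambda>x. \<eta> x + t * \<alpha> x) (\<lambda>x. t * \<beta> x)
      = t\<^sup>2 * (linear_form \<epsilon> \<eta> \<alpha> + linear_form \<epsilon> \<eta> \<beta> + 2 * weighted_norm2 \<eta> \<alpha> - coupling \<gamma> * weighted_norm2 \<eta> \<beta>)
        + t^3 * c3 + t^4 * c4" "(\<forall>x. \<alpha> x = 0) \<longrightarrow> c3 = 0"
    by (rule excess_energy_perturb[OF \<alpha> \<beta>, of "coupling \<gamma>"]) (rule that)
  have "perturb (state_of \<gamma> \<eta> (\<lambda>x. 0)) (state_of \<gamma> \<alpha> \<beta>) t = state_of \<gamma> (\<lambda>x. \<eta> x + t * \<alpha> x) (\<lambda>x. t * \<beta> x)" for t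
    unfolding state_of_def by (simp add: fun_eq_iff algebra_simps)
  moreover have "(\<lambda>x. \<eta> x + t * \<alpha> x) \<in> weighted_H1" "(\<lambda>x. t * \<beta> x) \<in> weighted_H1" for t
    by (intro weighted_H1_add weighted_H1_cmult weighted \<alpha> \<beta>)+
  ultimately have "energy \<epsilon> \<gamma> (perturb (state_of \<gamma> \<eta> (\<lambda>x. 0)) (state_of \<gamma> \<alpha> \<beta>) t)
      = (t\<^sup>2 * (linear_form \<epsilon> \<eta> \<alpha> + linear_form \<epsilon> \<eta> \<beta> + 2 * weighted_norm2 \<eta> \<alpha> - coupling \<gamma> * weighted_norm2 \<eta> \<beta>)
        + t^3 * c3 + t^4 * c4 + - (1/2 * (\<integral>x. (\<eta> x)^4 \<partial>lborel))) / (1 + \<gamma>)" for t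
    by (simp add: energy_state_of[OF \<gamma>] c(1))
  then show thesis by (intro that[of c3 c4] ext c(2))
qed

text \<open>The direction of positive second variation is the state itself, where only the \<eta>^4
  integral contributes. The negative one is purely odd, with Rayleigh quotient below the
  coupling.\<close>

lemma symmetric_state_saddle:
  assumes small: "\<epsilon> \<le> 1/4" and \<gamma>: "0 < \<gamma>" and \<mu>: "\<Lambda> < coupling \<gamma>"
  shows "saddle_point (energy \<epsilon> \<gamma>) sym_energy_space (state_of \<gamma> \<eta> (\<lambda>x. 0))"
  unfolding saddle_point_def critical_point_def
proof (intro conjI ballI)
  let ?\<Psi> = "state_of \<gamma> \<eta> (\<lambda>x. 0)"
  show "?\<Psi> \<in> sym_energy_space" by (rule symmetric_state_space[OF \<gamma>])
  have z: "(\<lambda>x. 0) \<in> weighted_H1" using zero_odd by (simp add: odd_functions_def)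
  have second: "second_variation (energy \<epsilon> \<gamma>) ?\<Psi> (state_of \<gamma> \<alpha> \<beta>)
      = 2 * (linear_form \<epsilon> \<eta> \<alpha> + linear_form \<epsilon> \<eta> \<beta> + 2 * weighted_norm2 \<eta> \<alpha> - coupling \<gamma> * weighted_norm2 \<eta> \<beta>) / (1 + \<gamma>)"
    and first: "((\<lambda>t. energy \<epsilon> \<gamma> (perturb ?\<Psi> (state_of \<gamma> \<alpha> \<beta>) t)) has_real_derivative 0) (at 0)"
    if ab: "\<alpha> \<in> weighted_H1" "\<beta> \<in> weighted_H1" for \<alpha> \<beta>
  proof -
    obtain c3 c4 where e: "(\<lambda>t. energy \<epsilon> \<gamma> (perturb ?\<Psi> (state_of \<gamma> \<alpha> \<beta>) t))
      = (\<lambda>t. (t\<^sup>2 * (linear_form \<epsilon> \<eta> \<alpha> + linear_form \<epsilon> \<eta> \<beta> + 2 * weighted_norm2 \<eta> \<alpha> - coupling \<gamma> * weighted_norm2 \<eta> \<beta>)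
        + t^3 * c3 + t^4 * c4 + - (1/2 * (\<integral>x. (\<eta> x)^4 \<partial>lborel))) / (1 + \<gamma>))"
      by (rule energy_perturb[OF \<gamma> ab]) (rule that)
    show "second_variation (energy \<epsilon> \<gamma>) ?\<Psi> (state_of \<gamma> \<alpha> \<beta>)
      = 2 * (linear_form \<epsilon> \<eta> \<alpha> + linear_form \<epsilon> \<eta> \<beta> + 2 * weighted_norm2 \<eta> \<alpha> - coupling \<gamma> * weighted_norm2 \<eta> \<beta>) / (1 + \<gamma>)"
      unfolding second_variation_def e by (rule polynomial_deriv_at_0(2))
    show "((\<lambda>t. energy \<epsilon> \<gamma> (perturb ?\<Psi> (state_of \<gamma> \<alpha> \<beta>) t)) has_real_derivative 0) (at 0)"
      unfolding e by (rule polynomial_deriv_at_0(1))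
  qed
  show "((\<lambda>t. energy \<epsilon> \<gamma> (perturb ?\<Psi> \<Phi> t)) has_real_derivative 0) (at 0)" if "\<Phi> \<in> sym_energy_space" for \<Phi>
    using that first unfolding sym_energy_space_state_of[OF \<gamma>] by (auto simp: odd_functions_def)
  have zero: "linear_form \<epsilon> \<eta> (\<lambda>x. 0) = 0" "weighted_norm2 \<eta> (\<lambda>x. 0) = 0"
    using linear_form_perturb(2)[OF weighted, of 0] by (simp_all add: weighted_norm2_def)
  have "1/2 \<le> weighted_norm2 \<eta> \<eta>"
    using integral_fourth_power_ge[OF small] by (simp add: weighted_norm2_def power4_eq_xxxx power2_eq_square mult.assoc)
  then have "0 < second_variation (energy \<epsilon> \<gamma>) ?\<Psi> ?\<Psi>"
    unfolding second[OF weighted z] linear_form_self zero using \<gamma> by simp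
  then show "\<exists>\<Phi>\<in>sym_energy_space. 0 < second_variation (energy \<epsilon> \<gamma>) ?\<Psi> \<Phi>"
    using symmetric_state_space[OF \<gamma>] by blast
  obtain b where b: "b \<in> odd_functions" "linear_form \<epsilon> \<eta> b < coupling \<gamma> * weighted_norm2 \<eta> b"
    by (rule rayleigh_less[OF small \<mu>])
  have bW: "b \<in> weighted_H1" using b(1) by (simp add: odd_functions_def)
  have "second_variation (energy \<epsilon> \<gamma>) ?\<Psi> (state_of \<gamma> (\<lambda>x. 0) b) < 0"
    unfolding second[OF z bW] zero using b(2) \<gamma> by (simp add: divide_less_0_iff)
  moreover have "state_of \<gamma> (\<lambda>x. 0) b \<in> sym_energy_space"
    unfolding sym_energy_space_state_of[OF \<gamma>] by (intro bexI[OF _ z] bexI[OF _ b(1)]) simp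
  ultimately show "\<exists>\<Phi>\<in>sym_energy_space. second_variation (energy \<epsilon> \<gamma>) ?\<Psi> \<Phi> < 0" by blast
qed

text \<open>Its right side is the energy of the symmetric state. A competitor strictly below that
  value is what forces minimizers to break the symmetry.\<close>

lemma energy_below_symmetric:
  assumes small: "\<epsilon> \<le> 1/4" and \<gamma>: "0 < \<gamma>" and \<mu>: "\<Lambda> < coupling \<gamma>"
  shows "\<exists>h\<in>weighted_H1. sym_energy \<epsilon> \<gamma> h < - (1/2 * (\<integral>x. (\<eta> x)^4 \<partial>lborel)) / (1 + \<gamma>)"
proof -
  let ?\<Psi> = "state_of \<gamma> \<eta> (\<lambda>x. 0)"
  obtain b where b: "b \<in> odd_functions" "linear_form \<epsilon> \<eta> b < coupling \<gamma> * weighted_norm2 \<eta> b"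
    by (rule rayleigh_less[OF small \<mu>])
  have bW: "b \<in> weighted_H1" using b(1) by (simp add: odd_functions_def)
  have z: "(\<lambda>x. 0) \<in> weighted_H1" using zero_odd by (simp add: odd_functions_def)
  define c2 where "c2 = linear_form \<epsilon> \<eta> b - coupling \<gamma> * weighted_norm2 \<eta> b"
  have c2: "c2 < 0" using b(2) by (simp add: c2_def)
  obtain c3 c4 where c: "\<And>t. excess_energy \<epsilon> \<eta> (coupling \<gamma>) (\<lambda>x. \<eta> x + t * 0) (\<lambda>x. t * b x)
      = t\<^sup>2 * (linear_form \<epsilon> \<eta> (\<lambda>x. 0) + linear_form \<epsilon> \<eta> b + 2 * weighted_norm2 \<eta> (\<lambda>x. 0) - coupling \<gamma> * weighted_norm2 \<eta> b)
        + t^3 * c3 + t^4 * c4" "(\<forall>x::real. (0::real) = 0) \<longrightarrow> c3 = 0"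
    by (rule excess_energy_perturb[OF z bW, of "coupling \<gamma>"]) (rule that)
  have zero: "linear_form \<epsilon> \<eta> (\<lambda>x. 0) = 0" "weighted_norm2 \<eta> (\<lambda>x. 0) = 0"
    using linear_form_perturb(2)[OF weighted, of 0] by (simp_all add: weighted_norm2_def)
  \<comment> \<open>Chosen so that t^2 c4 \<le> -c2/2, which keeps c2 + t^2 c4 negative; the summand
    1 guards against c4 = 0.\<close>
  define t where "t = sqrt (- c2 / (2 * (\<bar>c4\<bar> + 1)))"
  have "0 < - c2 / (2 * (\<bar>c4\<bar> + 1))" using c2 by (intro divide_pos_pos) auto
  then have t2: "t\<^sup>2 = - c2 / (2 * (\<bar>c4\<bar> + 1))" unfolding t_def by (intro real_sqrt_pow2) simp
  have t0: "0 < t\<^sup>2" unfolding t2 using c2 by (intro divide_pos_pos) auto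
  have "t\<^sup>2 * c4 \<le> t\<^sup>2 * (\<bar>c4\<bar> + 1)" by (intro mult_left_mono) auto
  also have "\<dots> = - c2 / 2" unfolding t2 by (simp add: field_simps)
  finally have "c2 + t\<^sup>2 * c4 < 0" using c2 by linarith
  then have "t\<^sup>2 * (c2 + t\<^sup>2 * c4) < 0" using t0 by (simp add: mult_less_0_iff)
  moreover have "excess_energy \<epsilon> \<eta> (coupling \<gamma>) \<eta> (\<lambda>x. t * b x) = t\<^sup>2 * (c2 + t\<^sup>2 * c4)"
    using c(1)[of t] c(2) unfolding zero by (simp add: c2_def algebra_simps power4_eq_xxxx power2_eq_square)
  ultimately have neg: "excess_energy \<epsilon> \<eta> (coupling \<gamma>) \<eta> (\<lambda>x. t * b x) < 0" by simp
  have tb: "(\<lambda>x. t * b x) \<in> odd_functions"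
    using b(1) weighted_H1_cmult(1)[OF bW, of t] by (simp add: odd_functions_def)
  have tbW: "(\<lambda>x. t * b x) \<in> weighted_H1" by (rule weighted_H1_cmult(1)[OF bW])
  have "state_of \<gamma> \<eta> (\<lambda>x. t * b x) \<in> sym_energy_space"
    using sym_energy_space_state_of[OF \<gamma>] weighted tb even by blast
  then obtain h where h: "h \<in> weighted_H1" "state_of \<gamma> \<eta> (\<lambda>x. t * b x) = (h, \<lambda>x. h (- x))"
    using sym_energy_space_iff by blast
  have "sym_energy \<epsilon> \<gamma> h = energy \<epsilon> \<gamma> (state_of \<gamma> \<eta> (\<lambda>x. t * b x))"
    unfolding h(2) by (rule energy_symmetric[OF h(1), symmetric])
  also have "\<dots> < - (1/2 * (\<integral>x. (\<eta> x)^4 \<partial>lborel)) / (1 + \<gamma>)"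
    unfolding energy_state_of[OF \<gamma> weighted tbW] using neg \<gamma> by (intro divide_strict_right_mono) auto
  finally show ?thesis using h(1) by blast
qed

text \<open>For an even function the odd part is 0, the coupling term disappears, and the excess is
  a sum of nonnegative terms. A minimizer with lower energy is therefore not even.\<close>

lemma even_state_energy:
  assumes \<gamma>: "0 < \<gamma>" and f: "f \<in> weighted_H1" and even: "\<And>x. f (- x) = f x"
  shows "- (1/2 * (\<integral>x. (\<eta> x)^4 \<partial>lborel)) / (1 + \<gamma>) \<le> sym_energy \<epsilon> \<gamma> f"
proof -
  define k where "k = (1 + \<gamma>) powr (- 1/2)"
  have k: "k \<noteq> 0" unfolding k_def using \<gamma> by simp
  have a: "(\<lambda>x. 1/k * f x) \<in> weighted_H1" by (rule weighted_H1_cmult(1)[OF f])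
  have z: "(\<lambda>x. 0) \<in> weighted_H1" using zero_odd by (simp add: odd_functions_def)
  have st: "state_of \<gamma> (\<lambda>x. 1/k * f x) (\<lambda>x. 0) = (f, \<lambda>x. f (- x))"
    unfolding state_of_def k_def[symmetric] using k by (simp add: even)
  have "sym_energy \<epsilon> \<gamma> f = energy \<epsilon> \<gamma> (state_of \<gamma> (\<lambda>x. 1/k * f x) (\<lambda>x. 0))"
    unfolding st by (rule energy_symmetric[OF f, symmetric])
  also have "\<dots> = (excess_energy \<epsilon> \<eta> (coupling \<gamma>) (\<lambda>x. 1/k * f x) (\<lambda>x. 0) - 1/2 * (\<integral>x. (\<eta> x)^4 \<partial>lborel)) / (1 + \<gamma>)"
    by (rule energy_state_of[OF \<gamma> a z])
  finally have e: "sym_energy \<epsilon> \<gamma> f = (excess_energy \<epsilon> \<eta> (coupling \<gamma>) (\<lambda>x. 1/k * f x) (\<lambda>x. 0) - 1/2 * (\<integral>x. (\<eta> x)^4 \<partial>lborel)) / (1 + \<gamma>)" .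
  have "0 \<le> excess_energy \<epsilon> \<eta> (coupling \<gamma>) (\<lambda>x. 1/k * f x) (\<lambda>x. 0)"
    unfolding excess_energy_def
    by (intro add_nonneg_nonneg linear_form_nonneg a z Bochner_Integration.integral_nonneg) simp
  then show ?thesis unfolding e using \<gamma> by (intro divide_right_mono) auto
qed

end

section \<open>Domain walls\<close>

lemma second_derivative_reflect:
  fixes f f1 f2 :: "real \<Rightarrow> real"
  assumes "\<And>x. (f has_real_derivative f1 x) (at x)" "\<And>x. (f1 has_real_derivative f2 x) (at x)"
  shows "((\<lambda>x. f (- x)) has_real_derivative - f1 (- x)) (at x)"
    "((\<lambda>x. - f1 (- x)) has_real_derivative f2 (- x)) (at x)"
proof -
  show "((\<lambda>x. f (- x)) has_real_derivative - f1 (- x)) (at x)"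
    by (rule DERIV_cong[OF DERIV_chain2[OF assms(1)]]) (auto intro!: derivative_eq_intros)
  show "((\<lambda>x. - f1 (- x)) has_real_derivative f2 (- x)) (at x)"
    by (rule DERIV_cong[OF DERIV_minus[OF DERIV_chain2[OF assms(2)]]]) (auto intro!: derivative_eq_intros)
qed

text \<open>The energy of the minimizer is too low for it to be zero and too low for it to be even.
  These two exclusions rule out a zero of F and, on the positive axis, a zero of F - G.\<close>

lemma (in scalar_state) domain_wall_minimizer:
  assumes small: "\<epsilon> \<le> 1/4" and \<gamma>: "0 < \<gamma>" and \<mu>: "\<Lambda> < coupling \<gamma>"
  shows "\<exists>\<psi>1 \<psi>2. domain_wall_state \<epsilon> \<gamma> (\<psi>1, \<psi>2) \<and>
    global_minimizer (energy \<epsilon> \<gamma>) sym_energy_space (\<psi>1, \<psi>2) \<and>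
    (\<forall>x>0. \<psi>1 x > \<psi>2 x \<and> \<psi>2 x > 0) \<and>
    domain_wall_state \<epsilon> \<gamma> (\<psi>2, \<psi>1) \<and>
    global_minimizer (energy \<epsilon> \<gamma>) sym_energy_space (\<psi>2, \<psi>1)"
proof -
  obtain F F1 where F: "F \<in> weighted_H1" "\<And>h. h \<in> weighted_H1 \<Longrightarrow> sym_energy \<epsilon> \<gamma> F \<le> sym_energy \<epsilon> \<gamma> h"
    "\<And>x. 0 \<le> F x" "\<And>x. 0 \<le> x \<Longrightarrow> F (- x) \<le> F x"
    and F1: "\<And>x. (F has_real_derivative F1 x) (at x)" "\<And>x. (F1 has_real_derivative reaction \<gamma> F x / \<epsilon>\<^sup>2) (at x)"
    by (rule sym_energy_minimizer[OF \<epsilon> less_imp_le[OF \<gamma>]]) (rule that)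
  \<comment> \<open>The energy of the symmetric state, at which the excess vanishes.\<close>
  define e0 where "e0 = - (1/2 * (\<integral>x. (\<eta> x)^4 \<partial>lborel)) / (1 + \<gamma>)"
  have "0 \<le> 1/2 * (\<integral>x. (\<eta> x)^4 \<partial>lborel)" by simp
  then have e0: "e0 \<le> 0" unfolding e0_def using \<gamma> by (intro divide_nonpos_pos) auto
  obtain h where h: "h \<in> weighted_H1" "sym_energy \<epsilon> \<gamma> h < e0"
    using energy_below_symmetric[OF small \<gamma> \<mu>] unfolding e0_def by blast
  then have less: "sym_energy \<epsilon> \<gamma> F < e0" using F(2)[OF h(1)] by linarith
  define G where "G x = F (- x)" for x
  have cF: "continuous_on UNIV F" by (rule weighted_H1_continuous[OF F(1)])
  have cG: "continuous_on UNIV G" unfolding G_def[abs_def]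
    by (rule continuous_on_compose2[OF cF]) (auto intro: continuous_intros)
  note G1 = second_derivative_reflect[OF F1]
  have pos: "0 < F x" for x
  proof (rule ccontr)
    assume "\<not> 0 < F x"
    then have 0: "F x = 0" using F(3)[of x] by simp
    have "F z = 0" for z
    proof (rule nonneg_solution_touching_zero[OF F1(1), of "\<lambda>x. (x\<^sup>2 - 1 + (F x)\<^sup>2 + \<gamma> * (G x)\<^sup>2) / \<epsilon>\<^sup>2" UNIV x])
      show "(F1 has_real_derivative (x\<^sup>2 - 1 + (F x)\<^sup>2 + \<gamma> * (G x)\<^sup>2) / \<epsilon>\<^sup>2 * F x) (at x)" for x
        using F1(2)[of x] by (simp add: reaction_def G_def algebra_simps power2_eq_square power3_eq_cube)
      show "continuous_on UNIV (\<lambda>x. (x\<^sup>2 - 1 + (F x)\<^sup>2 + \<gamma> * (G x)\<^sup>2) / \<epsilon>\<^sup>2)"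
        using \<epsilon> by (intro continuous_intros cF cG) auto
    qed (use F(3) 0 in auto)
    then have "F = (\<lambda>x. 0)" by auto
    moreover have "primitive (\<lambda>x. 0) (\<lambda>x. 0)" by (rule primitive_C1) auto
    ultimately have "sym_energy \<epsilon> \<gamma> F = 0"
      using sym_energy_eq[OF F(1), of "\<lambda>x. 0" \<epsilon> \<gamma>] by (simp add: sym_density_def)
    then show False using less e0 by simp
  qed
  have strict: "F (- x0) < F x0" if x0: "0 < x0" for x0
  proof (rule ccontr)
    assume "\<not> F (- x0) < F x0"
    then have 0: "F x0 - G x0 = 0" using F(4)[of x0] x0 by (simp add: G_def)
    \<comment> \<open>Subtracting the two equations, F - G factors out of F^3 - G^3 + \<gamma> F G
      (G - F), so the difference solves a linear equation. It is known to be nonnegative only for x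
      > 0, hence the choice of S; the conclusion still holds on the whole line.\<close>
    have "F z - G z = 0" for z
    proof (rule nonneg_solution_touching_zero[where y = "\<lambda>x. F x - G x" and ?y1.0 = "\<lambda>x. F1 x - - F1 (- x)"
        and c = "\<lambda>x. (x\<^sup>2 - 1 + (F x)\<^sup>2 + (1 - \<gamma>) * F x * G x + (G x)\<^sup>2) / \<epsilon>\<^sup>2" and S = "{0<..}" and ?x0.0 = x0])
      show "((\<lambda>x. F x - G x) has_real_derivative F1 x - - F1 (- x)) (at x)" for x
        unfolding G_def[abs_def] by (rule DERIV_diff[OF F1(1) G1(1)])
      show "((\<lambda>x. F1 x - - F1 (- x)) has_real_derivative
          (x\<^sup>2 - 1 + (F x)\<^sup>2 + (1 - \<gamma>) * F x * G x + (G x)\<^sup>2) / \<epsilon>\<^sup>2 * (F x - G x)) (at x)" for x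
      proof (rule DERIV_cong[OF DERIV_diff[OF F1(2) G1(2)]])
        have "reaction \<gamma> F x - reaction \<gamma> F (- x)
            = (x\<^sup>2 - 1 + (F x)\<^sup>2 + (1 - \<gamma>) * F x * G x + (G x)\<^sup>2) * (F x - G x)"
          by (simp add: reaction_def G_def algebra_simps power2_eq_square power3_eq_cube)
        then show "reaction \<gamma> F x / \<epsilon>\<^sup>2 - reaction \<gamma> F (- x) / \<epsilon>\<^sup>2
            = (x\<^sup>2 - 1 + (F x)\<^sup>2 + (1 - \<gamma>) * F x * G x + (G x)\<^sup>2) / \<epsilon>\<^sup>2 * (F x - G x)"
          by (simp add: diff_divide_distrib[symmetric])
      qed
      show "continuous_on UNIV (\<lambda>x. (x\<^sup>2 - 1 + (F x)\<^sup>2 + (1 - \<gamma>) * F x * G x + (G x)\<^sup>2) / \<epsilon>\<^sup>2)"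
        using \<epsilon> by (intro continuous_intros cF cG) auto
      show "0 \<le> F x - G x" if "x \<in> {0<..}" for x using F(4)[of x] that by (simp add: G_def)
    qed (use x0 0 in auto)
    then have "F (- x) = F x" for x by (simp add: G_def)
    then have "e0 \<le> sym_energy \<epsilon> \<gamma> F" unfolding e0_def by (rule even_state_energy[OF \<gamma> F(1)])
    then show False using less by simp
  qed
  have sd: "has_second_derivative F (\<lambda>x. reaction \<gamma> F x / \<epsilon>\<^sup>2)"
    "has_second_derivative G (\<lambda>x. reaction \<gamma> F (- x) / \<epsilon>\<^sup>2)"
    unfolding has_second_derivative_def G_def[abs_def]
    by (intro exI[of _ F1] conjI allI F1) (intro exI[of _ "\<lambda>x. - F1 (- x)"] conjI allI G1)
  have canc: "- \<epsilon>\<^sup>2 * (r / \<epsilon>\<^sup>2) = - r" for r using \<epsilon> by simp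
  have eq1: "- \<epsilon>\<^sup>2 * (reaction \<gamma> F x / \<epsilon>\<^sup>2) + x\<^sup>2 * F x + ((F x)\<^sup>2 + \<gamma> * (G x)\<^sup>2 - 1) * F x = 0" for x
    unfolding canc by (simp add: reaction_def G_def algebra_simps power2_eq_square power3_eq_cube)
  have eq2: "- \<epsilon>\<^sup>2 * (reaction \<gamma> F (- x) / \<epsilon>\<^sup>2) + x\<^sup>2 * G x + (\<gamma> * (F x)\<^sup>2 + (G x)\<^sup>2 - 1) * G x = 0" for x
    unfolding canc by (simp add: reaction_def G_def algebra_simps power2_eq_square power3_eq_cube)
  have eq1': "- \<epsilon>\<^sup>2 * (reaction \<gamma> F x / \<epsilon>\<^sup>2) + x\<^sup>2 * F x + (\<gamma> * (G x)\<^sup>2 + (F x)\<^sup>2 - 1) * F x = 0"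
    and eq2': "- \<epsilon>\<^sup>2 * (reaction \<gamma> F (- x) / \<epsilon>\<^sup>2) + x\<^sup>2 * G x + ((G x)\<^sup>2 + \<gamma> * (F x)\<^sup>2 - 1) * G x = 0" for x
  proof -
    show "- \<epsilon>\<^sup>2 * (reaction \<gamma> F x / \<epsilon>\<^sup>2) + x\<^sup>2 * F x + (\<gamma> * (G x)\<^sup>2 + (F x)\<^sup>2 - 1) * F x = 0"
      using eq1[of x] by (simp only: add.commute[of "\<gamma> * (G x)\<^sup>2" "(F x)\<^sup>2"])
    show "- \<epsilon>\<^sup>2 * (reaction \<gamma> F (- x) / \<epsilon>\<^sup>2) + x\<^sup>2 * G x + ((G x)\<^sup>2 + \<gamma> * (F x)\<^sup>2 - 1) * G x = 0"
      using eq2[of x] by (simp only: add.commute[of "(G x)\<^sup>2" "\<gamma> * (F x)\<^sup>2"])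
  qed
  have ne: "F \<noteq> G" using strict[of 1] by (auto simp: G_def fun_eq_iff intro!: exI[of _ 1])
  have el: "euler_lagrange \<epsilon> \<gamma> (F, G)" "euler_lagrange \<epsilon> \<gamma> (G, F)"
    unfolding euler_lagrange.simps using sd eq1 eq2 eq1' eq2' by blast+
  have dw: "domain_wall_state \<epsilon> \<gamma> (F, G)" "domain_wall_state \<epsilon> \<gamma> (G, F)"
    unfolding domain_wall_state.simps using el ne by (auto simp: G_def)
  have FG: "(\<lambda>x. F (- x)) = G" "(\<lambda>x. G (- x)) = F" by (simp_all add: G_def fun_eq_iff)
  have "global_minimizer (energy \<epsilon> \<gamma>) sym_energy_space (F, \<lambda>x. F (- x))"
    by (rule global_minimizer_symmetric[OF F(1,2)])
  then have mF: "global_minimizer (energy \<epsilon> \<gamma>) sym_energy_space (F, G)" unfolding FG .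
  have "global_minimizer (energy \<epsilon> \<gamma>) sym_energy_space (G, \<lambda>x. G (- x))"
  proof (rule global_minimizer_symmetric)
    show "G \<in> weighted_H1" unfolding G_def[abs_def] by (rule weighted_H1_reflect(1)[OF F(1)])
    show "sym_energy \<epsilon> \<gamma> G \<le> sym_energy \<epsilon> \<gamma> h" if "h \<in> weighted_H1" for h
      unfolding G_def[abs_def] sym_energy_reflect[OF F(1)] by (rule F(2)[OF that])
  qed
  then have mG: "global_minimizer (energy \<epsilon> \<gamma>) sym_energy_space (G, F)" unfolding FG .
  have "\<forall>x>0. F x > G x \<and> G x > 0" using strict pos by (simp add: G_def)
  with dw mF mG show ?thesis by blast
qed

section \<open>The threshold in terms of \<gamma> and the conclusion\<close>

text \<open>Solving 2 (\<gamma> - 1) / (\<gamma> + 1) = l for \<gamma> gives the formula for the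
  threshold, which is finite because l < 2.\<close>

lemma coupling_le_iff:
  assumes "0 < \<gamma>" "0 < l" "l < 2"
  shows "coupling \<gamma> \<le> l \<longleftrightarrow> \<gamma> \<le> (2 + l) / (2 - l)"
proof -
  have "coupling \<gamma> \<le> l \<longleftrightarrow> 2 * (\<gamma> - 1) \<le> l * (\<gamma> + 1)"
    unfolding coupling_def using assms by (simp add: pos_divide_le_eq)
  also have "\<dots> \<longleftrightarrow> \<gamma> * (2 - l) \<le> 2 + l" by (simp add: algebra_simps)
  also have "\<dots> \<longleftrightarrow> \<gamma> \<le> (2 + l) / (2 - l)" using assms by (simp add: pos_le_divide_eq)
  finally show ?thesis .
qed

theorem theorem3:
  shows "\<exists>\<epsilon>0 > (0::real). \<exists>\<gamma>0 :: real \<Rightarrow> real.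
    (\<forall>\<epsilon>. 0 < \<epsilon> \<and> \<epsilon> < \<epsilon>0 \<longrightarrow>
      (\<exists>!\<eta>. positive_scalar_state \<epsilon> \<eta>) \<and>
      1 < \<gamma>0 \<epsilon> \<and>
      (\<forall>\<gamma>. 0 < \<gamma> \<and> \<gamma> \<le> \<gamma>0 \<epsilon> \<longrightarrow>
        global_minimizer (energy \<epsilon> \<gamma>) sym_energy_space (symmetric_state \<epsilon> \<gamma>)) \<and>
      (\<forall>\<gamma>. \<gamma>0 \<epsilon> < \<gamma> \<longrightarrow>
        saddle_point (energy \<epsilon> \<gamma>) sym_energy_space (symmetric_state \<epsilon> \<gamma>)) \<and>
      (\<forall>\<gamma>. \<gamma>0 \<epsilon> < \<gamma> \<longrightarrow>
        (\<exists>\<psi>1 \<psi>2.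
          domain_wall_state \<epsilon> \<gamma> (\<psi>1, \<psi>2) \<and>
          global_minimizer (energy \<epsilon> \<gamma>) sym_energy_space (\<psi>1, \<psi>2) \<and>
          (\<forall>x>0. \<psi>1 x > \<psi>2 x \<and> \<psi>2 x > 0) \<and>
          domain_wall_state \<epsilon> \<gamma> (\<psi>2, \<psi>1) \<and>
          global_minimizer (energy \<epsilon> \<gamma>) sym_energy_space (\<psi>2, \<psi>1)))) \<and>
    (\<gamma>0 \<longlongrightarrow> 1) (at_right 0)"
proof -
  define C :: real where "C = 64/3 / (arctan (1/8))\<^sup>2"
  have C: "0 < C" unfolding C_def by (simp add: zero_less_arctan_iff)
  \<comment> \<open>The bound 1/4 is the one under which the tent estimates hold. The bound 1/C
    turns l \<le> C \<epsilon>^2 into l < \<epsilon>, which gives both l < 2 and the limit.\<close>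
  define \<epsilon>0 where "\<epsilon>0 = min (1/4) (1/C)"
  have \<epsilon>0: "0 < \<epsilon>0" unfolding \<epsilon>0_def using C by simp
  \<comment> \<open>For \<epsilon> outside (0, \<epsilon>0) the description behind
    \<open>eta\<close> carries no guarantee; the limit at 0 from the right only sees values where
    existence and uniqueness have been proved.\<close>
  define l where "l \<epsilon> = rayleigh_infimum \<epsilon> (eta \<epsilon>)" for \<epsilon>
  define \<gamma>0 where "\<gamma>0 \<epsilon> = (2 + l \<epsilon>) / (2 - l \<epsilon>)" for \<epsilon>
  have state: "\<exists>!\<eta>. positive_scalar_state \<epsilon> \<eta>" "\<exists>\<eta>' \<eta>''. scalar_state \<epsilon> (eta \<epsilon>) \<eta>' \<eta>''"
    "0 < l \<epsilon>" "l \<epsilon> < \<epsilon>" "\<epsilon> < 1/4" if \<epsilon>: "0 < \<epsilon>" "\<epsilon> < \<epsilon>0" for \<epsilon>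
  proof -
    show small: "\<epsilon> < 1/4" using \<epsilon> unfolding \<epsilon>0_def by simp
    show ex1: "\<exists>!\<eta>. positive_scalar_state \<epsilon> \<eta>"
    proof (rule ex_ex1I)
      show "\<exists>\<eta>. positive_scalar_state \<epsilon> \<eta>" by (rule positive_scalar_state_exists) (use \<epsilon> small in auto)
      show "\<eta> = \<zeta>" if "positive_scalar_state \<epsilon> \<eta>" "positive_scalar_state \<epsilon> \<zeta>" for \<eta> \<zeta>
        using positive_scalar_state_locale[OF \<epsilon>(1) that(1)] positive_scalar_state_locale[OF \<epsilon>(1) that(2)]
          scalar_state_unique by metis
    qed
    have "positive_scalar_state \<epsilon> (eta \<epsilon>)" unfolding eta_def by (rule theI'[OF ex1])
    then obtain \<eta>' \<eta>'' where s: "scalar_state \<epsilon> (eta \<epsilon>) \<eta>' \<eta>''"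
      by (rule positive_scalar_state_locale[OF \<epsilon>(1)])
    then show "\<exists>\<eta>' \<eta>''. scalar_state \<epsilon> (eta \<epsilon>) \<eta>' \<eta>''" by blast
    show "0 < l \<epsilon>" unfolding l_def by (rule scalar_state.rayleigh_bounds(1)[OF s]) (use small in simp)
    have "l \<epsilon> \<le> C * \<epsilon>\<^sup>2" unfolding l_def C_def by (rule scalar_state.rayleigh_bounds(2)[OF s]) (use small in simp)
    also have "\<epsilon> < 1/C" using \<epsilon> unfolding \<epsilon>0_def by simp
    then have "C * \<epsilon> < 1" using C by (simp add: field_simps)
    then have "(C * \<epsilon>) * \<epsilon> < 1 * \<epsilon>" using \<epsilon>(1) by (rule mult_strict_right_mono)
    then have "C * \<epsilon>\<^sup>2 < \<epsilon>" by (simp add: power2_eq_square mult.assoc)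
    finally show "l \<epsilon> < \<epsilon>" .
  qed
  have sym: "symmetric_state \<epsilon> \<gamma> = state_of \<gamma> (eta \<epsilon>) (\<lambda>x. 0)" for \<epsilon> \<gamma>
    by (simp add: symmetric_state_def state_of_def)
  have main: "(\<exists>!\<eta>. positive_scalar_state \<epsilon> \<eta>) \<and> 1 < \<gamma>0 \<epsilon> \<and>
      (\<forall>\<gamma>. 0 < \<gamma> \<and> \<gamma> \<le> \<gamma>0 \<epsilon> \<longrightarrow> global_minimizer (energy \<epsilon> \<gamma>) sym_energy_space (symmetric_state \<epsilon> \<gamma>)) \<and>
      (\<forall>\<gamma>. \<gamma>0 \<epsilon> < \<gamma> \<longrightarrow> saddle_point (energy \<epsilon> \<gamma>) sym_energy_space (symmetric_state \<epsilon> \<gamma>)) \<and>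
      (\<forall>\<gamma>. \<gamma>0 \<epsilon> < \<gamma> \<longrightarrow>
        (\<exists>\<psi>1 \<psi>2. domain_wall_state \<epsilon> \<gamma> (\<psi>1, \<psi>2) \<and>
          global_minimizer (energy \<epsilon> \<gamma>) sym_energy_space (\<psi>1, \<psi>2) \<and>
          (\<forall>x>0. \<psi>1 x > \<psi>2 x \<and> \<psi>2 x > 0) \<and>
          domain_wall_state \<epsilon> \<gamma> (\<psi>2, \<psi>1) \<and>
          global_minimizer (energy \<epsilon> \<gamma>) sym_energy_space (\<psi>2, \<psi>1)))" if \<epsilon>: "0 < \<epsilon>" "\<epsilon> < \<epsilon>0" for \<epsilon>
  proof -
    note st = state[OF \<epsilon>]
    obtain \<eta>' \<eta>'' where s: "scalar_state \<epsilon> (eta \<epsilon>) \<eta>' \<eta>''" using st(2) by blast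
    have l2: "l \<epsilon> < 2" using st(4,5) by linarith
    have small: "\<epsilon> \<le> 1/4" using st(5) by simp
    have \<gamma>1: "1 < \<gamma>0 \<epsilon>" unfolding \<gamma>0_def using st(3) l2 by (simp add: less_divide_eq)
    have large: "0 < \<gamma>" "rayleigh_infimum \<epsilon> (eta \<epsilon>) < coupling \<gamma>" if "\<gamma>0 \<epsilon> < \<gamma>" for \<gamma>
    proof -
      show "0 < \<gamma>" using that \<gamma>1 by linarith
      then show "rayleigh_infimum \<epsilon> (eta \<epsilon>) < coupling \<gamma>"
        using coupling_le_iff[of \<gamma> "l \<epsilon>"] st(3) l2 that unfolding \<gamma>0_def l_def by linarith
    qed
    show ?thesis
      unfolding sym
    proof (intro conjI allI impI)
      show "\<exists>!\<eta>. positive_scalar_state \<epsilon> \<eta>" by (rule st(1))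
      show "1 < \<gamma>0 \<epsilon>" by (rule \<gamma>1)
      show "global_minimizer (energy \<epsilon> \<gamma>) sym_energy_space (state_of \<gamma> (eta \<epsilon>) (\<lambda>x. 0))" if "0 < \<gamma> \<and> \<gamma> \<le> \<gamma>0 \<epsilon>" for \<gamma>
      proof (rule scalar_state.symmetric_state_minimizer[OF s])
        show "0 < \<gamma>" using that by simp
        then show "coupling \<gamma> \<le> rayleigh_infimum \<epsilon> (eta \<epsilon>)"
          using coupling_le_iff[of \<gamma> "l \<epsilon>"] st(3) l2 that unfolding \<gamma>0_def l_def by blast
      qed (use st(3) l2 in \<open>simp_all add: l_def\<close>)
      show "saddle_point (energy \<epsilon> \<gamma>) sym_energy_space (state_of \<gamma> (eta \<epsilon>) (\<lambda>x. 0))" if "\<gamma>0 \<epsilon> < \<gamma>" for \<gamma>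
        by (rule scalar_state.symmetric_state_saddle[OF s small large[OF that]])
      show "\<exists>\<psi>1 \<psi>2. domain_wall_state \<epsilon> \<gamma> (\<psi>1, \<psi>2) \<and>
          global_minimizer (energy \<epsilon> \<gamma>) sym_energy_space (\<psi>1, \<psi>2) \<and>
          (\<forall>x>0. \<psi>1 x > \<psi>2 x \<and> \<psi>2 x > 0) \<and>
          domain_wall_state \<epsilon> \<gamma> (\<psi>2, \<psi>1) \<and>
          global_minimizer (energy \<epsilon> \<gamma>) sym_energy_space (\<psi>2, \<psi>1)" if "\<gamma>0 \<epsilon> < \<gamma>" for \<gamma>
        by (rule scalar_state.domain_wall_minimizer[OF s small large[OF that]])
    qed
  qed
  have "(l \<longlongrightarrow> 0) (at_right 0)"
  proof (rule tendsto_sandwich[OF _ _ tendsto_const])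
    have ev: "\<forall>\<^sub>F \<epsilon> in at_right 0. 0 < \<epsilon> \<and> \<epsilon> < \<epsilon>0"
      using \<epsilon>0 unfolding eventually_at_right_field by blast
    show "\<forall>\<^sub>F \<epsilon> in at_right 0. 0 \<le> l \<epsilon>" "\<forall>\<^sub>F \<epsilon> in at_right 0. l \<epsilon> \<le> \<epsilon>"
      using ev state(3,4) by (auto elim!: eventually_mono intro: less_imp_le)
    show "((\<lambda>\<epsilon>::real. \<epsilon>) \<longlongrightarrow> 0) (at_right 0)" by (rule tendsto_ident_at)
  qed
  then have "((\<lambda>\<epsilon>. (2 + l \<epsilon>) / (2 - l \<epsilon>)) \<longlongrightarrow> (2 + 0) / (2 - 0)) (at_right 0)"
    by (intro tendsto_intros) auto
  then have lim: "(\<gamma>0 \<longlongrightarrow> 1) (at_right 0)" by (simp add: \<gamma>0_def[abs_def])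
  show ?thesis
    by (rule exI[of _ \<epsilon>0]) (intro conjI \<epsilon>0 exI[of _ \<gamma>0] lim; (intro allI impI, rule main; simp))
qed

end
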